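(* Let $\gamma\in[-1,1]$ and, for each $N\ge 1$, let $X=X_N$ be the normalized $N\times N$ complex Gaussian elliptic matrix with parameter $\gamma$. Let $p,q\ge 1$ be integers. Then the following limits exist and are given as follows. (i) Pure powers: $$\lim_{N\to\infty}\kappa_2\left(\operatorname{Tr} X^{p},\operatorname{Tr} X^{q}\right)=\sum_{a=1}^{\min\{p,q\}} a\,\gamma^{\frac{p+q}{2}}\binom{p}{\frac{p-a}{2}}\binom{q}{\frac{q-a}{2}}.$$ (ii) Pure power versus adjoint power: $$\lim_{N\to\infty}\kappa_2\left(\operatorname{Tr} X^{p},\operatorname{Tr} (X^{*})^{q}\right)=\sum_{a=1}^{\min\{p,q\}} a\,\gamma^{\frac{p+q}{2}-a}\binom{p}{\frac{p-a}{2}}\binom{q}{\frac{q-a}{2}}.$$ (iii) Alternating words: $$\lim_{N\to\infty}\kappa_2\left(\operatorname{Tr}(XX^{*})^{p},\operatorname{Tr}(XX^{*})^{q}\right)=\sum_{a=1}^{\min\{p,q\}} a\,(\gamma^{2a}+1)\binom{2p}{p-a}\binom{2q}{q-a}.$$ In (i) and (ii), only terms with $a\equiv p\equiv q \pmod 2$ contribute: a summand in which $\frac{p-a}{2}$ or $\frac{q-a}{2}$ is not an integer is $0$.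
   Context: A complex $N\times N$ Gaussian elliptic matrix of parameter $\gamma\in[-1,1]$ is a random matrix $(X_{ij})_{i,j=1}^N$ such that: (1) $\{X_{ii}:1\le i\le N\}\cup\{(X_{ij},X_{ji}):1\le i<j\le N\}$ is a collection of independent random elements; (2) the pairs $(X_{ij},X_{ji})$, $i<j$, are i.i.d. centered (jointly complex) Gaussian with $\mathbb E X_{ij}^2=\mathbb E X_{ji}^2=\mathbb E X_{ij}\overline{X_{ji}}=0$, $\mathbb E|X_{ij}|^2=\mathbb E|X_{ji}|^2=1$, $\mathbb E X_{ij}X_{ji}=\gamma$; (3) the $X_{ii}$ are i.i.d. centered (complex) Gaussian with $\mathbb E|X_{ii}|^2=1$ and $\mathbb E X_{ii}^2=\gamma$. The normalized matrix is $X_N=\frac{1}{\sqrt N}(X_{ij})_{i,j=1}^N$. $\operatorname{Tr}$ is the unnormalized trace and $X^*$ is the conjugate transpose. For complex random variables, $\kappa_2(\xi_1,\xi_2)=\mathbb E(\xi_1\xi_2)-\mathbb E(\xi_1)\mathbb E(\xi_2)$ (bilinear, no complex conjugation). Convention: $\binom{n}{x}=0$ if $x$ is not an integer, and $0^0=1$. *)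

theory Defs
  imports "HOL-Probability.Probability" "Jordan_Normal_Form.Schur_Decomposition"
begin

(* Leaves \<bullet> to the inner product of real_inner. *)
no_notation Matrix.scalar_prod (infix \<open>\<bullet>\<close> 70)

text \<open>
  Constants count as Gaussian: for \<open>\<gamma> = 1\<close> or \<open>\<gamma> = -1\<close> the entries of an elliptic matrix
  have degenerate joint laws.
\<close>

definition gaussian_rv :: "'a measure \<Rightarrow> ('a \<Rightarrow> real) \<Rightarrow> bool" where
  "gaussian_rv M Y \<longleftrightarrow> Y \<in> borel_measurable M \<and>
     ((\<exists>\<mu> \<sigma>. 0 < \<sigma> \<and> distributed M lborel Y (normal_density \<mu> \<sigma>)) \<or>
      (\<exists>\<mu>. AE \<omega> in M. Y \<omega> = \<mu>))"

text \<open>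
  The inner product is the real one, so for \<open>'b = complex\<close> and \<open>'b = complex \<times> complex\<close> this
  is joint Gaussianity of all real and imaginary parts, without circular symmetry.
\<close>

definition centered_gaussian :: "'a measure \<Rightarrow> ('a \<Rightarrow> 'b::euclidean_space) \<Rightarrow> bool" where
  "centered_gaussian M Z \<longleftrightarrow> Z \<in> borel_measurable M \<and>
     (\<forall>v. gaussian_rv M (\<lambda>\<omega>. v \<bullet> Z \<omega>)) \<and> (\<integral>\<omega>. Z \<omega> \<partial>M) = 0"

text \<open>
  Indices run over \<open>{..<N}\<close>.  In the independence clause the index \<open>(i, i)\<close> carries
  the pair \<open>(X i i, X i i)\<close>, which generates the same \<open>\<sigma>\<close>-algebra as \<open>X i i\<close>.
\<close>

definition elliptic_entries ::
    "'a measure \<Rightarrow> real \<Rightarrow> nat \<Rightarrow> (nat \<Rightarrow> nat \<Rightarrow> 'a \<Rightarrow> complex) \<Rightarrow> bool" where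
  "elliptic_entries M \<gamma> N X \<longleftrightarrow>
     prob_space M \<and>
     prob_space.indep_vars M (\<lambda>_. borel :: (complex \<times> complex) measure)
       (\<lambda>(i, j) \<omega>. (X i j \<omega>, X j i \<omega>)) {(i, j). i \<le> j \<and> j < N} \<and>
     (\<forall>i j. i < j \<and> j < N \<longrightarrow>
        centered_gaussian M (\<lambda>\<omega>. (X i j \<omega>, X j i \<omega>)) \<and>
        (\<integral>\<omega>. (X i j \<omega>)\<^sup>2 \<partial>M) = 0 \<and>
        (\<integral>\<omega>. (X j i \<omega>)\<^sup>2 \<partial>M) = 0 \<and>
        (\<integral>\<omega>. X i j \<omega> * cnj (X j i \<omega>) \<partial>M) = 0 \<and>
        (\<integral>\<omega>. (cmod (X i j \<omega>))\<^sup>2 \<partial>M) = 1 \<and>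
        (\<integral>\<omega>. (cmod (X j i \<omega>))\<^sup>2 \<partial>M) = 1 \<and>
        (\<integral>\<omega>. X i j \<omega> * X j i \<omega> \<partial>M) = complex_of_real \<gamma>) \<and>
     (\<forall>i j k l. i < j \<and> j < N \<and> k < l \<and> l < N \<longrightarrow>
        distr M (borel :: (complex \<times> complex) measure) (\<lambda>\<omega>. (X i j \<omega>, X j i \<omega>)) =
        distr M borel (\<lambda>\<omega>. (X k l \<omega>, X l k \<omega>))) \<and>
     (\<forall>i<N. centered_gaussian M (X i i) \<and>
        (\<integral>\<omega>. (cmod (X i i \<omega>))\<^sup>2 \<partial>M) = 1 \<and>
        (\<integral>\<omega>. (X i i \<omega>)\<^sup>2 \<partial>M) = complex_of_real \<gamma>) \<and>
     (\<forall>i<N. \<forall>k<N. distr M (borel :: complex measure) (X i i) = distr M borel (X k k))"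

definition normalized_mat ::
    "nat \<Rightarrow> (nat \<Rightarrow> nat \<Rightarrow> 'a \<Rightarrow> complex) \<Rightarrow> 'a \<Rightarrow> complex mat" where
  "normalized_mat N X \<omega> =
     complex_of_real (1 / sqrt (real N)) \<cdot>\<^sub>m mat N N (\<lambda>(i, j). X i j \<omega>)"

definition Tr :: "'b::comm_monoid_add mat \<Rightarrow> 'b" where
  "Tr A = (\<Sum>i<dim_row A. A $$ (i, i))"

definition cumulant2 :: "'a measure \<Rightarrow> ('a \<Rightarrow> complex) \<Rightarrow> ('a \<Rightarrow> complex) \<Rightarrow> complex" where
  "cumulant2 M \<xi> \<eta> = (\<integral>\<omega>. \<xi> \<omega> * \<eta> \<omega> \<partial>M) - (\<integral>\<omega>. \<xi> \<omega> \<partial>M) * (\<integral>\<omega>. \<eta> \<omega> \<partial>M)"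

text \<open>The binomial coefficient with a real lower entry, zero unless that entry is a natural
  number.  A factor \<open>binom_real n ((n - a) / 2)\<close> with \<open>a \<le> n\<close> thus vanishes unless \<open>a\<close> and \<open>n\<close> have the same
  parity, so in products of two of them exponents such as \<open>(p + q) div 2\<close> are exact divisions
  whenever the product is nonzero.\<close>

definition binom_real :: "nat \<Rightarrow> real \<Rightarrow> real" where
  "binom_real n x = (if x \<in> \<nat> then real (n choose nat \<lfloor>x\<rfloor>) else 0)"

end

theory Submission
  imports Defs
begin

text \<open>
  Gaussian integration by parts expresses the expectation of a product of centred traces of words in
  \<open>X\<close> and \<open>X\<^sup>*\<close> through such products with two letters fewer.  By induction on the number of
  letters all of them converge as \<open>N\<close> tends to infinity, as do the normalised traces, and in the
  limit only the terms of leading order survive: the limits \<open>m w\<close> of \<open>E[Tr w] / N\<close> and \<open>k u v\<close> of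
  the covariances satisfy a closed recursion.  This recursion is the one for noncrossing pairings of a
  disc and of an annulus, in which a pair of letters \<open>b\<close>, \<open>b'\<close> has weight \<open>\<gamma>\<close> or \<open>1\<close> according to
  whether \<open>b = b'\<close>.  For the words of the theorem the weight depends only on the number \<open>a\<close> of pairs
  joining the two circles and on the rotation by which they are joined, so that the recursion is
  solved by binomial and ballot numbers; the factor \<open>a\<close> counts the rotations.
\<close>

section \<open>Wick recursion for Gaussian spaces\<close>

text \<open>For \<gamma> = 1 or \<gamma> = -1 the entries have no joint density, so integration by
  parts cannot start from one. Its source is the recursion E[f^(n+1)] = n E[f^2] E[f^(n-1)] for
  centred, possibly degenerate, one-dimensional Gaussians. It is applied to every real linear form f
  in the entries and polarised by differentiating in a real parameter. The equation for the
  covariance of two traces contains, with a factor 1/N, the expectation of a product of three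
  centred traces, and so on; pairs of words alone do not close up, hence products of any number of
  factors. Centring is what keeps them bounded: it cancels the product of two means, the one
  contribution of order N. The limit recursion treats its two words differently: the first is peeled
  letter by letter and yields a number of circular type, the second is cut open once and yields one
  of linear type. A double count (the cycle lemma) turns the sum over the cuts into a second
  circular number and brings in the factor a.\<close>

definition all_moments ::
    "'a measure \<Rightarrow> ('a \<Rightarrow> 'b::{real_normed_field,banach,second_countable_topology}) \<Rightarrow> bool" where
  "all_moments M f \<longleftrightarrow> f \<in> borel_measurable M \<and> (\<forall>n. integrable M (\<lambda>\<omega>. norm (f \<omega>) ^ n))"

lemma all_moments_measurable: "all_moments M f \<Longrightarrow> f \<in> borel_measurable M"
  by (simp add: all_moments_def)

lemma all_moments_integrable: "all_moments M f \<Longrightarrow> integrable M f"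
  unfolding all_moments_def
  by (rule integrable_norm_cancel) (auto dest: spec[of _ 1])

lemma (in prob_space) all_moments_const [intro, simp]: "all_moments M (\<lambda>_. c)"
  by (simp add: all_moments_def)

text \<open>Reason: |f g|^n is at most |f|^(2n) + |g|^(2n). Demanding all moments, and not just
  integrability, makes the class an algebra, so that integrability of any polynomial in the entries
  is checked syntactically.\<close>

lemma all_moments_mult [intro]:
  assumes "all_moments M f" "all_moments M g"
  shows "all_moments M (\<lambda>\<omega>. f \<omega> * g \<omega>)"
proof -
  note [measurable] = assms[THEN all_moments_measurable]
  have "integrable M (\<lambda>\<omega>. norm (f \<omega> * g \<omega>) ^ n)" for n
  proof (rule Bochner_Integration.integrable_bound)
    show "integrable M (\<lambda>\<omega>. norm (f \<omega>) ^ (2 * n) + norm (g \<omega>) ^ (2 * n))"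
      using assms by (auto simp: all_moments_def)
    show "AE \<omega> in M. norm (norm (f \<omega> * g \<omega>) ^ n) \<le>
        norm (norm (f \<omega>) ^ (2 * n) + norm (g \<omega>) ^ (2 * n))"
    proof (rule AE_I2)
      fix \<omega>
      let ?a = "norm (f \<omega>) ^ n" and ?b = "norm (g \<omega>) ^ n"
      have "2 * (?a * ?b) \<le> ?a\<^sup>2 + ?b\<^sup>2"
        using sum_squares_bound[of ?a ?b] by simp
      moreover have "0 \<le> ?a * ?b" by simp
      ultimately have "?a * ?b \<le> ?a\<^sup>2 + ?b\<^sup>2" by linarith
      then show "norm (norm (f \<omega> * g \<omega>) ^ n) \<le> norm (norm (f \<omega>) ^ (2 * n) + norm (g \<omega>) ^ (2 * n))"
        by (simp add: norm_mult power_mult_distrib power_mult[symmetric] mult.commute)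
    qed
  qed measurable
  then show ?thesis by (simp add: all_moments_def)
qed

lemma all_moments_add [intro]:
  assumes "all_moments M f" "all_moments M g"
  shows "all_moments M (\<lambda>\<omega>. f \<omega> + g \<omega>)"
proof -
  note [measurable] = assms[THEN all_moments_measurable]
  have "integrable M (\<lambda>\<omega>. norm (f \<omega> + g \<omega>) ^ n)" for n
  proof (rule Bochner_Integration.integrable_bound)
    show "integrable M (\<lambda>\<omega>. 2 ^ n * (norm (f \<omega>) ^ n + norm (g \<omega>) ^ n))"
      using assms by (auto simp: all_moments_def)
    show "AE \<omega> in M. norm (norm (f \<omega> + g \<omega>) ^ n) \<le>
        norm (2 ^ n * (norm (f \<omega>) ^ n + norm (g \<omega>) ^ n))"
    proof (rule AE_I2)
      fix \<omega>
      let ?m = "max (norm (f \<omega>)) (norm (g \<omega>))"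
      have "norm (f \<omega> + g \<omega>) \<le> 2 * ?m"
        using norm_triangle_ineq[of "f \<omega>" "g \<omega>"] by linarith
      then have "norm (f \<omega> + g \<omega>) ^ n \<le> (2 * ?m) ^ n"
        by (intro power_mono) auto
      also have "\<dots> = 2 ^ n * ?m ^ n" by (simp add: power_mult_distrib)
      also have "\<dots> \<le> 2 ^ n * (norm (f \<omega>) ^ n + norm (g \<omega>) ^ n)"
        by (intro mult_left_mono) (auto simp: max_def)
      finally show "norm (norm (f \<omega> + g \<omega>) ^ n) \<le> norm (2 ^ n * (norm (f \<omega>) ^ n + norm (g \<omega>) ^ n))"
        by simp
    qed
  qed measurable
  then show ?thesis by (simp add: all_moments_def)
qed

lemma (in prob_space) all_moments_cmult [intro]:
  "all_moments M f \<Longrightarrow> all_moments M (\<lambda>\<omega>. c * f \<omega>)"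
  by (rule all_moments_mult[OF all_moments_const])

lemma (in prob_space) all_moments_diff [intro]:
  assumes "all_moments M f" "all_moments M g"
  shows "all_moments M (\<lambda>\<omega>. f \<omega> - g \<omega>)"
  using all_moments_add[OF assms(1) all_moments_cmult[OF assms(2), of "-1"]] by simp

lemma (in prob_space) all_moments_sum [intro]:
  "(\<And>i. i \<in> I \<Longrightarrow> all_moments M (f i)) \<Longrightarrow> all_moments M (\<lambda>\<omega>. \<Sum>i\<in>I. f i \<omega>)"
  by (induction I rule: infinite_finite_induct) auto

lemma (in prob_space) all_moments_power [intro]:
  "all_moments M f \<Longrightarrow> all_moments M (\<lambda>\<omega>. f \<omega> ^ n)"
  by (induction n) auto

lemma (in prob_space) all_moments_prod_list [intro]:
  "(\<And>z. z \<in> set zs \<Longrightarrow> all_moments M (f z)) \<Longrightarrow> all_moments M (\<lambda>\<omega>. \<Prod>z\<leftarrow>zs. f z \<omega>)"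
  by (induction zs) auto

lemma all_moments_of_real [intro]:
  fixes f :: "'a \<Rightarrow> real"
  shows "all_moments M f \<Longrightarrow> all_moments M (\<lambda>\<omega>. complex_of_real (f \<omega>))"
  by (auto simp: all_moments_def)

text \<open>The integral is a polynomial in t, so no interchange of limit and integral is needed:
  one factor f + t g is split off at a time. The weight \<open>h\<close> is general because it
  absorbs the factor split off.\<close>

lemma (in prob_space) moment_deriv:
  fixes f g h :: "'a \<Rightarrow> real"
  assumes f: "all_moments M f" and g: "all_moments M g"
  shows "all_moments M h \<Longrightarrow>
    ((\<lambda>t. \<integral>\<omega>. (f \<omega> + t * g \<omega>) ^ n * h \<omega> \<partial>M) has_real_derivative
      (real n * (\<integral>\<omega>. f \<omega> ^ (n - 1) * g \<omega> * h \<omega> \<partial>M))) (at 0)"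
proof (induction n arbitrary: h)
  case (Suc n)
  note h = Suc.prems
  have eq: "(\<integral>\<omega>. (f \<omega> + t * g \<omega>) ^ Suc n * h \<omega> \<partial>M) =
      (\<integral>\<omega>. (f \<omega> + t * g \<omega>) ^ n * (f \<omega> * h \<omega>) \<partial>M) +
      t * (\<integral>\<omega>. (f \<omega> + t * g \<omega>) ^ n * (g \<omega> * h \<omega>) \<partial>M)" for t
  proof -
    have i: "integrable M (\<lambda>\<omega>. (f \<omega> + t * g \<omega>) ^ n * (u \<omega> * h \<omega>))" if "all_moments M u" for u
      by (intro all_moments_integrable all_moments_mult all_moments_power all_moments_add
          all_moments_cmult f g h that)
    have "(\<integral>\<omega>. (f \<omega> + t * g \<omega>) ^ Suc n * h \<omega> \<partial>M) =
        (\<integral>\<omega>. (f \<omega> + t * g \<omega>) ^ n * (f \<omega> * h \<omega>) +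
           t * ((f \<omega> + t * g \<omega>) ^ n * (g \<omega> * h \<omega>)) \<partial>M)"
      by (rule Bochner_Integration.integral_cong) (simp_all add: algebra_simps)
    also have "\<dots> = (\<integral>\<omega>. (f \<omega> + t * g \<omega>) ^ n * (f \<omega> * h \<omega>) \<partial>M) +
        t * (\<integral>\<omega>. (f \<omega> + t * g \<omega>) ^ n * (g \<omega> * h \<omega>) \<partial>M)"
      using i[OF f] i[OF g] by simp
    finally show ?thesis .
  qed
  have *: "((\<lambda>t. (\<integral>\<omega>. (f \<omega> + t * g \<omega>) ^ n * (f \<omega> * h \<omega>) \<partial>M) +
      t * (\<integral>\<omega>. (f \<omega> + t * g \<omega>) ^ n * (g \<omega> * h \<omega>) \<partial>M)) has_real_derivative
      (real n * (\<integral>\<omega>. f \<omega> ^ (n - 1) * g \<omega> * (f \<omega> * h \<omega>) \<partial>M)) +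
      (1 * (\<integral>\<omega>. (f \<omega> + 0 * g \<omega>) ^ n * (g \<omega> * h \<omega>) \<partial>M) +
       (real n * (\<integral>\<omega>. f \<omega> ^ (n - 1) * g \<omega> * (g \<omega> * h \<omega>) \<partial>M)) * 0)) (at 0)"
    by (intro DERIV_add DERIV_mult' Suc.IH DERIV_mult[OF DERIV_ident] all_moments_mult f g h)
  \<comment> \<open>The truncated \<open>n - 1\<close> does no harm: for \<open>n = 0\<close> the
    factor \<open>real n\<close> vanishes.\<close>
  have "real n * (\<integral>\<omega>. f \<omega> ^ (n - 1) * g \<omega> * (f \<omega> * h \<omega>) \<partial>M) =
      real n * (\<integral>\<omega>. f \<omega> ^ n * g \<omega> * h \<omega> \<partial>M)"
    by (cases n) (auto simp: mult_ac)
  note * = *[unfolded this]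
  have "((\<lambda>t. (\<integral>\<omega>. (f \<omega> + t * g \<omega>) ^ n * (f \<omega> * h \<omega>) \<partial>M) +
      t * (\<integral>\<omega>. (f \<omega> + t * g \<omega>) ^ n * (g \<omega> * h \<omega>) \<partial>M)) has_real_derivative
      (real n * (\<integral>\<omega>. f \<omega> ^ n * g \<omega> * h \<omega> \<partial>M)) + (\<integral>\<omega>. f \<omega> ^ n * g \<omega> * h \<omega> \<partial>M)) (at 0)"
    using * by (simp add: mult.assoc)
  then show ?case unfolding eq
    by (simp add: distrib_right add.commute)
qed simp

text \<open>Gaussianity enters only as a recursion for one-dimensional moments, valid for degenerate
  laws too; joint Gaussianity is its validity on a set closed under linear combinations. The
  instance \<open>n = 0\<close> says that the elements are centred.\<close>

locale gaussian_space = prob_space M for M :: "'a measure" +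
  fixes L :: "('a \<Rightarrow> real) set"
  assumes lin: "f \<in> L \<Longrightarrow> g \<in> L \<Longrightarrow> (\<lambda>\<omega>. f \<omega> + t * g \<omega>) \<in> L"
    and mom: "f \<in> L \<Longrightarrow> all_moments M f"
    and moment_rec: "f \<in> L \<Longrightarrow>
      (\<integral>\<omega>. f \<omega> ^ Suc n \<partial>M) = real n * (\<integral>\<omega>. f \<omega> ^ 2 \<partial>M) * (\<integral>\<omega>. f \<omega> ^ (n - 1) \<partial>M)"
begin

text \<open>Differentiate the moment recursion along f + t V at t = 0. The right side yields 2 n
  E[f V] E[f^(n-1)] and a term with E[f^(n-2) V]; the latter is known by induction and, by the
  moment recursion, equals n (n-1) E[f V] E[f^(n-1)]. Dividing by n + 1 gives the claim.\<close>

lemma expectation_mult_power: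
  assumes V: "V \<in> L" and f: "f \<in> L"
  shows "(\<integral>\<omega>. V \<omega> * f \<omega> ^ n \<partial>M) = real n * (\<integral>\<omega>. V \<omega> * f \<omega> \<partial>M) * (\<integral>\<omega>. f \<omega> ^ (n - 1) \<partial>M)"
proof (induction n rule: less_induct)
  case (less n)
  consider "n = 0" | "n = 1" | k where "n = Suc (Suc k)"
    by (metis One_nat_def not0_implies_Suc)
  then show ?case
  proof cases
    case 1
    then show ?thesis using moment_rec[OF V, of 0] by simp
  next
    case 2
    then show ?thesis by (simp add: prob_space)
  next
    case 3
    note d = moment_deriv[OF mom[OF f] mom[OF V] all_moments_const[of 1]]
    have L: "(\<lambda>\<omega>. f \<omega> + t * V \<omega>) \<in> L" for t by (rule lin[OF f V])
    have d1: "((\<lambda>t. \<integral>\<omega>. (f \<omega> + t * V \<omega>) ^ Suc n \<partial>M) has_real_derivative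
        real (Suc n) * (\<integral>\<omega>. f \<omega> ^ n * V \<omega> \<partial>M)) (at 0)"
      using d[of "Suc n"] by simp
    have d2: "((\<lambda>t. real n * ((\<integral>\<omega>. (f \<omega> + t * V \<omega>) ^ 2 \<partial>M) * (\<integral>\<omega>. (f \<omega> + t * V \<omega>) ^ (n - 1) \<partial>M)))
       has_real_derivative real n * ((real 2 * (\<integral>\<omega>. f \<omega> * V \<omega> \<partial>M)) * (\<integral>\<omega>. (f \<omega> + 0 * V \<omega>) ^ (n - 1) \<partial>M) +
          (real (n - 1) * (\<integral>\<omega>. f \<omega> ^ (n - 1 - 1) * V \<omega> \<partial>M)) * (\<integral>\<omega>. (f \<omega> + 0 * V \<omega>) ^ 2 \<partial>M))) (at 0)"
      using d[of 2] d[of "n - 1"] by (intro DERIV_cmult DERIV_mult) simp_all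
    have "(\<lambda>t. \<integral>\<omega>. (f \<omega> + t * V \<omega>) ^ Suc n \<partial>M) =
        (\<lambda>t. real n * ((\<integral>\<omega>. (f \<omega> + t * V \<omega>) ^ 2 \<partial>M) * (\<integral>\<omega>. (f \<omega> + t * V \<omega>) ^ (n - 1) \<partial>M)))"
      by (rule ext) (simp only: moment_rec[OF L] mult.assoc)
    then have eq: "real (Suc n) * (\<integral>\<omega>. f \<omega> ^ n * V \<omega> \<partial>M) =
        real n * ((real 2 * (\<integral>\<omega>. f \<omega> * V \<omega> \<partial>M)) * (\<integral>\<omega>. f \<omega> ^ (n - 1) \<partial>M) +
          (real (n - 1) * (\<integral>\<omega>. f \<omega> ^ (n - 1 - 1) * V \<omega> \<partial>M)) * (\<integral>\<omega>. f \<omega> ^ 2 \<partial>M))"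
      using DERIV_unique[OF d1] d2 by simp
    have IH: "(\<integral>\<omega>. f \<omega> ^ k * V \<omega> \<partial>M) = real k * (\<integral>\<omega>. f \<omega> * V \<omega> \<partial>M) * (\<integral>\<omega>. f \<omega> ^ (k - 1) \<partial>M)"
      using less.IH[of k] 3 by (simp add: mult.commute)
    have m: "(\<integral>\<omega>. f \<omega> ^ Suc k \<partial>M) = real k * (\<integral>\<omega>. f \<omega> ^ 2 \<partial>M) * (\<integral>\<omega>. f \<omega> ^ (k - 1) \<partial>M)"
      by (rule moment_rec[OF f])
    have "real (Suc n) * (\<integral>\<omega>. f \<omega> ^ n * V \<omega> \<partial>M) =
        real n * (2 * (\<integral>\<omega>. f \<omega> * V \<omega> \<partial>M) * (\<integral>\<omega>. f \<omega> ^ Suc k \<partial>M) +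
          real (Suc k) * ((\<integral>\<omega>. f \<omega> * V \<omega> \<partial>M) * (\<integral>\<omega>. f \<omega> ^ Suc k \<partial>M)))"
      unfolding eq m using 3 IH m by (simp del: power_Suc of_nat_Suc)
    also have "\<dots> = real (Suc n) * (real n * (\<integral>\<omega>. f \<omega> * V \<omega> \<partial>M) * (\<integral>\<omega>. f \<omega> ^ Suc k \<partial>M))"
      using 3 by (simp add: algebra_simps)
    finally have "(\<integral>\<omega>. f \<omega> ^ n * V \<omega> \<partial>M) = real n * (\<integral>\<omega>. f \<omega> * V \<omega> \<partial>M) * (\<integral>\<omega>. f \<omega> ^ Suc k \<partial>M)"
      by (simp del: of_nat_Suc)
    with 3 show ?thesis by (simp add: mult.commute)
  qed
qed

text \<open>Leibniz expansion of the product over the list under the derivation that sends a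
  generator \<open>z\<close> to E[V z].\<close>

fun wick :: "('a \<Rightarrow> real) \<Rightarrow> ('a \<Rightarrow> real) list \<Rightarrow> 'a \<Rightarrow> real" where
  "wick V [] \<omega> = 0"
| "wick V (z # zs) \<omega> = (\<integral>\<omega>. V \<omega> * z \<omega> \<partial>M) * (\<Prod>z\<leftarrow>zs. z \<omega>) + z \<omega> * wick V zs \<omega>"

lemma all_moments_generators: "set zs \<subseteq> L \<Longrightarrow> all_moments M (\<lambda>\<omega>. \<Prod>z\<leftarrow>zs. z \<omega>)"
  by (rule all_moments_prod_list) (auto dest: mom)

lemma all_moments_wick: "set zs \<subseteq> L \<Longrightarrow> all_moments M (wick V zs)"
proof (induction zs)
  case (Cons z zs)
  then have z: "all_moments M z" and zs: "set zs \<subseteq> L" by (auto intro: mom)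
  have "all_moments M (\<lambda>\<omega>. (\<integral>\<omega>. V \<omega> * z \<omega> \<partial>M) * (\<Prod>z\<leftarrow>zs. z \<omega>) + z \<omega> * wick V zs \<omega>)"
    by (intro all_moments_add all_moments_cmult all_moments_mult z all_moments_generators zs
        Cons.IH)
  also have "(\<lambda>\<omega>. (\<integral>\<omega>. V \<omega> * z \<omega> \<partial>M) * (\<Prod>z\<leftarrow>zs. z \<omega>) + z \<omega> * wick V zs \<omega>) = wick V (z # zs)"
    by (rule ext) simp
  finally show ?case .
next
  case Nil
  have "wick V [] = (\<lambda>_. 0)" by (rule ext) simp
  then show ?case by simp
qed

text \<open>Polarisation one variable at a time: the identity for \<open>z # zs\<close> and the power \<open>f ^ n\<close> is the
  derivative at \<open>t = 0\<close> of the identity for \<open>zs\<close> and \<open>(f + t z) ^ (n + 1)\<close>.\<close>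

lemma wick_power:
  assumes V: "V \<in> L" and "set zs \<subseteq> L" and "f \<in> L"
  shows "(\<integral>\<omega>. f \<omega> ^ n * (V \<omega> * (\<Prod>z\<leftarrow>zs. z \<omega>)) \<partial>M) =
     real n * (\<integral>\<omega>. V \<omega> * f \<omega> \<partial>M) * (\<integral>\<omega>. f \<omega> ^ (n - 1) * (\<Prod>z\<leftarrow>zs. z \<omega>) \<partial>M) +
     (\<integral>\<omega>. f \<omega> ^ n * wick V zs \<omega> \<partial>M)"
  using assms(2,3)
proof (induction zs arbitrary: f n)
  case Nil
  then show ?case using expectation_mult_power[OF V, of f n] by (simp add: mult.commute)
next
  case (Cons z zs)
  then have z: "z \<in> L" and zs: "set zs \<subseteq> L" and f: "f \<in> L" by auto
  let ?P = "\<lambda>\<omega>. \<Prod>z\<leftarrow>zs. z \<omega>"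
  note d = moment_deriv[OF mom[OF f] mom[OF z]]
  have P: "all_moments M ?P" by (rule all_moments_generators[OF zs])
  have L: "(\<lambda>\<omega>. f \<omega> + t * z \<omega>) \<in> L" for t by (rule lin[OF f z])
  have cov: "(\<integral>\<omega>. V \<omega> * (f \<omega> + t * z \<omega>) \<partial>M) =
      (\<integral>\<omega>. V \<omega> * f \<omega> \<partial>M) + t * (\<integral>\<omega>. V \<omega> * z \<omega> \<partial>M)" for t
  proof -
    have i: "integrable M (\<lambda>\<omega>. V \<omega> * u \<omega>)" if "u \<in> L" for u
      by (intro all_moments_integrable all_moments_mult mom V that)
    have "(\<integral>\<omega>. V \<omega> * (f \<omega> + t * z \<omega>) \<partial>M) = (\<integral>\<omega>. V \<omega> * f \<omega> + t * (V \<omega> * z \<omega>) \<partial>M)"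
      by (rule Bochner_Integration.integral_cong) (simp_all add: algebra_simps)
    also have "\<dots> = (\<integral>\<omega>. V \<omega> * f \<omega> \<partial>M) + t * (\<integral>\<omega>. V \<omega> * z \<omega> \<partial>M)"
      using i[OF f] i[OF z] by simp
    finally show ?thesis .
  qed
  have d1: "((\<lambda>t. \<integral>\<omega>. (f \<omega> + t * z \<omega>) ^ Suc n * (V \<omega> * ?P \<omega>) \<partial>M) has_real_derivative
      (real (Suc n) * (\<integral>\<omega>. f \<omega> ^ (Suc n - 1) * z \<omega> * (V \<omega> * ?P \<omega>) \<partial>M))) (at 0)"
    by (rule d[OF all_moments_mult[OF mom[OF V] P]])
  have d2: "((\<lambda>t. real (Suc n) * (((\<integral>\<omega>. V \<omega> * f \<omega> \<partial>M) + t * (\<integral>\<omega>. V \<omega> * z \<omega> \<partial>M)) *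
         (\<integral>\<omega>. (f \<omega> + t * z \<omega>) ^ n * ?P \<omega> \<partial>M)) +
       (\<integral>\<omega>. (f \<omega> + t * z \<omega>) ^ Suc n * wick V zs \<omega> \<partial>M)) has_real_derivative
     real (Suc n) * ((0 + (1 * (\<integral>\<omega>. V \<omega> * z \<omega> \<partial>M))) * (\<integral>\<omega>. (f \<omega> + 0 * z \<omega>) ^ n * ?P \<omega> \<partial>M) +
        (real n * (\<integral>\<omega>. f \<omega> ^ (n - 1) * z \<omega> * ?P \<omega> \<partial>M)) *
         ((\<integral>\<omega>. V \<omega> * f \<omega> \<partial>M) + 0 * (\<integral>\<omega>. V \<omega> * z \<omega> \<partial>M))) +
     real (Suc n) * (\<integral>\<omega>. f \<omega> ^ (Suc n - 1) * z \<omega> * wick V zs \<omega> \<partial>M)) (at 0)"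
    by (intro DERIV_add DERIV_cmult DERIV_mult DERIV_const DERIV_cmult_right DERIV_ident d P
        all_moments_wick zs)
  have fun_eq: "(\<lambda>t. \<integral>\<omega>. (f \<omega> + t * z \<omega>) ^ Suc n * (V \<omega> * ?P \<omega>) \<partial>M) =
    (\<lambda>t. real (Suc n) * (((\<integral>\<omega>. V \<omega> * f \<omega> \<partial>M) + t * (\<integral>\<omega>. V \<omega> * z \<omega> \<partial>M)) *
         (\<integral>\<omega>. (f \<omega> + t * z \<omega>) ^ n * ?P \<omega> \<partial>M)) +
       (\<integral>\<omega>. (f \<omega> + t * z \<omega>) ^ Suc n * wick V zs \<omega> \<partial>M))"
    by (rule ext) (simp only: Cons.IH[OF zs L] cov mult.assoc diff_Suc_1)
  have eq: "real (Suc n) * (\<integral>\<omega>. f \<omega> ^ n * z \<omega> * (V \<omega> * ?P \<omega>) \<partial>M) =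
     real (Suc n) * ((\<integral>\<omega>. V \<omega> * z \<omega> \<partial>M) * (\<integral>\<omega>. f \<omega> ^ n * ?P \<omega> \<partial>M) +
        (real n * (\<integral>\<omega>. f \<omega> ^ (n - 1) * z \<omega> * ?P \<omega> \<partial>M)) * (\<integral>\<omega>. V \<omega> * f \<omega> \<partial>M) +
        (\<integral>\<omega>. f \<omega> ^ n * z \<omega> * wick V zs \<omega> \<partial>M))"
    using DERIV_unique[OF d1 d2[folded fun_eq]]
    by (simp only: diff_Suc_1 mult_zero_left add_0_left add_0_right mult_1_left distrib_left)
  have "(\<integral>\<omega>. f \<omega> ^ n * wick V (z # zs) \<omega> \<partial>M) =
     (\<integral>\<omega>. (\<integral>\<omega>. V \<omega> * z \<omega> \<partial>M) * (f \<omega> ^ n * ?P \<omega>) + f \<omega> ^ n * z \<omega> * wick V zs \<omega> \<partial>M)"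
    by (simp add: algebra_simps)
  also have "\<dots> = (\<integral>\<omega>. V \<omega> * z \<omega> \<partial>M) * (\<integral>\<omega>. f \<omega> ^ n * ?P \<omega> \<partial>M) +
     (\<integral>\<omega>. f \<omega> ^ n * z \<omega> * wick V zs \<omega> \<partial>M)"
    by (subst Bochner_Integration.integral_add)
      (intro all_moments_integrable all_moments_cmult all_moments_mult all_moments_power
        P mom[OF f] mom[OF z] all_moments_wick[OF zs] | simp)+
  finally show ?case using eq
    by (simp add: mult_ac del: of_nat_Suc wick.simps)
qed

text \<open>The power of \<open>f\<close> in \<open>wick_power\<close> exists only for the
  polarisation; \<open>n = 0\<close> removes it.\<close>

lemma wick_real:
  assumes "V \<in> L" "set zs \<subseteq> L"
  shows "(\<integral>\<omega>. V \<omega> * (\<Prod>z\<leftarrow>zs. z \<omega>) \<partial>M) = (\<integral>\<omega>. wick V zs \<omega> \<partial>M)"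
  using wick_power[OF assms assms(1), of 0] by simp

end

section \<open>Gaussian integration by parts\<close>

context gaussian_space
begin

text \<open>Real and imaginary part are independent choices from \<open>L\<close>, so an entry and
  its conjugate both belong and no circular symmetry is built in. All covariances below are
  bilinear.\<close>

definition complex_span :: "('a \<Rightarrow> complex) set" where
  "complex_span =
     {\<lambda>\<omega>. complex_of_real (A \<omega>) + \<i> * complex_of_real (B \<omega>) | A B. A \<in> L \<and> B \<in> L}"

lemma complex_spanI:
  assumes "A \<in> L" "B \<in> L" "\<And>\<omega>. z \<omega> = complex_of_real (A \<omega>) + \<i> * complex_of_real (B \<omega>)"
  shows "z \<in> complex_span"
  unfolding complex_span_def using assms by (intro CollectI exI[of _ A] exI[of _ B]) auto

lemma all_moments_complex_span: "z \<in> complex_span \<Longrightarrow> all_moments M z"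
  by (auto simp: complex_span_def
      intro!: all_moments_add all_moments_cmult all_moments_of_real mom)

fun cwick :: "('a \<Rightarrow> complex) \<Rightarrow> ('a \<Rightarrow> real) list \<Rightarrow> 'a \<Rightarrow> complex" where
  "cwick \<xi> [] \<omega> = 0"
| "cwick \<xi> (z # zs) \<omega> = (\<integral>\<omega>. \<xi> \<omega> * complex_of_real (z \<omega>) \<partial>M) * complex_of_real (\<Prod>z\<leftarrow>zs. z \<omega>)
     + complex_of_real (z \<omega>) * cwick \<xi> zs \<omega>"

lemma expectation_complex_of_real:
  assumes "all_moments M A" "all_moments M B" "all_moments M z"
  shows "(\<integral>\<omega>. (complex_of_real (A \<omega>) + \<i> * complex_of_real (B \<omega>)) * complex_of_real (z \<omega>) \<partial>M) =
    complex_of_real (\<integral>\<omega>. A \<omega> * z \<omega> \<partial>M) + \<i> * complex_of_real (\<integral>\<omega>. B \<omega> * z \<omega> \<partial>M)"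
proof -
  have "(\<integral>\<omega>. (complex_of_real (A \<omega>) + \<i> * complex_of_real (B \<omega>)) * complex_of_real (z \<omega>) \<partial>M) =
    (\<integral>\<omega>. complex_of_real (A \<omega> * z \<omega>) + \<i> * complex_of_real (B \<omega> * z \<omega>) \<partial>M)"
    by (rule Bochner_Integration.integral_cong) (simp_all add: algebra_simps)
  also have "\<dots> = (\<integral>\<omega>. complex_of_real (A \<omega> * z \<omega>) \<partial>M) + (\<integral>\<omega>. \<i> * complex_of_real (B \<omega> * z \<omega>) \<partial>M)"
    by (intro Bochner_Integration.integral_add all_moments_integrable all_moments_cmult
        all_moments_of_real all_moments_mult assms)
  finally show ?thesis by (simp only: integral_mult_right_zero integral_complex_of_real)
qed

lemma cwick_Re_Im:
  assumes "A \<in> L" "B \<in> L" "set zs \<subseteq> L"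
  shows "cwick (\<lambda>\<omega>. complex_of_real (A \<omega>) + \<i> * complex_of_real (B \<omega>)) zs \<omega> =
    complex_of_real (wick A zs \<omega>) + \<i> * complex_of_real (wick B zs \<omega>)"
  using assms(3)
proof (induction zs)
  case (Cons z zs)
  then have z: "z \<in> L" and zs: "set zs \<subseteq> L" by auto
  show ?case
    unfolding cwick.simps wick.simps Cons.IH[OF zs]
      expectation_complex_of_real[OF mom[OF assms(1)] mom[OF assms(2)] mom[OF z]]
    by (simp add: algebra_simps)
qed simp

lemma all_moments_cwick:
  assumes "\<xi> \<in> complex_span" "set zs \<subseteq> L"
  shows "all_moments M (cwick \<xi> zs)"
proof -
  obtain A B where AB: "A \<in> L" "B \<in> L"
    and \<xi>: "\<xi> = (\<lambda>\<omega>. complex_of_real (A \<omega>) + \<i> * complex_of_real (B \<omega>))"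
    using assms(1) by (auto simp: complex_span_def)
  have "cwick \<xi> zs = (\<lambda>\<omega>. complex_of_real (wick A zs \<omega>) + \<i> * complex_of_real (wick B zs \<omega>))"
    unfolding \<xi> by (rule ext) (rule cwick_Re_Im[OF AB assms(2)])
  then show ?thesis
    by (simp only:) (intro all_moments_add all_moments_cmult all_moments_of_real
        all_moments_wick assms(2))
qed

lemma wick_complex:
  assumes "\<xi> \<in> complex_span" "set zs \<subseteq> L"
  shows "(\<integral>\<omega>. \<xi> \<omega> * complex_of_real (\<Prod>z\<leftarrow>zs. z \<omega>) \<partial>M) = (\<integral>\<omega>. cwick \<xi> zs \<omega> \<partial>M)"
proof -
  obtain A B where AB: "A \<in> L" "B \<in> L"
    and \<xi>: "\<xi> = (\<lambda>\<omega>. complex_of_real (A \<omega>) + \<i> * complex_of_real (B \<omega>))"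
    using assms(1) by (auto simp: complex_span_def)
  have "(\<integral>\<omega>. cwick \<xi> zs \<omega> \<partial>M) =
      (\<integral>\<omega>. complex_of_real (wick A zs \<omega>) + \<i> * complex_of_real (wick B zs \<omega>) \<partial>M)"
    unfolding \<xi> by (simp only: cwick_Re_Im[OF AB assms(2)])
  also have "\<dots> = (\<integral>\<omega>. complex_of_real (wick A zs \<omega>) \<partial>M) + (\<integral>\<omega>. \<i> * complex_of_real (wick B zs \<omega>) \<partial>M)"
    by (intro Bochner_Integration.integral_add all_moments_integrable all_moments_cmult
        all_moments_of_real all_moments_wick assms)
  also have "\<dots> = (\<integral>\<omega>. \<xi> \<omega> * complex_of_real (\<Prod>z\<leftarrow>zs. z \<omega>) \<partial>M)"
    unfolding \<xi> expectation_complex_of_real[OF AB[THEN mom] all_moments_generators[OF assms(2)]]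
      wick_real[OF AB(1) assms(2)] wick_real[OF AB(2) assms(2)]
    by (simp only: integral_mult_right_zero integral_complex_of_real)
  finally show ?thesis ..
qed

text \<open>\<open>stein \<xi> F G\<close> says that \<open>G\<close> is the derivative of the polynomial \<open>F\<close> under the derivation
  sending a generator \<open>z\<close> to \<open>E[\<xi> z]\<close>.  The extra factor over \<open>zs\<close> makes the relation stable
  under multiplying \<open>F\<close> by a further generator.\<close>

definition stein :: "('a \<Rightarrow> complex) \<Rightarrow> ('a \<Rightarrow> complex) \<Rightarrow> ('a \<Rightarrow> complex) \<Rightarrow> bool" where
  "stein \<xi> F G \<longleftrightarrow> all_moments M F \<and> all_moments M G \<and>
     (\<forall>zs. set zs \<subseteq> L \<longrightarrow>
       (\<integral>\<omega>. \<xi> \<omega> * F \<omega> * complex_of_real (\<Prod>z\<leftarrow>zs. z \<omega>) \<partial>M) =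
       (\<integral>\<omega>. G \<omega> * complex_of_real (\<Prod>z\<leftarrow>zs. z \<omega>) \<partial>M) + (\<integral>\<omega>. F \<omega> * cwick \<xi> zs \<omega> \<partial>M))"

lemma stein_expectation: "stein \<xi> F G \<Longrightarrow> (\<integral>\<omega>. \<xi> \<omega> * F \<omega> \<partial>M) = (\<integral>\<omega>. G \<omega> \<partial>M)"
  by (auto simp: stein_def dest: spec[of _ "[]"])

lemma stein_all_moments:
  assumes "stein \<xi> F G"
  shows "all_moments M F" "all_moments M G"
  using assms by (auto simp: stein_def)

context
  fixes \<xi> assumes \<xi>: "\<xi> \<in> complex_span"
begin

text \<open>This base case is the only place where Wick's formula enters; the other rules for
  \<open>stein\<close> are algebra and linearity.\<close>

lemma stein_const: "stein \<xi> (\<lambda>_. c) (\<lambda>_. 0)"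
  unfolding stein_def
proof (intro conjI allI impI)
  fix zs assume zs: "set zs \<subseteq> L"
  have "(\<integral>\<omega>. \<xi> \<omega> * c * complex_of_real (\<Prod>z\<leftarrow>zs. z \<omega>) \<partial>M) =
      c * (\<integral>\<omega>. \<xi> \<omega> * complex_of_real (\<Prod>z\<leftarrow>zs. z \<omega>) \<partial>M)"
    by (subst integral_mult_right_zero[symmetric]) (simp add: mult_ac)
  then show "(\<integral>\<omega>. \<xi> \<omega> * c * complex_of_real (\<Prod>z\<leftarrow>zs. z \<omega>) \<partial>M) =
      (\<integral>\<omega>. 0 * complex_of_real (\<Prod>z\<leftarrow>zs. z \<omega>) \<partial>M) + (\<integral>\<omega>. c * cwick \<xi> zs \<omega> \<partial>M)"
    by (simp add: wick_complex[OF \<xi> zs])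
qed auto

lemma stein_add:
  assumes "stein \<xi> F G" "stein \<xi> F' G'"
  shows "stein \<xi> (\<lambda>\<omega>. F \<omega> + F' \<omega>) (\<lambda>\<omega>. G \<omega> + G' \<omega>)"
  unfolding stein_def
proof (intro conjI allI impI)
  note mm = stein_all_moments[OF assms(1)] stein_all_moments[OF assms(2)]
  show "all_moments M (\<lambda>\<omega>. F \<omega> + F' \<omega>)" "all_moments M (\<lambda>\<omega>. G \<omega> + G' \<omega>)"
    by (intro all_moments_add mm)+
  fix zs assume zs: "set zs \<subseteq> L"
  let ?P = "\<lambda>\<omega>. complex_of_real (\<Prod>z\<leftarrow>zs. z \<omega>)"
  note i = all_moments_integrable all_moments_mult mm all_moments_complex_span[OF \<xi>]
    all_moments_of_real all_moments_generators[OF zs] all_moments_cwick[OF \<xi> zs]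
  have "(\<integral>\<omega>. \<xi> \<omega> * (F \<omega> + F' \<omega>) * ?P \<omega> \<partial>M) = (\<integral>\<omega>. \<xi> \<omega> * F \<omega> * ?P \<omega> + \<xi> \<omega> * F' \<omega> * ?P \<omega> \<partial>M)"
    by (rule Bochner_Integration.integral_cong) (simp_all add: algebra_simps)
  also have "\<dots> = (\<integral>\<omega>. \<xi> \<omega> * F \<omega> * ?P \<omega> \<partial>M) + (\<integral>\<omega>. \<xi> \<omega> * F' \<omega> * ?P \<omega> \<partial>M)"
    by (intro Bochner_Integration.integral_add i)
  also have "\<dots> = ((\<integral>\<omega>. G \<omega> * ?P \<omega> \<partial>M) + (\<integral>\<omega>. G' \<omega> * ?P \<omega> \<partial>M)) +
     ((\<integral>\<omega>. F \<omega> * cwick \<xi> zs \<omega> \<partial>M) + (\<integral>\<omega>. F' \<omega> * cwick \<xi> zs \<omega> \<partial>M))"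
    using assms zs by (simp add: stein_def)
  also have "(\<integral>\<omega>. G \<omega> * ?P \<omega> \<partial>M) + (\<integral>\<omega>. G' \<omega> * ?P \<omega> \<partial>M) = (\<integral>\<omega>. G \<omega> * ?P \<omega> + G' \<omega> * ?P \<omega> \<partial>M)"
    by (rule Bochner_Integration.integral_add[symmetric]; intro i)
  also have "(\<integral>\<omega>. F \<omega> * cwick \<xi> zs \<omega> \<partial>M) + (\<integral>\<omega>. F' \<omega> * cwick \<xi> zs \<omega> \<partial>M) =
      (\<integral>\<omega>. F \<omega> * cwick \<xi> zs \<omega> + F' \<omega> * cwick \<xi> zs \<omega> \<partial>M)"
    by (rule Bochner_Integration.integral_add[symmetric]; intro i)
  finally show "(\<integral>\<omega>. \<xi> \<omega> * (F \<omega> + F' \<omega>) * ?P \<omega> \<partial>M) =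
      (\<integral>\<omega>. (G \<omega> + G' \<omega>) * ?P \<omega> \<partial>M) + (\<integral>\<omega>. (F \<omega> + F' \<omega>) * cwick \<xi> zs \<omega> \<partial>M)"
    by (simp only: distrib_right)
qed

lemma stein_cmult:
  assumes "stein \<xi> F G"
  shows "stein \<xi> (\<lambda>\<omega>. c * F \<omega>) (\<lambda>\<omega>. c * G \<omega>)"
  unfolding stein_def
proof (intro conjI allI impI)
  show "all_moments M (\<lambda>\<omega>. c * F \<omega>)" "all_moments M (\<lambda>\<omega>. c * G \<omega>)"
    by (intro all_moments_cmult stein_all_moments[OF assms])+
  fix zs assume zs: "set zs \<subseteq> L"
  let ?P = "\<lambda>\<omega>. complex_of_real (\<Prod>z\<leftarrow>zs. z \<omega>)"
  have "(\<integral>\<omega>. \<xi> \<omega> * (c * F \<omega>) * ?P \<omega> \<partial>M) = c * (\<integral>\<omega>. \<xi> \<omega> * F \<omega> * ?P \<omega> \<partial>M)"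
    by (subst integral_mult_right_zero[symmetric]) (simp add: mult_ac)
  also have "\<dots> = c * (\<integral>\<omega>. G \<omega> * ?P \<omega> \<partial>M) + c * (\<integral>\<omega>. F \<omega> * cwick \<xi> zs \<omega> \<partial>M)"
    using assms zs by (simp add: stein_def distrib_left)
  finally show "(\<integral>\<omega>. \<xi> \<omega> * (c * F \<omega>) * ?P \<omega> \<partial>M) =
      (\<integral>\<omega>. c * G \<omega> * ?P \<omega> \<partial>M) + (\<integral>\<omega>. c * F \<omega> * cwick \<xi> zs \<omega> \<partial>M)"
    by (simp only: mult.assoc integral_mult_right_zero)
qed

lemma stein_sum:
  "(\<And>i. i \<in> I \<Longrightarrow> stein \<xi> (F i) (G i)) \<Longrightarrow> stein \<xi> (\<lambda>\<omega>. \<Sum>i\<in>I. F i \<omega>) (\<lambda>\<omega>. \<Sum>i\<in>I. G i \<omega>)"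
  by (induction I rule: infinite_finite_induct) (auto intro: stein_add stein_const)

text \<open>Test the hypothesis against the longer list \<open>z # zs\<close>: the test factor
  \<open>z\<close> is moved into \<open>F\<close>, and the head term of \<open>cwick\<close> becomes
  the new summand of the derivative.\<close>

lemma stein_mult_real_generator:
  assumes FG: "stein \<xi> F G" and z: "z \<in> L"
  shows "stein \<xi> (\<lambda>\<omega>. F \<omega> * complex_of_real (z \<omega>))
    (\<lambda>\<omega>. G \<omega> * complex_of_real (z \<omega>) + F \<omega> * (\<integral>\<omega>. \<xi> \<omega> * complex_of_real (z \<omega>) \<partial>M))"
  unfolding stein_def
proof (intro conjI allI impI)
  note mm = stein_all_moments[OF FG]
  let ?c = "\<integral>\<omega>. \<xi> \<omega> * complex_of_real (z \<omega>) \<partial>M"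
  show "all_moments M (\<lambda>\<omega>. F \<omega> * complex_of_real (z \<omega>))"
    "all_moments M (\<lambda>\<omega>. G \<omega> * complex_of_real (z \<omega>) + F \<omega> * ?c)"
    by (intro all_moments_mult all_moments_add mm all_moments_of_real mom z all_moments_const)+
  fix zs assume zs: "set zs \<subseteq> L"
  let ?P = "\<lambda>\<omega>. complex_of_real (\<Prod>z\<leftarrow>zs. z \<omega>)"
  note i = all_moments_integrable all_moments_mult mm all_moments_complex_span[OF \<xi>]
    all_moments_of_real all_moments_generators[OF zs] all_moments_cwick[OF \<xi> zs] mom[OF z]
    all_moments_const
  have "set (z # zs) \<subseteq> L" using z zs by simp
  then have "(\<integral>\<omega>. \<xi> \<omega> * F \<omega> * complex_of_real (\<Prod>z\<leftarrow>z # zs. z \<omega>) \<partial>M) =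
     (\<integral>\<omega>. G \<omega> * complex_of_real (\<Prod>z\<leftarrow>z # zs. z \<omega>) \<partial>M) + (\<integral>\<omega>. F \<omega> * cwick \<xi> (z # zs) \<omega> \<partial>M)"
    using FG by (simp only: stein_def)
  also have "(\<integral>\<omega>. F \<omega> * cwick \<xi> (z # zs) \<omega> \<partial>M) =
     (\<integral>\<omega>. F \<omega> * ?c * ?P \<omega> + F \<omega> * complex_of_real (z \<omega>) * cwick \<xi> zs \<omega> \<partial>M)"
    by (simp add: algebra_simps)
  also have "\<dots> = (\<integral>\<omega>. F \<omega> * ?c * ?P \<omega> \<partial>M) + (\<integral>\<omega>. F \<omega> * complex_of_real (z \<omega>) * cwick \<xi> zs \<omega> \<partial>M)"
    by (intro Bochner_Integration.integral_add i)
  also have "(\<integral>\<omega>. G \<omega> * complex_of_real (\<Prod>z\<leftarrow>z # zs. z \<omega>) \<partial>M) +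
     ((\<integral>\<omega>. F \<omega> * ?c * ?P \<omega> \<partial>M) + (\<integral>\<omega>. F \<omega> * complex_of_real (z \<omega>) * cwick \<xi> zs \<omega> \<partial>M)) =
     ((\<integral>\<omega>. G \<omega> * complex_of_real (z \<omega>) * ?P \<omega> \<partial>M) + (\<integral>\<omega>. F \<omega> * ?c * ?P \<omega> \<partial>M)) +
       (\<integral>\<omega>. F \<omega> * complex_of_real (z \<omega>) * cwick \<xi> zs \<omega> \<partial>M)"
    by (simp add: mult.assoc)
  also have "(\<integral>\<omega>. G \<omega> * complex_of_real (z \<omega>) * ?P \<omega> \<partial>M) + (\<integral>\<omega>. F \<omega> * ?c * ?P \<omega> \<partial>M) =
    (\<integral>\<omega>. G \<omega> * complex_of_real (z \<omega>) * ?P \<omega> + F \<omega> * ?c * ?P \<omega> \<partial>M)"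
    by (rule Bochner_Integration.integral_add[symmetric]; intro i)
  finally show "(\<integral>\<omega>. \<xi> \<omega> * (F \<omega> * complex_of_real (z \<omega>)) * ?P \<omega> \<partial>M) =
     (\<integral>\<omega>. (G \<omega> * complex_of_real (z \<omega>) + F \<omega> * ?c) * ?P \<omega> \<partial>M) +
     (\<integral>\<omega>. F \<omega> * complex_of_real (z \<omega>) * cwick \<xi> zs \<omega> \<partial>M)"
    by (simp add: distrib_right mult.assoc)
qed

lemma stein_mult_generator:
  assumes FG: "stein \<xi> F G" and z: "z \<in> complex_span"
  shows "stein \<xi> (\<lambda>\<omega>. F \<omega> * z \<omega>) (\<lambda>\<omega>. G \<omega> * z \<omega> + F \<omega> * (\<integral>\<omega>. \<xi> \<omega> * z \<omega> \<partial>M))"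
proof -
  obtain A B where AB: "A \<in> L" "B \<in> L"
    and z: "z = (\<lambda>\<omega>. complex_of_real (A \<omega>) + \<i> * complex_of_real (B \<omega>))"
    using z by (auto simp: complex_span_def)
  have "(\<integral>\<omega>. \<xi> \<omega> * z \<omega> \<partial>M) =
      (\<integral>\<omega>. \<xi> \<omega> * complex_of_real (A \<omega>) + \<i> * (\<xi> \<omega> * complex_of_real (B \<omega>)) \<partial>M)"
    by (simp add: z algebra_simps)
  also have "\<dots> = (\<integral>\<omega>. \<xi> \<omega> * complex_of_real (A \<omega>) \<partial>M) + (\<integral>\<omega>. \<i> * (\<xi> \<omega> * complex_of_real (B \<omega>)) \<partial>M)"
    by (intro Bochner_Integration.integral_add all_moments_integrable all_moments_cmult
        all_moments_mult all_moments_complex_span[OF \<xi>] all_moments_of_real mom AB)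
  also have "(\<integral>\<omega>. \<i> * (\<xi> \<omega> * complex_of_real (B \<omega>)) \<partial>M) = \<i> * (\<integral>\<omega>. \<xi> \<omega> * complex_of_real (B \<omega>) \<partial>M)"
    by (rule integral_mult_right_zero)
  finally have cov: "(\<integral>\<omega>. \<xi> \<omega> * z \<omega> \<partial>M) = (\<integral>\<omega>. \<xi> \<omega> * complex_of_real (A \<omega>) \<partial>M) +
      \<i> * (\<integral>\<omega>. \<xi> \<omega> * complex_of_real (B \<omega>) \<partial>M)" .
  from stein_add[OF stein_mult_real_generator[OF FG AB(1)]
      stein_cmult[OF stein_mult_real_generator[OF FG AB(2)], of \<i>]]
  show ?thesis unfolding cov unfolding z by (simp add: algebra_simps)
qed

end

end

section \<open>Ballot numbers and noncrossing pairings\<close>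

text \<open>\<open>paths g p a\<close> is the \<open>z ^ a\<close>-coefficient of \<open>(z + g / z) ^ p\<close>, and \<open>ballot g p a\<close> counts the
  \<open>p\<close>-step nonnegative walks from \<open>0\<close> to \<open>a\<close>, each down-step having weight \<open>g\<close>.  In a noncrossing
  diagram these are the configurations of \<open>p\<close> points on a circle, respectively on a line, \<open>a\<close> of
  which stay unmatched.\<close>

definition paths :: "'a::comm_ring_1 \<Rightarrow> nat \<Rightarrow> nat \<Rightarrow> 'a" where
  "paths g p a =
     (if a \<le> p \<and> even (p - a) then g ^ ((p - a) div 2) * of_nat (p choose ((p - a) div 2)) else 0)"

definition ballot :: "'a::comm_ring_1 \<Rightarrow> nat \<Rightarrow> nat \<Rightarrow> 'a" where
  "ballot g p a = paths g p a - g * paths g p (Suc (Suc a))"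

lemma paths_0: "paths g 0 a = (if a = 0 then 1 else 0)"
  by (simp add: paths_def)

lemma paths_eq_0: "p < a \<or> odd (p + a) \<Longrightarrow> paths g p a = 0"
  by (auto simp: paths_def)

lemma paths_diag: "paths g (a + 2 * k) a = g ^ k * of_nat ((a + 2 * k) choose k)"
  by (simp add: paths_def)

text \<open>Multiplication by z + g / z, that is, Pascal's rule.\<close>

lemma paths_Suc_Suc: "paths g (Suc p) (Suc a) = paths g p a + g * paths g p (Suc (Suc a))"
proof (cases "a \<le> p \<and> even (p - a)")
  case True
  then obtain k where p: "p = a + 2 * k" by (metis dvd_def le_add_diff_inverse)
  show ?thesis
  proof (cases k)
    case 0
    then show ?thesis using p by (simp add: paths_def)
  next
    case (Suc j)
    have "paths g (Suc p) (Suc a) = g ^ k * of_nat (Suc p choose k)"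
      using paths_diag[of g "Suc a" k] p by simp
    moreover have "paths g p (Suc (Suc a)) = g ^ j * of_nat (p choose j)"
      using paths_diag[of g "Suc (Suc a)" j] p Suc by simp
    moreover have "paths g p a = g ^ k * of_nat (p choose k)"
      using paths_diag[of g a k] p by simp
    ultimately show ?thesis using Suc by (simp add: algebra_simps)
  qed
next
  case False
  then have "p < a \<or> odd (p + a)" by auto
  then have "Suc p < Suc a \<or> odd (Suc p + Suc a)" "p < Suc (Suc a) \<or> odd (p + Suc (Suc a))"
    by auto
  with \<open>p < a \<or> odd (p + a)\<close> show ?thesis by (simp only: paths_eq_0 mult_zero_right add_0_left)
qed

text \<open>The coefficient of 1/z, which the encoding does not contain, would enter here. By the
  symmetry z to g / z it is g times the coefficient of z, whence the factor 2.\<close>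

lemma paths_Suc_0: "paths g (Suc p) 0 = 2 * g * paths g p 1"
proof (cases "odd p")
  case True
  then obtain k where p: "p = 2 * k + 1" by (elim oddE)
  have "(2 * k + 1) choose k = (2 * k + 1) choose Suc k"
    using binomial_symmetric[of k "2 * k + 1"] by simp
  then have "Suc p choose Suc k = 2 * (p choose k)" using p by simp
  moreover have "paths g (Suc p) 0 = g ^ Suc k * of_nat (Suc p choose Suc k)"
    using paths_diag[of g 0 "Suc k"] p by simp
  moreover have "paths g p 1 = g ^ k * of_nat (p choose k)"
    using paths_diag[of g 1 k] p by simp
  ultimately show ?thesis by simp
qed (simp add: paths_eq_0)

lemma ballot_0: "ballot g 0 a = (if a = 0 then 1 else 0)"
  by (simp add: ballot_def paths_0)

lemma ballot_eq_0: "p < a \<or> odd (p + a) \<Longrightarrow> ballot g p a = 0"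
  by (auto simp: ballot_def paths_eq_0)

lemma ballot_Suc_Suc: "ballot g (Suc p) (Suc a) = ballot g p a + g * ballot g p (Suc (Suc a))"
  by (simp add: ballot_def paths_Suc_Suc algebra_simps)

text \<open>Compared with \<open>paths_Suc_0\<close> the factor 2 is gone, since a nonnegative walk
  cannot reach 0 from -1. This and \<open>ballot_Suc_Suc\<close> confirm the reflection formula used
  as definition.\<close>

lemma ballot_Suc_0: "ballot g (Suc p) 0 = g * ballot g p 1"
  by (simp add: ballot_def paths_Suc_Suc paths_Suc_0 algebra_simps)

text \<open>Decomposition at the first passage to level 1: before it lies an excursion below 0 of
  length i, weighted like one above 0, and after it a free walk from 1 to a + 1.\<close>

lemma paths_convolution: "paths g p (Suc a) = (\<Sum>i<p. ballot g i 0 * paths g (p - Suc i) a)"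
proof (induction p arbitrary: a)
  case (Suc p)
  have split: "(\<Sum>i<Suc p. ballot g i 0 * paths g (Suc p - Suc i) a) =
      (\<Sum>i<p. ballot g i 0 * paths g (Suc (p - Suc i)) a) + ballot g p 0 * paths g 0 a"
    by (simp add: Suc_diff_Suc)
  show ?case
  proof (cases a)
    case 0
    have "(\<Sum>i<p. ballot g i 0 * paths g (Suc (p - Suc i)) 0) =
        2 * g * (\<Sum>i<p. ballot g i 0 * paths g (p - Suc i) (Suc 0))"
      by (simp add: paths_Suc_0 sum_distrib_left mult_ac)
    also have "\<dots> = 2 * g * paths g p (Suc (Suc 0))" using Suc.IH by simp
    finally have eq: "(\<Sum>i<p. ballot g i 0 * paths g (Suc (p - Suc i)) 0) =
        2 * g * paths g p (Suc (Suc 0))" .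
    show ?thesis unfolding 0 split[unfolded 0] eq
      by (simp add: paths_Suc_Suc paths_0 ballot_def algebra_simps)
  next
    case (Suc b)
    have "(\<Sum>i<p. ballot g i 0 * paths g (Suc (p - Suc i)) (Suc b)) =
        (\<Sum>i<p. ballot g i 0 * paths g (p - Suc i) b) +
        g * (\<Sum>i<p. ballot g i 0 * paths g (p - Suc i) (Suc (Suc b)))"
      by (simp add: paths_Suc_Suc distrib_left sum.distrib sum_distrib_left mult_ac)
    also have "\<dots> = paths g p (Suc b) + g * paths g p (Suc (Suc (Suc b)))"
      using Suc.IH by simp
    finally show ?thesis unfolding split using \<open>a = Suc b\<close>
      by (simp add: paths_Suc_Suc paths_0)
  qed
qed (simp add: paths_0)

text \<open>Decomposition at the last visit to 0; algebraically the difference of two instances of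
  \<open>paths_convolution\<close>.\<close>

lemma ballot_convolution: "ballot g p (Suc a) = (\<Sum>i<p. ballot g i 0 * ballot g (p - Suc i) a)"
  by (simp add: ballot_def[of g _ a] ballot_def[of g _ "Suc a"] paths_convolution[of g p]
      right_diff_distrib sum_subtractf sum_distrib_left mult_ac)

text \<open>Arranged in the shape of the annular recursion: the first point is paired within its own
  circle, with the other circle on either side of the chord (hence \<open>2 * g\<close>), or it
  joins the two circles.\<close>

lemma paths_Suc_Suc_convolution:
  "paths g (Suc p) (Suc a) =
     2 * g * (\<Sum>i<p. ballot g i 0 * paths g (p - Suc i) (Suc a)) + ballot g p a"
  by (simp add: paths_Suc_Suc ballot_def[of g p a] algebra_simps flip: paths_convolution)

text \<open>Cycle lemma. Both sides count diagrams on a circle of q + 1 points with a + 1 unmatched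
  points, one of them marked: mark it afterwards, or choose it first and cut the circle open
  there.\<close>

lemma paths_eq_ballot: "of_nat (Suc a) * paths g (Suc q) (Suc a) = of_nat (Suc q) * ballot g q a"
proof (cases "a \<le> q \<and> even (q - a)")
  case True
  then obtain k where q: "q = a + 2 * k" by (metis dvd_def le_add_diff_inverse)
  have 1: "paths g (Suc q) (Suc a) = g ^ k * of_nat (Suc q choose k)"
    using paths_diag[of g "Suc a" k] q by simp
  have 2: "paths g q a = g ^ k * of_nat (q choose k)"
    using paths_diag[of g a k] q by simp
  show ?thesis
  proof (cases k)
    case 0
    then show ?thesis using q by (simp add: ballot_def paths_def)
  next
    case (Suc j)
    have 3: "paths g q (Suc (Suc a)) = g ^ j * of_nat (q choose j)"
      using paths_diag[of g "Suc (Suc a)" j] q Suc by simp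
    \<comment> \<open>The ring has neither division nor order, so the identity between binomials is
      proved over the integers and transported by \<open>of_int\<close>.\<close>
    define x y where "x = int (q choose j)" and "y = int (q choose Suc j)"
    have "Suc j * (q choose Suc j) = (q - j) * (q choose j)"
      by (metis binomial_absorption binomial_absorb_comp)
    moreover have "q - j = a + j + 2" using q Suc by simp
    ultimately have "int (Suc j * (q choose Suc j)) = int ((a + j + 2) * (q choose j))" by simp
    then have "int (Suc j) * y = int (a + j + 2) * x" unfolding x_def y_def by (simp only: of_nat_mult)
    moreover have "int q = int a + 2 * int j + 2" using q Suc by simp
    ultimately have "int (Suc a) * (x + y) = int (Suc q) * (y - x)" by (simp add: algebra_simps)
    then have "int (Suc a) * (int (q choose j) + int (q choose Suc j)) =
        int (Suc q) * (int (q choose Suc j) - int (q choose j))"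
      unfolding x_def y_def .
    then have "of_int (int (Suc a) * (int (q choose j) + int (q choose Suc j))) =
        (of_int (int (Suc q) * (int (q choose Suc j) - int (q choose j))) :: 'a)"
      by simp
    then have "of_nat (Suc a) * (of_nat (q choose j) + of_nat (q choose Suc j)) =
        of_nat (Suc q) * (of_nat (q choose Suc j) - of_nat (q choose j) :: 'a)"
      by (simp only: of_int_mult of_int_add of_int_diff of_int_of_nat_eq)
    then have "g ^ k * (of_nat (Suc a) * (of_nat (q choose j) + of_nat (q choose Suc j))) =
        g ^ k * (of_nat (Suc q) * (of_nat (q choose Suc j) - of_nat (q choose j)))"
      by simp
    then show ?thesis unfolding ballot_def 1 2 3 Suc by (simp add: algebra_simps)
  qed
next
  case False
  then have "q < a \<or> odd (q + a)" by auto
  then show ?thesis by (simp add: paths_eq_0 ballot_eq_0)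
qed

section \<open>Solution of the limit recursion on the disc and on the annulus\<close>

lemma sum_lessThan_add_split:
  fixes f :: "nat \<Rightarrow> 'a::comm_monoid_add"
  shows "(\<Sum>s<n + q. f s) = (\<Sum>s<n. f s) + (\<Sum>i<q. f (n + i))"
  by (induction q) (simp_all add: add.assoc)

text \<open>Removing the letter \<open>v ! t\<close> from the cyclic word \<open>v\<close> leaves the linear word \<open>cut_at t v\<close>.\<close>

definition cut_at :: "nat \<Rightarrow> 'l list \<Rightarrow> 'l list" where
  "cut_at t v = drop (Suc t) v @ take t v"

lemma length_cut_at [simp]: "t < length v \<Longrightarrow> length (cut_at t v) = length v - 1"
  by (simp add: cut_at_def)

text \<open>The recursion follows the partner of the first letter. A partner in the same word splits
  that word, and exactly one of the two parts remains connected to \<open>v\<close>; a partner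
  \<open>v ! t\<close> merges the two circles into one, so that only \<open>m\<close>
  occurs.\<close>

locale loop_limits =
  fixes c :: "'l \<Rightarrow> 'l \<Rightarrow> 'c::comm_ring_1"
    and m :: "'l list \<Rightarrow> 'c"
    and k :: "'l list \<Rightarrow> 'l list \<Rightarrow> 'c"
  assumes m_Nil: "m [] = 1"
    and m_Cons: "m (b # w) =
      (\<Sum>s<length w. c b (w ! s) * (m (take s w) * m (drop (Suc s) w)))"
    and k_Nil: "k [] v = 0"
    and k_Cons: "k (b # w) v =
      (\<Sum>s<length w. c b (w ! s) *
         (m (take s w) * k (drop (Suc s) w) v + k (take s w) v * m (drop (Suc s) w))) +
      (\<Sum>t<length v. c b (v ! t) * m (w @ cut_at t v))"
begin

lemma m_odd: "odd (length w) \<Longrightarrow> m w = 0"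
proof (induction w rule: length_induct)
  case (1 w)
  show ?case
  proof (cases w)
    case (Cons b w')
    have "m (take s w') * m (drop (Suc s) w') = 0" if "s < length w'" for s
    proof -
      have "odd (length (take s w')) \<or> odd (length (drop (Suc s) w'))"
        using 1 that Cons by auto
      then show ?thesis using "1.IH" Cons by auto
    qed
    then show ?thesis using Cons by (simp add: m_Cons)
  qed (use 1 in simp)
qed

lemma k_odd: "odd (length u + length v) \<Longrightarrow> k u v = 0"
proof (induction u rule: length_induct)
  case (1 u)
  show ?case
  proof (cases u)
    case (Cons b w)
    have "m (take s w) * k (drop (Suc s) w) v = 0 \<and> k (take s w) v * m (drop (Suc s) w) = 0"
      if s: "s < length w" for s
    proof -
      have "odd (length (take s w)) \<or> odd (length (drop (Suc s) w) + length v)"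
        "odd (length (take s w) + length v) \<or> odd (length (drop (Suc s) w))"
        using 1 s Cons by auto
      then show ?thesis using "1.IH" Cons m_odd by auto
    qed
    moreover have "m (w @ cut_at t v) = 0" if t: "t < length v" for t
    proof (rule m_odd)
      have "odd (length u + length v)" "0 < length v" using 1 t by auto
      then show "odd (length (w @ cut_at t v))" using t Cons by simp
    qed
    ultimately show ?thesis using Cons by (simp add: k_Cons)
  qed (simp add: k_Nil)
qed

text \<open>A pair of a noncrossing pairing encloses an even number of letters, so only positions at
  odd distance can be paired. Constant words qualify with their own weight, words in which two
  letters alternate with the weight of unequal letters.\<close>

definition alternating :: "'c \<Rightarrow> 'l list \<Rightarrow> bool" where
  "alternating g w \<longleftrightarrow> (\<forall>i j. i < j \<longrightarrow> j < length w \<longrightarrow> odd (i + j) \<longrightarrow> c (w ! i) (w ! j) = g)"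

lemma alternatingD:
  "alternating g w \<Longrightarrow> i < j \<Longrightarrow> j < length w \<Longrightarrow> odd (i + j) \<Longrightarrow> c (w ! i) (w ! j) = g"
  by (auto simp: alternating_def)

lemma alternating_take: "alternating g w \<Longrightarrow> alternating g (take s w)"
  by (auto simp: alternating_def)

lemma alternating_drop:
  assumes "alternating g w"
  shows "alternating g (drop s w)"
  unfolding alternating_def
proof (intro allI impI)
  fix i j assume "i < j" "j < length (drop s w)" "odd (i + j)"
  then show "c (drop s w ! i) (drop s w ! j) = g"
    using alternatingD[OF assms, of "s + i" "s + j"] by simp
qed

lemma alternating_tl: "alternating g (b # w) \<Longrightarrow> alternating g w"
  using alternating_drop[of g "b # w" 1] by simp

text \<open>Every pair that can occur weighs g, so the recursion for \<open>m\<close> is the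
  weighted Catalan recursion; for odd s the weight is unknown, but a factor of odd length
  vanishes.\<close>

lemma m_alternating: "alternating g w \<Longrightarrow> m w = ballot g (length w) 0"
proof (induction w rule: length_induct)
  case (1 w)
  show ?case
  proof (cases w)
    case Nil
    then show ?thesis by (simp add: m_Nil ballot_0)
  next
    case (Cons b w')
    let ?n = "length w'"
    note alt = alternating_tl[OF 1(2)[unfolded Cons]]
    have "c b (w' ! s) * (m (take s w') * m (drop (Suc s) w')) =
        g * (ballot g s 0 * ballot g (?n - Suc s) 0)" if s: "s < ?n" for s
    proof (cases "even s")
      case True
      then have "c b (w' ! s) = g"
        using alternatingD[OF 1(2)[unfolded Cons], of 0 "Suc s"] s by simp
      moreover have "m (take s w') = ballot g s 0"
        using "1.IH" alternating_take[OF alt] s Cons by simp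
      moreover have "m (drop (Suc s) w') = ballot g (?n - Suc s) 0"
        using "1.IH" alternating_drop[OF alt, of "Suc s"] s Cons by simp
      ultimately show ?thesis by simp
    next
      case False
      then show ?thesis using s by (simp add: m_odd ballot_eq_0)
    qed
    then have "m w = g * (\<Sum>s<?n. ballot g s 0 * ballot g (?n - Suc s) 0)"
      using Cons by (simp add: m_Cons sum_distrib_left)
    then show ?thesis using Cons
      by (simp add: ballot_Suc_0 flip: ballot_convolution)
  qed
qed

text \<open>In \<open>u @ v\<close> the letter \<open>v ! j\<close> has position
  \<open>length u + j\<close>; the parity condition is again that of odd distance, and pairs between
  the two blocks have a weight d of their own.\<close>

definition crossing :: "'c \<Rightarrow> 'c \<Rightarrow> 'l list \<Rightarrow> 'l list \<Rightarrow> bool" where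
  "crossing g d u v \<longleftrightarrow> alternating g u \<and> alternating g v \<and>
     (\<forall>i<length u. \<forall>j<length v. odd (i + j + length u) \<longrightarrow> c (u ! i) (v ! j) = d)"

lemma crossing_drop:
  assumes "crossing g d u v" "s \<le> length u"
  shows "crossing g d (drop s u) v"
  unfolding crossing_def
proof (intro conjI allI impI)
  show "alternating g (drop s u)" "alternating g v"
    using assms alternating_drop by (auto simp: crossing_def)
  fix i j assume ij: "i < length (drop s u)" "j < length v" "odd (i + j + length (drop s u))"
  have "s + i < length u" "odd (s + i + j + length u)"
    using ij assms(2) by auto
  then have "c (u ! (s + i)) (v ! j) = d"
    using assms(1) ij(2) unfolding crossing_def by blast
  then show "c (drop s u ! i) (v ! j) = d" using assms(2) by simp
qed

lemma crossing_take: "crossing g d u v \<Longrightarrow> crossing g d u (take s v)"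
  by (auto simp: crossing_def intro: alternating_take)

text \<open>The index \<open>r\<close> is the number of pairs between \<open>u\<close> and \<open>v\<close>.\<close>

lemma m_crossing:
  assumes "crossing g d u v" "length u < R"
  shows "m (u @ v) = (\<Sum>r<R. d ^ r * ballot g (length u) r * ballot g (length v) r)"
  using assms
proof (induction u arbitrary: v R rule: length_induct)
  case (1 u)
  \<comment> \<open>The bound R is any number above \<open>length u\<close>, so one and the same
    range of summation serves for all shorter words in the induction.\<close>
  obtain R' where R: "R = Suc R'" using 1(3) by (cases R) auto
  show ?case
  proof (cases u)
    case Nil
    have "(\<Sum>r<R'. d ^ Suc r * ballot g 0 (Suc r) * ballot g (length v) (Suc r)) = 0"
      by (simp add: ballot_0)
    then show ?thesis using 1(2) Nil m_alternating[of g v] R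
      by (simp add: crossing_def ballot_0 sum.lessThan_Suc_shift del: sum.lessThan_Suc)
  next
    case (Cons b w)
    let ?n = "length w" and ?q = "length v"
    have R': "?n < R'" using 1(3) R Cons by simp
    have cr: "crossing g d w v" using crossing_drop[OF 1(2), of 1] Cons by simp
    have alt: "alternating g w" "alternating g v" using cr by (auto simp: crossing_def)
    have IH: "crossing g d u' v' \<Longrightarrow> length u' \<le> ?n \<Longrightarrow>
        m (u' @ v') = (\<Sum>r<R. d ^ r * ballot g (length u') r * ballot g (length v') r)" for u' v'
      using "1.IH"[rule_format, of u' v' R] Cons R R' by simp
    \<comment> \<open>\<open>b\<close> is paired inside \<open>u\<close>: the enclosed letters close
      up among themselves, and all pairs to \<open>v\<close> start behind the partner.\<close>
    have left: "c b ((w @ v) ! s) * (m (take s (w @ v)) * m (drop (Suc s) (w @ v))) =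
        (\<Sum>r<R. d ^ r * ballot g ?q r * g * (ballot g s 0 * ballot g (?n - Suc s) r))"
      if s: "s < ?n" for s
    proof (cases "even s")
      case True
      then have "c b (w ! s) = g"
        using 1(2) alternatingD[of g u 0 "Suc s"] s Cons by (simp add: crossing_def)
      moreover have "m (take s w) = ballot g s 0"
        using m_alternating[OF alternating_take[OF alt(1)], of s] s by simp
      moreover have "m (drop (Suc s) w @ v) =
          (\<Sum>r<R. d ^ r * ballot g (?n - Suc s) r * ballot g ?q r)"
        using IH[OF crossing_drop[OF cr, of "Suc s"]] s by simp
      ultimately show ?thesis using s
        by (simp add: nth_append sum_distrib_left mult_ac)
    next
      case False
      then show ?thesis using s by (simp add: m_odd ballot_eq_0)
    qed
    \<comment> \<open>\<open>b\<close> is paired with \<open>v ! i\<close>: this pair encloses the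
      rest of \<open>u\<close>, and the letters of \<open>v\<close> behind it close up among
      themselves. It is one more pair across, hence the extra factor d.\<close>
    have right: "c b ((w @ v) ! (?n + i)) * (m (take (?n + i) (w @ v)) * m (drop (Suc (?n + i)) (w @ v))) =
        (\<Sum>r<R. d ^ Suc r * ballot g ?n r * (ballot g i r * ballot g (?q - Suc i) 0))"
      if i: "i < ?q" for i
    proof -
      have m1: "m (w @ take i v) = (\<Sum>r<R. d ^ r * ballot g ?n r * ballot g i r)"
        using IH[OF crossing_take[OF cr, of i]] i by simp
      have m2: "m (drop (Suc i) v) = ballot g (?q - Suc i) 0"
        using m_alternating[OF alternating_drop[OF alt(2), of "Suc i"]] by simp
      \<comment> \<open>For the wrong parity the weight is not known, but then the enclosed word has
        odd length and \<open>m\<close> vanishes.\<close>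
      have cb: "c b (v ! i) * m (w @ take i v) = d * m (w @ take i v)"
      proof (cases "even (?n + i)")
        case True
        then have "odd (0 + i + length u)" using Cons by auto
        then have "c (u ! 0) (v ! i) = d"
          using 1(2) i Cons unfolding crossing_def by (metis length_greater_0_conv list.distinct(1))
        then show ?thesis using Cons by simp
      next
        case False
        then show ?thesis using i by (simp add: m_odd)
      qed
      have "c b ((w @ v) ! (?n + i)) * (m (take (?n + i) (w @ v)) * m (drop (Suc (?n + i)) (w @ v))) =
          (c b (v ! i) * m (w @ take i v)) * m (drop (Suc i) v)"
        using i by (simp add: nth_append mult.assoc)
      also have "\<dots> = d * (\<Sum>r<R. d ^ r * ballot g ?n r * ballot g i r) * ballot g (?q - Suc i) 0"
        unfolding cb unfolding m2 m1 ..
      also have "\<dots> = (\<Sum>r<R. d ^ Suc r * ballot g ?n r * (ballot g i r * ballot g (?q - Suc i) 0))"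
        by (simp add: sum_distrib_left sum_distrib_right mult_ac)
      finally show ?thesis .
    qed
    have rev: "(\<Sum>i<?q. ballot g i r * ballot g (?q - Suc i) 0) = ballot g ?q (Suc r)" for r
      unfolding ballot_convolution
      by (subst sum.nat_diff_reindex[symmetric]) (simp add: mult.commute Suc_diff_Suc)
    have "m (u @ v) = (\<Sum>s<?n + ?q. c b ((w @ v) ! s) *
        (m (take s (w @ v)) * m (drop (Suc s) (w @ v))))"
      using Cons m_Cons[of b "w @ v"] by simp
    also have "\<dots> =
       (\<Sum>s<?n. c b ((w @ v) ! s) * (m (take s (w @ v)) * m (drop (Suc s) (w @ v)))) +
       (\<Sum>i<?q. c b ((w @ v) ! (?n + i)) *
         (m (take (?n + i) (w @ v)) * m (drop (Suc (?n + i)) (w @ v))))"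
      by (rule sum_lessThan_add_split)
    also have "\<dots> =
       (\<Sum>s<?n. \<Sum>r<R. d ^ r * ballot g ?q r * g * (ballot g s 0 * ballot g (?n - Suc s) r)) +
       (\<Sum>i<?q. \<Sum>r<R. d ^ Suc r * ballot g ?n r * (ballot g i r * ballot g (?q - Suc i) 0))"
      by (intro arg_cong2[where f = "(+)"] sum.cong refl left right) auto
    also have "\<dots> = (\<Sum>r<R. d ^ r * ballot g ?q r * g * ballot g ?n (Suc r)) +
        (\<Sum>r<R. d ^ Suc r * ballot g ?n r * ballot g ?q (Suc r))"
      by (subst (1 2) sum.swap) (simp add: rev ballot_convolution[of g ?n] flip: sum_distrib_left)
    \<comment> \<open>The summand of index \<open>R'\<close> is zero because \<open>?n < R'\<close>;
      without it the sum matches the other one after its index shift.\<close>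
    also have "(\<Sum>r<R. d ^ Suc r * ballot g ?n r * ballot g ?q (Suc r)) =
        (\<Sum>r<R'. d ^ Suc r * ballot g ?n r * ballot g ?q (Suc r))"
      using R R' by (simp add: ballot_eq_0)
    also have "(\<Sum>r<R. d ^ r * ballot g ?q r * g * ballot g ?n (Suc r)) =
        ballot g ?q 0 * g * ballot g ?n 1 +
        (\<Sum>r<R'. d ^ Suc r * ballot g ?q (Suc r) * g * ballot g ?n (Suc (Suc r)))"
      unfolding R by (simp add: sum.lessThan_Suc_shift del: sum.lessThan_Suc)
    also have "ballot g ?q 0 * g * ballot g ?n 1 +
        (\<Sum>r<R'. d ^ Suc r * ballot g ?q (Suc r) * g * ballot g ?n (Suc (Suc r))) +
        (\<Sum>r<R'. d ^ Suc r * ballot g ?n r * ballot g ?q (Suc r)) =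
        (\<Sum>r<R. d ^ r * ballot g (Suc ?n) r * ballot g ?q r)"
    proof -
      have "d ^ Suc r * ballot g (Suc ?n) (Suc r) * ballot g ?q (Suc r) =
          d ^ Suc r * ballot g ?q (Suc r) * g * ballot g ?n (Suc (Suc r)) +
          d ^ Suc r * ballot g ?n r * ballot g ?q (Suc r)" for r
        unfolding ballot_Suc_Suc by (simp only: distrib_left distrib_right mult_ac add_ac)
      moreover have "d ^ 0 * ballot g (Suc ?n) 0 * ballot g ?q 0 = ballot g ?q 0 * g * ballot g ?n 1"
        unfolding ballot_Suc_0 by (simp only: power_0 mult_1_left mult_ac)
      ultimately show ?thesis
        unfolding R sum.lessThan_Suc_shift by (simp only: sum.distrib add.assoc)
    qed
    finally show ?thesis using Cons by simp
  qed
qed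

text \<open>All pairs inside one of the two words weigh \<open>g\<close>; once a letter of \<open>u\<close> is joined to \<open>v ! t\<close>,
  the remaining pairs between the two words, nested around this one, have the same weight.  Indices of
  the wrong parity are exempt because they leave an odd number of letters to be matched.  The
  weights enter the result only through the power sums \<open>S\<close>.\<close>

definition annular :: "'c \<Rightarrow> (nat \<Rightarrow> 'c) \<Rightarrow> 'l list \<Rightarrow> 'l list \<Rightarrow> bool" where
  "annular g S u v \<longleftrightarrow>
     (\<forall>t<length v. alternating g (cut_at t v)) \<and>
     (\<forall>i j. i < j \<longrightarrow> j < length u \<longrightarrow> odd (i + j) \<or> odd (length v) \<longrightarrow> c (u ! i) (u ! j) = g) \<and>
     (\<forall>t i j. \<forall>l<length v - 1. t < length v \<longrightarrow> i < j \<longrightarrow> j < length u \<longrightarrow>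
        odd (j - i + l + length v) \<longrightarrow> c (u ! j) (cut_at t v ! l) = c (u ! i) (v ! t)) \<and>
     (\<forall>i<length u. \<forall>a. (\<Sum>t<length v. c (u ! i) (v ! t) ^ Suc a) = S a)"

lemma annular_take: "annular g S u v \<Longrightarrow> annular g S (take s u) v"
  unfolding annular_def by auto

lemma annular_drop:
  assumes "annular g S u v"
  shows "annular g S (drop s u) v"
  unfolding annular_def
proof (intro conjI allI impI; (elim exE conjE)?)
  fix t assume "t < length v"
  then show "alternating g (cut_at t v)" using assms by (simp add: annular_def)
next
  fix i j assume "i < j" "j < length (drop s u)" "odd (i + j) \<or> odd (length v)"
  then have "s + i < s + j" "s + j < length u" "odd ((s + i) + (s + j)) \<or> odd (length v)" by auto
  then have "c (u ! (s + i)) (u ! (s + j)) = g"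
    using assms unfolding annular_def by blast
  then show "c (drop s u ! i) (drop s u ! j) = g" using \<open>s + j < length u\<close> by simp
next
  fix t i j l assume *: "l < length v - 1" "t < length v" "i < j" "j < length (drop s u)"
    "odd (j - i + l + length v)"
  then have "s + i < s + j" "s + j < length u" "odd ((s + j) - (s + i) + l + length v)" by auto
  then have "c (u ! (s + j)) (cut_at t v ! l) = c (u ! (s + i)) (v ! t)"
    using assms * unfolding annular_def by blast
  then show "c (drop s u ! j) (cut_at t v ! l) = c (drop s u ! i) (v ! t)"
    using \<open>s + j < length u\<close> by simp
next
  fix i a assume "i < length (drop s u)"
  then have "s + i < length u" by simp
  then have "(\<Sum>t<length v. c (u ! (s + i)) (v ! t) ^ Suc a) = S a"
    using assms unfolding annular_def by blast
  then show "(\<Sum>t<length v. c (drop s u ! i) (v ! t) ^ Suc a) = S a"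
    using \<open>s + i < length u\<close> by simp
qed

text \<open>The summand of index \<open>a\<close> counts the diagrams with \<open>a + 1\<close> pairs between \<open>u\<close> and \<open>v\<close>.\<close>

lemma k_annular:
  assumes "annular g S u v" "length u \<le> R" "v \<noteq> []"
  shows "k u v = (\<Sum>a<R. S a * paths g (length u) (Suc a) * ballot g (length v - 1) a)"
  using assms(1,2)
proof (induction u rule: length_induct)
  case (1 u)
  let ?q = "length v - 1"
  have v: "Suc ?q = length v" using assms(3) by (cases v) auto
  \<comment> \<open>The claimed value depends on the first word only through its length; keeping R
    fixed makes the values for all subwords comparable.\<close>
  define K where "K n = (\<Sum>a<R. S a * paths g n (Suc a) * ballot g ?q a)" for n
  show ?case
  proof (cases u)
    case Nil
    then show ?thesis by (simp add: k_Nil paths_0)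
  next
    case (Cons b w)
    let ?n = "length w"
    \<comment> \<open>An odd total number of letters makes both sides vanish. It is treated apart
      since \<open>annular\<close> controls the weights only for the parities that can
      occur.\<close>
    show ?thesis
    proof (cases "odd (length u + length v)")
      case True
      have "paths g (length u) (Suc a) * ballot g ?q a = 0" for a
      proof -
        have "odd (length u + Suc a) \<or> odd (?q + a)" using True v by presburger
        then show ?thesis by (auto simp: paths_eq_0 ballot_eq_0)
      qed
      then show ?thesis using True by (simp add: k_odd mult.assoc)
    next
      case False
      have ann: "annular g S w v" using annular_drop[OF 1(2), of 1] Cons by simp
      have altw: "alternating g w"
        using ann unfolding annular_def alternating_def by blast
      have IH: "k u' v = K (length u')" if "annular g S u' v" "length u' \<le> ?n" for u'
        using "1.IH" that 1(3) Cons unfolding K_def by simp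
      have inner: "c b (w ! s) * (m (take s w) * k (drop (Suc s) w) v + k (take s w) v * m (drop (Suc s) w))
          = g * (ballot g s 0 * K (?n - Suc s)) + g * (K s * ballot g (?n - Suc s) 0)"
        if s: "s < ?n" for s
      proof -
        have m1: "m (take s w) = ballot g s 0"
          using m_alternating[OF alternating_take[OF altw], of s] s by simp
        have m2: "m (drop (Suc s) w) = ballot g (?n - Suc s) 0"
          using m_alternating[OF alternating_drop[OF altw], of "Suc s"] s by simp
        have k1: "k (take s w) v = K s" using IH[OF annular_take[OF ann], of s] s by simp
        have k2: "k (drop (Suc s) w) v = K (?n - Suc s)"
          using IH[OF annular_drop[OF ann], of "Suc s"] s by simp
        show ?thesis
        \<comment> \<open>If s is odd and \<open>length v\<close> even, the weight is not
          controlled, but both parts of \<open>w\<close> then have odd length, so neither can close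
          up.\<close>
        proof (cases "even s \<or> odd (length v)")
          case True
          then have "odd (0 + Suc s) \<or> odd (length v)" "Suc s < length u" "0 < Suc s"
            using s Cons by auto
          then have "c (u ! 0) (u ! Suc s) = g"
            using 1(2) unfolding annular_def by blast
          then show ?thesis unfolding m1 m2 k1 k2 using Cons by (simp add: algebra_simps)
        next
          case odd: False
          then have "odd (?n - Suc s)" using False s Cons by simp
          with odd have "ballot g s 0 = 0" "ballot g (?n - Suc s) 0 = 0"
            by (auto simp: ballot_eq_0)
          then show ?thesis unfolding m1 m2 by simp
        qed
      qed
      \<comment> \<open>Once \<open>b\<close> is joined to \<open>v ! t\<close>, the annulus is cut
        open to a disc with boundary \<open>w @ cut_at t v\<close>. The r further pairs across share
        the weight of the first, so summing over t will produce the power sum \<open>S r\<close>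
        with exponent r + 1.\<close>
      have outer: "m (w @ cut_at t v) = (\<Sum>r<R. c b (v ! t) ^ r * ballot g ?n r * ballot g ?q r)"
        if t: "t < length v" for t
      proof -
        have "crossing g (c b (v ! t)) w (cut_at t v)"
          unfolding crossing_def
        proof (intro conjI allI impI)
          show "alternating g w" by (rule altw)
          show "alternating g (cut_at t v)" using ann t by (simp add: annular_def)
          fix i j assume ij: "i < ?n" "j < length (cut_at t v)" "odd (i + j + ?n)"
          have "odd (Suc i - 0 + j + length v)"
            using False ij(3) Cons by auto
          moreover have "j < length v - 1" "0 < Suc i" "Suc i < length u"
            using ij t Cons by auto
          ultimately have "c (u ! Suc i) (cut_at t v ! j) = c (u ! 0) (v ! t)"
            using 1(2) t unfolding annular_def by blast
          then show "c (w ! i) (cut_at t v ! j) = c b (v ! t)" using Cons by simp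
        qed
        from m_crossing[OF this, of R] show ?thesis using 1(3) Cons t by simp
      qed
      have "k u v = (\<Sum>s<?n. g * (ballot g s 0 * K (?n - Suc s)) + g * (K s * ballot g (?n - Suc s) 0)) +
          (\<Sum>t<length v. c b (v ! t) * (\<Sum>r<R. c b (v ! t) ^ r * ballot g ?n r * ballot g ?q r))"
        unfolding Cons k_Cons
        by (intro arg_cong2[where f = "(+)"] sum.cong refl) (simp_all add: inner outer)
      also have "(\<Sum>s<?n. g * (ballot g s 0 * K (?n - Suc s)) + g * (K s * ballot g (?n - Suc s) 0)) =
          g * (\<Sum>s<?n. ballot g s 0 * K (?n - Suc s)) + g * (\<Sum>s<?n. K s * ballot g (?n - Suc s) 0)"
        by (simp add: sum.distrib sum_distrib_left)
      \<comment> \<open>Reversing the index shows that both ways of splitting contribute equally,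
        which gives the \<open>2 * g\<close> of \<open>paths_Suc_Suc_convolution\<close>.\<close>
      also have "(\<Sum>s<?n. K s * ballot g (?n - Suc s) 0) = (\<Sum>s<?n. ballot g s 0 * K (?n - Suc s))"
        by (subst sum.nat_diff_reindex[symmetric]) (simp add: mult.commute Suc_diff_Suc)
      also have "(\<Sum>s<?n. ballot g s 0 * K (?n - Suc s)) =
          (\<Sum>a<R. S a * ballot g ?q a * (\<Sum>s<?n. ballot g s 0 * paths g (?n - Suc s) (Suc a)))"
        unfolding K_def sum_distrib_left
        by (subst sum.swap) (simp add: mult_ac)
      also have "(\<Sum>t<length v. c b (v ! t) * (\<Sum>r<R. c b (v ! t) ^ r * ballot g ?n r * ballot g ?q r)) =
          (\<Sum>r<R. (\<Sum>t<length v. c b (v ! t) ^ Suc r) * ballot g ?n r * ballot g ?q r)"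
        unfolding sum_distrib_left sum_distrib_right
        by (subst sum.swap) (simp add: mult_ac)
      also have "\<dots> = (\<Sum>r<R. S r * ballot g ?n r * ballot g ?q r)"
      proof -
        have "0 < length u" using Cons by simp
        then have "(\<Sum>t<length v. c (u ! 0) (v ! t) ^ Suc r) = S r" for r
          using 1(2) unfolding annular_def by blast
        then show ?thesis using Cons by simp
      qed
      finally have "k u v = (\<Sum>a<R. S a * ballot g ?q a *
          (2 * g * (\<Sum>s<?n. ballot g s 0 * paths g (?n - Suc s) (Suc a)) + ballot g ?n a))"
        by (simp add: sum_distrib_left distrib_left sum.distrib mult_ac)
      then show ?thesis unfolding Cons
        by (simp add: paths_Suc_Suc_convolution[of g ?n] mult_ac)
    qed
  qed
qed

end

section \<open>Loop equations for traces\<close>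

lemma integral_sum2:
  fixes f :: "'i \<Rightarrow> 'j \<Rightarrow> 'a \<Rightarrow> 'b::{banach,second_countable_topology}"
  assumes "\<And>i k. i \<in> A \<Longrightarrow> k \<in> B i \<Longrightarrow> integrable M (f i k)"
  shows "(\<integral>\<omega>. (\<Sum>i\<in>A. \<Sum>k\<in>B i. f i k \<omega>) \<partial>M) = (\<Sum>i\<in>A. \<Sum>k\<in>B i. \<integral>\<omega>. f i k \<omega> \<partial>M)"
  by (subst Bochner_Integration.integral_sum)
    (auto intro!: Bochner_Integration.integrable_sum sum.cong Bochner_Integration.integral_sum assms)

definition letter_cov :: "'c::one \<Rightarrow> bool \<Rightarrow> bool \<Rightarrow> 'c" where
  "letter_cov \<gamma> b b' = (if b = b' then \<gamma> else 1)"

text \<open>\<open>e True\<close> and \<open>e False\<close> are the entries of \<open>X\<close> and of its adjoint, so that a word in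
  \<open>X\<close> and \<open>X\<^sup>*\<close> is a list of booleans.\<close>

locale elliptic_ensemble = gaussian_space M L for M :: "'a measure" and L +
  fixes N :: nat and \<gamma> :: complex and e :: "bool \<Rightarrow> nat \<Rightarrow> nat \<Rightarrow> 'a \<Rightarrow> complex"
  assumes entry_span: "i < N \<Longrightarrow> j < N \<Longrightarrow> e b i j \<in> complex_span"
    and entry_cov: "i < N \<Longrightarrow> j < N \<Longrightarrow> k < N \<Longrightarrow> l < N \<Longrightarrow>
      (\<integral>\<omega>. e b i j \<omega> * e b' k l \<omega> \<partial>M) =
      (if i = l \<and> j = k then letter_cov \<gamma> b b' / of_nat N else 0)"
begin

fun word_entry :: "bool list \<Rightarrow> nat \<Rightarrow> nat \<Rightarrow> 'a \<Rightarrow> complex" where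
  "word_entry [] i j \<omega> = (if i = j then 1 else 0)"
| "word_entry (b # w) i j \<omega> = (\<Sum>k<N. e b i k \<omega> * word_entry w k j \<omega>)"

definition word_trace :: "bool list \<Rightarrow> 'a \<Rightarrow> complex" where
  "word_trace w \<omega> = (\<Sum>i<N. word_entry w i i \<omega>)"

text \<open>The centring constants are left open because a constant has derivative zero; they become
  the expectations only after the loop equation.\<close>

definition trace_prod :: "(bool list \<Rightarrow> complex) \<Rightarrow> bool list list \<Rightarrow> 'a \<Rightarrow> complex" where
  "trace_prod a us \<omega> = (\<Prod>u\<leftarrow>us. word_trace u \<omega> - a u)"

lemma word_entry_append:
  "i < N \<Longrightarrow> word_entry (u @ v) i j \<omega> = (\<Sum>k<N. word_entry u i k \<omega> * word_entry v k j \<omega>)"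
proof (induction u arbitrary: i)
  case Nil
  have "(\<Sum>k<N. (if i = k then 1 else 0) * word_entry v k j \<omega>) =
      (\<Sum>k<N. if i = k then word_entry v k j \<omega> else 0)"
    by (rule sum.cong) auto
  then show ?case using Nil by simp
next
  case (Cons b u)
  then show ?case
    by (simp add: sum_distrib_left sum_distrib_right mult.assoc) (rule sum.swap)
qed

lemma all_moments_word_entry: "i < N \<Longrightarrow> j < N \<Longrightarrow> all_moments M (word_entry w i j)"
proof (induction w arbitrary: i)
  case Nil
  have "word_entry [] i j = (\<lambda>_. if i = j then 1 else 0)" by (rule ext) simp
  then show ?case by simp
next
  case (Cons b w)
  have eq: "word_entry (b # w) i j = (\<lambda>\<omega>. \<Sum>k<N. e b i k \<omega> * word_entry w k j \<omega>)"
    by (rule ext) simp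
  show ?case unfolding eq
    using Cons.prems
    by (intro all_moments_sum all_moments_mult all_moments_complex_span[OF entry_span] Cons.IH) auto
qed

lemma all_moments_word_trace: "all_moments M (word_trace w)"
proof -
  have eq: "word_trace w = (\<lambda>\<omega>. \<Sum>i<N. word_entry w i i \<omega>)"
    by (rule ext) (simp add: word_trace_def)
  show ?thesis unfolding eq by (intro all_moments_sum all_moments_word_entry) auto
qed

lemma all_moments_trace_prod: "all_moments M (trace_prod a us)"
proof -
  have eq: "trace_prod a us = (\<lambda>\<omega>. \<Prod>u\<leftarrow>us. word_trace u \<omega> - a u)"
    by (rule ext) (simp add: trace_prod_def)
  show ?thesis unfolding eq
    by (intro all_moments_prod_list all_moments_diff all_moments_word_trace all_moments_const)
qed

text \<open>Derivative of a word entry in the direction of the entry (i0, j0) of the letter b.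
  Removing position s leaves the indices j0 and i0 in this swapped order, because (i0, j0) is
  correlated only with (j0, i0).\<close>

definition dentry :: "bool \<Rightarrow> nat \<Rightarrow> nat \<Rightarrow> bool list \<Rightarrow> nat \<Rightarrow> nat \<Rightarrow> 'a \<Rightarrow> complex" where
  "dentry b i0 j0 w i j \<omega> = (\<Sum>s<length w. letter_cov \<gamma> b (w ! s) / of_nat N *
     (word_entry (take s w) i j0 \<omega> * word_entry (drop (Suc s) w) i0 j \<omega>))"

definition dtrace :: "bool \<Rightarrow> nat \<Rightarrow> nat \<Rightarrow> bool list \<Rightarrow> 'a \<Rightarrow> complex" where
  "dtrace b i0 j0 u \<omega> = (\<Sum>t<length u. letter_cov \<gamma> b (u ! t) / of_nat N * word_entry (cut_at t u) i0 j0 \<omega>)"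

definition dtrace_prod :: "bool \<Rightarrow> nat \<Rightarrow> nat \<Rightarrow> (bool list \<Rightarrow> complex) \<Rightarrow> bool list list \<Rightarrow> 'a \<Rightarrow> complex" where
  "dtrace_prod b i0 j0 a us \<omega> =
     (\<Sum>r<length us. dtrace b i0 j0 (us ! r) \<omega> * trace_prod a (take r us @ drop (Suc r) us) \<omega>)"

context
  fixes b :: bool and i0 j0 :: nat
  assumes i0: "i0 < N" and j0: "j0 < N"
begin

lemma dentry_Cons:
  assumes "i < N"
  shows "dentry b i0 j0 (b' # w) i j \<omega> =
    (\<Sum>k<N. (\<integral>\<omega>. e b i0 j0 \<omega> * e b' i k \<omega> \<partial>M) * word_entry w k j \<omega>) +
    (\<Sum>k<N. e b' i k \<omega> * dentry b i0 j0 w k j \<omega>)"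
proof -
  let ?c = "letter_cov \<gamma> b b' / of_nat N"
  have "(\<Sum>k<N. (\<integral>\<omega>. e b i0 j0 \<omega> * e b' i k \<omega> \<partial>M) * word_entry w k j \<omega>) =
      (\<Sum>k<N. if i0 = k then (if i = j0 then ?c * word_entry w k j \<omega> else 0) else 0)"
    using i0 j0 assms by (intro sum.cong) (auto simp: entry_cov)
  also have "\<dots> = ?c * (word_entry [] i j0 \<omega> * word_entry w i0 j \<omega>)"
    using i0 by simp
  finally have 1: "(\<Sum>k<N. (\<integral>\<omega>. e b i0 j0 \<omega> * e b' i k \<omega> \<partial>M) * word_entry w k j \<omega>) =
      ?c * (word_entry [] i j0 \<omega> * word_entry w i0 j \<omega>)" .
  have "(\<Sum>k<N. e b' i k \<omega> * dentry b i0 j0 w k j \<omega>) =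
      (\<Sum>s<length w. letter_cov \<gamma> b (w ! s) / of_nat N *
        (word_entry (b' # take s w) i j0 \<omega> * word_entry (drop (Suc s) w) i0 j \<omega>))"
    unfolding dentry_def sum_distrib_left
    by (subst sum.swap) (simp add: sum_distrib_left sum_distrib_right sum_divide_distrib mult_ac)
  then show ?thesis unfolding 1 by (simp add: dentry_def sum.lessThan_Suc_shift del: sum.lessThan_Suc)
qed

text \<open>\<open>F\<close> and \<open>G\<close> act as accumulators: each letter of the word is
  moved into \<open>F\<close> as a single generator, so that the Leibniz rule for one generator
  suffices.\<close>

lemma stein_word_entry:
  assumes "stein (e b i0 j0) F G" "i < N" "j < N"
  shows "stein (e b i0 j0) (\<lambda>\<omega>. F \<omega> * word_entry w i j \<omega>)
    (\<lambda>\<omega>. G \<omega> * word_entry w i j \<omega> + F \<omega> * dentry b i0 j0 w i j \<omega>)"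
  using assms
proof (induction w arbitrary: F G i)
  case Nil
  from stein_cmult[OF entry_span[OF i0 j0] Nil(1), of "if i = j then 1 else 0"]
  show ?case by (simp add: dentry_def mult.commute)
next
  case (Cons b' w)
  note span = entry_span[OF i0 j0]
  have "stein (e b i0 j0) (\<lambda>\<omega>. F \<omega> * e b' i k \<omega> * word_entry w k j \<omega>)
      (\<lambda>\<omega>. (G \<omega> * e b' i k \<omega> + F \<omega> * (\<integral>\<omega>. e b i0 j0 \<omega> * e b' i k \<omega> \<partial>M)) * word_entry w k j \<omega> +
         F \<omega> * e b' i k \<omega> * dentry b i0 j0 w k j \<omega>)" if "k < N" for k
    by (rule Cons.IH[OF stein_mult_generator[OF span Cons.prems(1) entry_span[OF Cons.prems(2) that]]
          that Cons.prems(3)])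
  then have "stein (e b i0 j0) (\<lambda>\<omega>. \<Sum>k<N. F \<omega> * e b' i k \<omega> * word_entry w k j \<omega>)
      (\<lambda>\<omega>. \<Sum>k<N. (G \<omega> * e b' i k \<omega> + F \<omega> * (\<integral>\<omega>. e b i0 j0 \<omega> * e b' i k \<omega> \<partial>M)) * word_entry w k j \<omega> +
         F \<omega> * e b' i k \<omega> * dentry b i0 j0 w k j \<omega>)"
    by (intro stein_sum[OF span]) auto
  moreover have "(\<Sum>k<N. F \<omega> * e b' i k \<omega> * word_entry w k j \<omega>) = F \<omega> * word_entry (b' # w) i j \<omega>" for \<omega>
    by (simp add: sum_distrib_left mult.assoc)
  moreover have "(\<Sum>k<N. (G \<omega> * e b' i k \<omega> + F \<omega> * (\<integral>\<omega>. e b i0 j0 \<omega> * e b' i k \<omega> \<partial>M)) * word_entry w k j \<omega> +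
         F \<omega> * e b' i k \<omega> * dentry b i0 j0 w k j \<omega>) =
      G \<omega> * word_entry (b' # w) i j \<omega> + F \<omega> * dentry b i0 j0 (b' # w) i j \<omega>" for \<omega>
    by (simp only: dentry_Cons[OF Cons.prems(2)] word_entry.simps distrib_left distrib_right
        sum.distrib sum_distrib_left mult.assoc add.assoc)
  ultimately show ?case by (simp only:)
qed

text \<open>Summing over the diagonal index glues the part behind the removed letter to the part
  before it, which is the cyclic cut.\<close>

lemma sum_dentry_diag: "(\<Sum>i<N. dentry b i0 j0 u i i \<omega>) = dtrace b i0 j0 u \<omega>"
proof -
  have "(\<Sum>i<N. dentry b i0 j0 u i i \<omega>) = (\<Sum>t<length u. letter_cov \<gamma> b (u ! t) / of_nat N *
      (\<Sum>i<N. word_entry (drop (Suc t) u) i0 i \<omega> * word_entry (take t u) i j0 \<omega>))"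
    unfolding dentry_def sum_distrib_left by (subst sum.swap) (simp add: mult_ac)
  also have "\<dots> = dtrace b i0 j0 u \<omega>"
    unfolding dtrace_def cut_at_def using i0 by (simp add: word_entry_append)
  finally show ?thesis .
qed

lemma stein_word_trace:
  assumes "stein (e b i0 j0) F G"
  shows "stein (e b i0 j0) (\<lambda>\<omega>. F \<omega> * (word_trace u \<omega> - a))
    (\<lambda>\<omega>. G \<omega> * (word_trace u \<omega> - a) + F \<omega> * dtrace b i0 j0 u \<omega>)"
proof -
  note span = entry_span[OF i0 j0]
  have "stein (e b i0 j0) (\<lambda>\<omega>. (\<Sum>i<N. F \<omega> * word_entry u i i \<omega>) + (- a) * F \<omega>)
    (\<lambda>\<omega>. (\<Sum>i<N. G \<omega> * word_entry u i i \<omega> + F \<omega> * dentry b i0 j0 u i i \<omega>) + (- a) * G \<omega>)"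
    by (intro stein_add[OF span] stein_sum[OF span] stein_cmult[OF span] assms stein_word_entry) auto
  moreover have "(\<Sum>i<N. F \<omega> * word_entry u i i \<omega>) + (- a) * F \<omega> = F \<omega> * (word_trace u \<omega> - a)" for \<omega>
    by (simp add: word_trace_def algebra_simps sum_distrib_left)
  moreover have "(\<Sum>i<N. G \<omega> * word_entry u i i \<omega> + F \<omega> * dentry b i0 j0 u i i \<omega>) + (- a) * G \<omega> =
      G \<omega> * (word_trace u \<omega> - a) + F \<omega> * dtrace b i0 j0 u \<omega>" for \<omega>
    unfolding sum_dentry_diag[symmetric]
    by (simp add: word_trace_def algebra_simps sum.distrib sum_distrib_left)
  ultimately show ?thesis by (simp only:)
qed

lemma stein_trace_prod:
  assumes "stein (e b i0 j0) F G"
  shows "stein (e b i0 j0) (\<lambda>\<omega>. F \<omega> * trace_prod a us \<omega>)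
    (\<lambda>\<omega>. G \<omega> * trace_prod a us \<omega> + F \<omega> * dtrace_prod b i0 j0 a us \<omega>)"
  using assms
proof (induction us arbitrary: F G)
  case Nil
  then show ?case by (simp add: trace_prod_def dtrace_prod_def)
next
  case (Cons u us)
  have dp: "dtrace_prod b i0 j0 a (u # us) \<omega> =
      dtrace b i0 j0 u \<omega> * trace_prod a us \<omega> + (word_trace u \<omega> - a u) * dtrace_prod b i0 j0 a us \<omega>" for \<omega>
    by (simp add: dtrace_prod_def trace_prod_def sum.lessThan_Suc_shift sum_distrib_left mult_ac
        del: sum.lessThan_Suc)
  have tp: "trace_prod a (u # us) \<omega> = (word_trace u \<omega> - a u) * trace_prod a us \<omega>" for \<omega>
    by (simp add: trace_prod_def)
  have d: "(G \<omega> * (word_trace u \<omega> - a u) + F \<omega> * dtrace b i0 j0 u \<omega>) * trace_prod a us \<omega> +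
      F \<omega> * (word_trace u \<omega> - a u) * dtrace_prod b i0 j0 a us \<omega> =
      G \<omega> * trace_prod a (u # us) \<omega> + F \<omega> * dtrace_prod b i0 j0 a (u # us) \<omega>" for \<omega>
    unfolding dp tp by (simp add: algebra_simps)
  have p: "F \<omega> * (word_trace u \<omega> - a u) * trace_prod a us \<omega> = F \<omega> * trace_prod a (u # us) \<omega>" for \<omega>
    by (simp add: tp)
  from Cons.IH[OF stein_word_trace[OF Cons.prems, of u "a u"]]
  show ?case unfolding d p .
qed

lemma expectation_entry_mult:
  assumes "i < N" "j < N"
  shows "(\<integral>\<omega>. e b i0 j0 \<omega> * (word_entry w i j \<omega> * trace_prod a us \<omega>) \<partial>M) =
    (\<integral>\<omega>. dentry b i0 j0 w i j \<omega> * trace_prod a us \<omega> + word_entry w i j \<omega> * dtrace_prod b i0 j0 a us \<omega> \<partial>M)"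
  using stein_expectation[OF stein_trace_prod[OF
        stein_word_entry[OF stein_const[OF entry_span[OF i0 j0], where c = 1] assms]]]
  by simp

end

lemma all_moments_dentry:
  "i0 < N \<Longrightarrow> j0 < N \<Longrightarrow> i < N \<Longrightarrow> j < N \<Longrightarrow> all_moments M (dentry b i0 j0 w i j)"
  unfolding dentry_def[abs_def]
  by (intro all_moments_sum all_moments_cmult all_moments_mult all_moments_word_entry) auto

lemma all_moments_dtrace_prod:
  "i0 < N \<Longrightarrow> j0 < N \<Longrightarrow> all_moments M (dtrace_prod b i0 j0 a us)"
  unfolding dtrace_prod_def[abs_def] dtrace_def[abs_def]
  by (intro all_moments_sum all_moments_cmult all_moments_mult all_moments_word_entry
      all_moments_trace_prod) auto

text \<open>Schwinger-Dyson equation: Gaussian integration by parts against the letter \<open>b\<close>.\<close>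

lemma loop_equation:
  "(\<integral>\<omega>. word_trace (b # w) \<omega> * trace_prod a us \<omega> \<partial>M) =
    (\<Sum>s<length w. letter_cov \<gamma> b (w ! s) / of_nat N *
      (\<integral>\<omega>. word_trace (take s w) \<omega> * word_trace (drop (Suc s) w) \<omega> * trace_prod a us \<omega> \<partial>M)) +
    (\<Sum>r<length us. \<Sum>t<length (us ! r). letter_cov \<gamma> b (us ! r ! t) / of_nat N *
      (\<integral>\<omega>. word_trace (w @ cut_at t (us ! r)) \<omega> * trace_prod a (take r us @ drop (Suc r) us) \<omega> \<partial>M))"
proof -
  note mm = all_moments_mult all_moments_word_trace all_moments_trace_prod all_moments_cmult
  have "(\<integral>\<omega>. word_trace (b # w) \<omega> * trace_prod a us \<omega> \<partial>M) =
      (\<integral>\<omega>. (\<Sum>i<N. \<Sum>k<N. e b i k \<omega> * (word_entry w k i \<omega> * trace_prod a us \<omega>)) \<partial>M)"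
    by (simp add: word_trace_def sum_distrib_right mult.assoc)
  also have "\<dots> = (\<Sum>i<N. \<Sum>k<N. \<integral>\<omega>. e b i k \<omega> * (word_entry w k i \<omega> * trace_prod a us \<omega>) \<partial>M)"
  proof -
    have i: "integrable M (\<lambda>\<omega>. e b i k \<omega> * (word_entry w k i \<omega> * trace_prod a us \<omega>))"
      if "i < N" "k < N" for i k
      using that by (intro all_moments_integrable all_moments_mult all_moments_word_entry
          all_moments_trace_prod all_moments_complex_span[OF entry_span])
    show ?thesis by (rule integral_sum2) (auto intro: i)
  qed
  also have "\<dots> = (\<Sum>i<N. \<Sum>k<N. \<integral>\<omega>. dentry b i k w k i \<omega> * trace_prod a us \<omega> +
      word_entry w k i \<omega> * dtrace_prod b i k a us \<omega> \<partial>M)"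
    by (intro sum.cong refl expectation_entry_mult) auto
  \<comment> \<open>The index sums return under the integral so that they can be contracted
    pointwise.\<close>
  also have "\<dots> = (\<integral>\<omega>. (\<Sum>i<N. \<Sum>k<N. dentry b i k w k i \<omega> * trace_prod a us \<omega> +
      word_entry w k i \<omega> * dtrace_prod b i k a us \<omega>) \<partial>M)"
  proof -
    have i: "integrable M (\<lambda>\<omega>. dentry b i k w k i \<omega> * trace_prod a us \<omega> +
      word_entry w k i \<omega> * dtrace_prod b i k a us \<omega>)"
      if "i < N" "k < N" for i k
      using that by (intro all_moments_integrable all_moments_add all_moments_mult
          all_moments_word_entry all_moments_trace_prod all_moments_dentry all_moments_dtrace_prod)
    show ?thesis by (rule integral_sum2[symmetric]) (rule i; simp)
  qed
  also have "(\<lambda>\<omega>. \<Sum>i<N. \<Sum>k<N. dentry b i k w k i \<omega> * trace_prod a us \<omega> +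
      word_entry w k i \<omega> * dtrace_prod b i k a us \<omega>) =
    (\<lambda>\<omega>. (\<Sum>s<length w. letter_cov \<gamma> b (w ! s) / of_nat N *
      (word_trace (take s w) \<omega> * word_trace (drop (Suc s) w) \<omega> * trace_prod a us \<omega>)) +
    (\<Sum>r<length us. \<Sum>t<length (us ! r). letter_cov \<gamma> b (us ! r ! t) / of_nat N *
      (word_trace (w @ cut_at t (us ! r)) \<omega> * trace_prod a (take r us @ drop (Suc r) us) \<omega>)))"
  proof (rule ext)
    fix \<omega>
    \<comment> \<open>Here the removed letter has indices (i, k) and the word entry (k, i), so the
      indices separate and the trace splits into two traces.\<close>
    have "(\<Sum>i<N. \<Sum>k<N. dentry b i k w k i \<omega>) =
        (\<Sum>i<N. \<Sum>s<length w. \<Sum>k<N. letter_cov \<gamma> b (w ! s) / of_nat N *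
          (word_entry (take s w) k k \<omega> * word_entry (drop (Suc s) w) i i \<omega>))"
      unfolding dentry_def by (intro sum.cong refl sum.swap)
    also have "\<dots> = (\<Sum>s<length w. \<Sum>i<N. \<Sum>k<N. letter_cov \<gamma> b (w ! s) / of_nat N *
          (word_entry (take s w) k k \<omega> * word_entry (drop (Suc s) w) i i \<omega>))"
      by (rule sum.swap)
    also have "\<dots> = (\<Sum>s<length w. letter_cov \<gamma> b (w ! s) / of_nat N *
      (word_trace (take s w) \<omega> * word_trace (drop (Suc s) w) \<omega>))"
      unfolding word_trace_def sum_product
      by (subst (2) sum.swap) (simp only: sum_distrib_left)
    finally have 1: "(\<Sum>i<N. \<Sum>k<N. dentry b i k w k i \<omega>) =
      (\<Sum>s<length w. letter_cov \<gamma> b (w ! s) / of_nat N *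
        (word_trace (take s w) \<omega> * word_trace (drop (Suc s) w) \<omega>))" .
    \<comment> \<open>The opposite effect: a letter of another trace is removed, and the shared
      indices merge two traces into one.\<close>
    have tr: "(\<Sum>i<N. \<Sum>k<N. word_entry w k i \<omega> * word_entry u i k \<omega>) = word_trace (w @ u) \<omega>" for u
      unfolding word_trace_def by (subst sum.swap) (simp add: word_entry_append)
    have 2: "(\<Sum>i<N. \<Sum>k<N. word_entry w k i \<omega> * dtrace b i k u \<omega>) =
        (\<Sum>t<length u. letter_cov \<gamma> b (u ! t) / of_nat N * word_trace (w @ cut_at t u) \<omega>)" for u
    proof -
      have "(\<Sum>i<N. \<Sum>k<N. word_entry w k i \<omega> * dtrace b i k u \<omega>) =
        (\<Sum>i<N. \<Sum>t<length u. \<Sum>k<N. letter_cov \<gamma> b (u ! t) / of_nat N *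
          (word_entry w k i \<omega> * word_entry (cut_at t u) i k \<omega>))"
        unfolding dtrace_def sum_distrib_left
        by (subst sum.swap) (simp add: mult_ac)
      also have "\<dots> = (\<Sum>t<length u. \<Sum>i<N. \<Sum>k<N. letter_cov \<gamma> b (u ! t) / of_nat N *
          (word_entry w k i \<omega> * word_entry (cut_at t u) i k \<omega>))"
        by (rule sum.swap)
      finally show ?thesis by (simp only: tr flip: sum_distrib_left)
    qed
    have "(\<Sum>i<N. \<Sum>k<N. word_entry w k i \<omega> * dtrace_prod b i k a us \<omega>) =
       (\<Sum>i<N. \<Sum>r<length us. \<Sum>k<N. (word_entry w k i \<omega> * dtrace b i k (us ! r) \<omega>) *
          trace_prod a (take r us @ drop (Suc r) us) \<omega>)"
      unfolding dtrace_prod_def sum_distrib_left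
      by (subst sum.swap) (simp add: mult.assoc)
    also have "\<dots> = (\<Sum>r<length us. \<Sum>i<N. \<Sum>k<N. (word_entry w k i \<omega> * dtrace b i k (us ! r) \<omega>) *
          trace_prod a (take r us @ drop (Suc r) us) \<omega>)"
      by (rule sum.swap)
    also have "\<dots> = (\<Sum>r<length us. (\<Sum>i<N. \<Sum>k<N. word_entry w k i \<omega> * dtrace b i k (us ! r) \<omega>) *
          trace_prod a (take r us @ drop (Suc r) us) \<omega>)"
      by (simp only: sum_distrib_right)
    also have "\<dots> = (\<Sum>r<length us. \<Sum>t<length (us ! r). letter_cov \<gamma> b (us ! r ! t) / of_nat N *
      (word_trace (w @ cut_at t (us ! r)) \<omega> * trace_prod a (take r us @ drop (Suc r) us) \<omega>))"
      unfolding 2 sum_distrib_right by (simp only: mult.assoc)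
    finally have 3: "(\<Sum>i<N. \<Sum>k<N. word_entry w k i \<omega> * dtrace_prod b i k a us \<omega>) =
      (\<Sum>r<length us. \<Sum>t<length (us ! r). letter_cov \<gamma> b (us ! r ! t) / of_nat N *
      (word_trace (w @ cut_at t (us ! r)) \<omega> * trace_prod a (take r us @ drop (Suc r) us) \<omega>))" .
    have "(\<Sum>i<N. \<Sum>k<N. dentry b i k w k i \<omega> * trace_prod a us \<omega> +
      word_entry w k i \<omega> * dtrace_prod b i k a us \<omega>) =
      (\<Sum>i<N. \<Sum>k<N. dentry b i k w k i \<omega>) * trace_prod a us \<omega> +
      (\<Sum>i<N. \<Sum>k<N. word_entry w k i \<omega> * dtrace_prod b i k a us \<omega>)"
      by (simp only: sum.distrib sum_distrib_right)
    also have "\<dots> = (\<Sum>s<length w. letter_cov \<gamma> b (w ! s) / of_nat N *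
      (word_trace (take s w) \<omega> * word_trace (drop (Suc s) w) \<omega> * trace_prod a us \<omega>)) +
    (\<Sum>r<length us. \<Sum>t<length (us ! r). letter_cov \<gamma> b (us ! r ! t) / of_nat N *
      (word_trace (w @ cut_at t (us ! r)) \<omega> * trace_prod a (take r us @ drop (Suc r) us) \<omega>))"
      unfolding 1 3 sum_distrib_right by (simp only: mult.assoc)
    finally show "(\<Sum>i<N. \<Sum>k<N. dentry b i k w k i \<omega> * trace_prod a us \<omega> +
      word_entry w k i \<omega> * dtrace_prod b i k a us \<omega>) = \<dots>" .
  qed
  also have "(\<integral>\<omega>. (\<Sum>s<length w. letter_cov \<gamma> b (w ! s) / of_nat N *
      (word_trace (take s w) \<omega> * word_trace (drop (Suc s) w) \<omega> * trace_prod a us \<omega>)) +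
    (\<Sum>r<length us. \<Sum>t<length (us ! r). letter_cov \<gamma> b (us ! r ! t) / of_nat N *
      (word_trace (w @ cut_at t (us ! r)) \<omega> * trace_prod a (take r us @ drop (Suc r) us) \<omega>)) \<partial>M) =
    (\<integral>\<omega>. (\<Sum>s<length w. letter_cov \<gamma> b (w ! s) / of_nat N *
      (word_trace (take s w) \<omega> * word_trace (drop (Suc s) w) \<omega> * trace_prod a us \<omega>)) \<partial>M) +
    (\<integral>\<omega>. (\<Sum>r<length us. \<Sum>t<length (us ! r). letter_cov \<gamma> b (us ! r ! t) / of_nat N *
      (word_trace (w @ cut_at t (us ! r)) \<omega> * trace_prod a (take r us @ drop (Suc r) us) \<omega>)) \<partial>M)"
    by (intro Bochner_Integration.integral_add all_moments_integrable all_moments_sum mm)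
  also have "(\<integral>\<omega>. (\<Sum>s<length w. letter_cov \<gamma> b (w ! s) / of_nat N *
      (word_trace (take s w) \<omega> * word_trace (drop (Suc s) w) \<omega> * trace_prod a us \<omega>)) \<partial>M) =
    (\<Sum>s<length w. letter_cov \<gamma> b (w ! s) / of_nat N *
      (\<integral>\<omega>. word_trace (take s w) \<omega> * word_trace (drop (Suc s) w) \<omega> * trace_prod a us \<omega> \<partial>M))"
    by (subst Bochner_Integration.integral_sum)
      (intro all_moments_integrable mm, simp only: integral_mult_right_zero)
  also have "(\<integral>\<omega>. (\<Sum>r<length us. \<Sum>t<length (us ! r). letter_cov \<gamma> b (us ! r ! t) / of_nat N *
      (word_trace (w @ cut_at t (us ! r)) \<omega> * trace_prod a (take r us @ drop (Suc r) us) \<omega>)) \<partial>M) =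
    (\<Sum>r<length us. \<Sum>t<length (us ! r). letter_cov \<gamma> b (us ! r ! t) / of_nat N *
      (\<integral>\<omega>. word_trace (w @ cut_at t (us ! r)) \<omega> * trace_prod a (take r us @ drop (Suc r) us) \<omega> \<partial>M))"
  proof -
    have i: "integrable M (\<lambda>\<omega>. letter_cov \<gamma> b (us ! r ! t) / of_nat N *
      (word_trace (w @ cut_at t (us ! r)) \<omega> * trace_prod a (take r us @ drop (Suc r) us) \<omega>))" for r t
      by (intro all_moments_integrable mm)
    show ?thesis by (subst integral_sum2[OF i]) (simp only: integral_mult_right_zero)
  qed
  finally show ?thesis .
qed

end

section \<open>Large size limit\<close>

context elliptic_ensemble
begin

definition mean :: "bool list \<Rightarrow> complex" where
  "mean w = (\<integral>\<omega>. word_trace w \<omega> \<partial>M)"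

definition cmom :: "bool list list \<Rightarrow> complex" where
  "cmom us = (\<integral>\<omega>. trace_prod mean us \<omega> \<partial>M)"

lemma word_trace_Nil: "word_trace [] \<omega> = of_nat N"
  by (simp add: word_trace_def)

lemma mean_Nil: "mean [] = of_nat N"
  by (simp add: mean_def word_trace_Nil prob_space)

lemma cmom_Nil: "cmom [] = 1"
  by (simp add: cmom_def trace_prod_def prob_space)

lemma cmom_Nil_Cons: "cmom ([] # us) = 0"
  by (simp add: cmom_def trace_prod_def word_trace_Nil mean_Nil)

lemma trace_prod_Cons: "trace_prod a (u # us) \<omega> = (word_trace u \<omega> - a u) * trace_prod a us \<omega>"
  by (simp add: trace_prod_def)

lemma expectation_trace_mult:
  "(\<integral>\<omega>. word_trace u \<omega> * trace_prod mean us \<omega> \<partial>M) = cmom (u # us) + mean u * cmom us"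
proof -
  have "(\<integral>\<omega>. word_trace u \<omega> * trace_prod mean us \<omega> \<partial>M) =
      (\<integral>\<omega>. trace_prod mean (u # us) \<omega> + mean u * trace_prod mean us \<omega> \<partial>M)"
    by (simp add: trace_prod_Cons algebra_simps)
  also have "\<dots> = (\<integral>\<omega>. trace_prod mean (u # us) \<omega> \<partial>M) + (\<integral>\<omega>. mean u * trace_prod mean us \<omega> \<partial>M)"
    by (intro Bochner_Integration.integral_add all_moments_integrable all_moments_cmult
        all_moments_trace_prod)
  finally show ?thesis by (simp only: cmom_def integral_mult_right_zero)
qed

lemma cmom_single: "cmom [u] = 0"
  using expectation_trace_mult[of u "[]"] by (simp add: cmom_Nil) (simp add: trace_prod_def mean_def)

lemma expectation_trace_mult_mult:
  "(\<integral>\<omega>. word_trace u \<omega> * word_trace v \<omega> * trace_prod mean us \<omega> \<partial>M) =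
    cmom (u # v # us) + mean u * cmom (v # us) + mean v * cmom (u # us) + mean u * mean v * cmom us"
proof -
  have "(\<integral>\<omega>. word_trace u \<omega> * word_trace v \<omega> * trace_prod mean us \<omega> \<partial>M) =
      (\<integral>\<omega>. word_trace u \<omega> * trace_prod mean (v # us) \<omega> +
        mean v * (word_trace u \<omega> * trace_prod mean us \<omega>) \<partial>M)"
    by (simp add: trace_prod_Cons algebra_simps)
  also have "\<dots> = (\<integral>\<omega>. word_trace u \<omega> * trace_prod mean (v # us) \<omega> \<partial>M) +
      (\<integral>\<omega>. mean v * (word_trace u \<omega> * trace_prod mean us \<omega>) \<partial>M)"
    by (intro Bochner_Integration.integral_add all_moments_integrable all_moments_cmult
        all_moments_mult all_moments_word_trace all_moments_trace_prod)
  finally show ?thesis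
    by (simp only: integral_mult_right_zero expectation_trace_mult) (simp add: algebra_simps)
qed

lemma mean_Cons:
  "mean (b # w) = (\<Sum>s<length w. letter_cov \<gamma> b (w ! s) / of_nat N *
     (cmom [take s w, drop (Suc s) w] + mean (take s w) * mean (drop (Suc s) w)))"
  using loop_equation[of b w mean "[]"]
  by (simp add: expectation_trace_mult expectation_trace_mult_mult cmom_single cmom_Nil)

text \<open>Centring the first trace subtracts the equation for its mean. The product of two means
  over N, of order N, cancels, and only a covariance over N is left in its place.\<close>

lemma cmom_Cons:
  "cmom ((b # w) # us) =
    (\<Sum>s<length w. letter_cov \<gamma> b (w ! s) / of_nat N *
      (cmom (take s w # drop (Suc s) w # us) +
       mean (take s w) * cmom (drop (Suc s) w # us) + mean (drop (Suc s) w) * cmom (take s w # us) -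
       cmom [take s w, drop (Suc s) w] * cmom us)) +
    (\<Sum>r<length us. \<Sum>t<length (us ! r). letter_cov \<gamma> b (us ! r ! t) / of_nat N *
      (cmom ((w @ cut_at t (us ! r)) # take r us @ drop (Suc r) us) +
       mean (w @ cut_at t (us ! r)) * cmom (take r us @ drop (Suc r) us)))"
proof -
  let ?S = "\<Sum>s<length w. letter_cov \<gamma> b (w ! s) / of_nat N *
      (cmom (take s w # drop (Suc s) w # us) +
       mean (take s w) * cmom (drop (Suc s) w # us) + mean (drop (Suc s) w) * cmom (take s w # us) +
       mean (take s w) * mean (drop (Suc s) w) * cmom us)"
  have "?S - mean (b # w) * cmom us =
    (\<Sum>s<length w. letter_cov \<gamma> b (w ! s) / of_nat N *
      (cmom (take s w # drop (Suc s) w # us) +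
       mean (take s w) * cmom (drop (Suc s) w # us) + mean (drop (Suc s) w) * cmom (take s w # us) -
       cmom [take s w, drop (Suc s) w] * cmom us))"
    unfolding mean_Cons sum_distrib_right sum_subtractf[symmetric]
    by (rule sum.cong) (simp_all add: algebra_simps)
  then show ?thesis
    using loop_equation[of b w mean us]
    unfolding expectation_trace_mult expectation_trace_mult_mult
    by (simp add: algebra_simps)
qed

end

text \<open>The sequences are indexed so that the \<open>n\<close>-th term belongs to matrices of size \<open>n + 1\<close>.\<close>

locale loop_asymptotics =
  fixes c :: "'l \<Rightarrow> 'l \<Rightarrow> complex"
    and mean :: "nat \<Rightarrow> 'l list \<Rightarrow> complex"
    and cmom :: "nat \<Rightarrow> 'l list list \<Rightarrow> complex"
  assumes mean_Nil: "mean n [] = of_nat (Suc n)"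
    and cmom_Nil: "cmom n [] = 1"
    and cmom_Nil_Cons: "cmom n ([] # us) = 0"
    and mean_Cons: "mean n (b # w) = (\<Sum>s<length w. c b (w ! s) / of_nat (Suc n) *
     (cmom n [take s w, drop (Suc s) w] + mean n (take s w) * mean n (drop (Suc s) w)))"
    and cmom_Cons: "cmom n ((b # w) # us) =
    (\<Sum>s<length w. c b (w ! s) / of_nat (Suc n) *
      (cmom n (take s w # drop (Suc s) w # us) +
       mean n (take s w) * cmom n (drop (Suc s) w # us) +
       mean n (drop (Suc s) w) * cmom n (take s w # us) -
       cmom n [take s w, drop (Suc s) w] * cmom n us)) +
    (\<Sum>r<length us. \<Sum>t<length (us ! r). c b (us ! r ! t) / of_nat (Suc n) *
      (cmom n ((w @ cut_at t (us ! r)) # take r us @ drop (Suc r) us) +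
       mean n (w @ cut_at t (us ! r)) * cmom n (take r us @ drop (Suc r) us)))"
begin

definition nmean :: "nat \<Rightarrow> 'l list \<Rightarrow> complex" where
  "nmean n w = mean n w / of_nat (Suc n)"

definition eps :: "nat \<Rightarrow> complex" where
  "eps n = 1 / of_nat (Suc n)"

lemma eps_lim: "eps \<longlonglongrightarrow> 0"
  unfolding eps_def by (rule LIMSEQ_Suc[OF lim_1_over_n])

lemma nmean_Nil: "nmean n [] = 1"
  by (simp add: nmean_def mean_Nil del: of_nat_Suc)

lemma nmean_Cons: "nmean n (b # w) = (\<Sum>s<length w. c b (w ! s) *
     (eps n * eps n * cmom n [take s w, drop (Suc s) w] + nmean n (take s w) * nmean n (drop (Suc s) w)))"
  unfolding nmean_def mean_Cons sum_divide_distrib eps_def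
  by (rule sum.cong) (simp_all add: field_simps del: of_nat_Suc)

text \<open>Every factor 1/N is either absorbed by a mean or displayed as \<open>eps\<close>, so the
  terms that disappear in the limit can be read off.\<close>

lemma cmom_Cons': "cmom n ((b # w) # us) =
    (\<Sum>s<length w. c b (w ! s) *
      (eps n * cmom n (take s w # drop (Suc s) w # us) +
       nmean n (take s w) * cmom n (drop (Suc s) w # us) +
       nmean n (drop (Suc s) w) * cmom n (take s w # us) -
       eps n * cmom n [take s w, drop (Suc s) w] * cmom n us)) +
    (\<Sum>r<length us. \<Sum>t<length (us ! r). c b (us ! r ! t) *
      (eps n * cmom n ((w @ cut_at t (us ! r)) # take r us @ drop (Suc r) us) +
       nmean n (w @ cut_at t (us ! r)) * cmom n (take r us @ drop (Suc r) us)))"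
  unfolding cmom_Cons nmean_def eps_def
  by (intro arg_cong2[where f = "(+)"] sum.cong refl) (simp_all add: field_simps del: of_nat_Suc)

lemma convergent_aux:
  "(\<forall>w. length w = n \<longrightarrow> convergent (\<lambda>n. nmean n w)) \<and>
   (\<forall>us. sum_list (map length us) = n \<longrightarrow> convergent (\<lambda>n. cmom n us))"
proof (induction n rule: less_induct)
  case (less n)
  have IHm: "convergent (\<lambda>n. nmean n w)" if "length w < n" for w
    using less.IH that by blast
  have IHc: "convergent (\<lambda>n. cmom n us)" if "sum_list (map length us) < n" for us
    using less.IH that by blast
  have eps: "convergent eps" using eps_lim by (auto simp: convergent_def)
  note conv = convergent_add convergent_mult convergent_sum convergent_diff convergent_const eps
  show ?case
  proof (intro conjI allI impI)
    fix w :: "'l list" assume n: "length w = n"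
    show "convergent (\<lambda>n. nmean n w)"
    proof (cases w)
      case Nil
      then show ?thesis by (simp add: nmean_Nil convergent_const)
    next
      case (Cons b w')
      show ?thesis unfolding Cons nmean_Cons
        using n Cons by (intro conv IHm IHc) auto
    qed
  next
    fix us :: "'l list list" assume n: "sum_list (map length us) = n"
    consider "us = []" | us' where "us = [] # us'" | b w us' where "us = (b # w) # us'"
      by (metis list.exhaust)
    then show "convergent (\<lambda>n. cmom n us)"
    proof cases
      case 1
      then show ?thesis by (simp add: cmom_Nil convergent_const)
    next
      case 2
      then show ?thesis by (simp add: cmom_Nil_Cons convergent_const)
    next
      case 3
      \<comment> \<open>Merging \<open>b # w\<close> with the r-th word removes exactly the two
        paired letters from the total.\<close>
      have tot: "sum_list (map length us') = length (us' ! r) +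
          (sum_list (map length (take r us')) + sum_list (map length (drop (Suc r) us')))"
        if "r < length us'" for r
        using arg_cong[OF id_take_nth_drop[OF that], of "\<lambda>us. sum_list (map length us)"] by simp
      show ?thesis unfolding 3 cmom_Cons'
      proof (intro conv IHm IHc)
        fix r t assume rt: "r \<in> {..<length us'}" "t \<in> {..<length (us' ! r)}"
        have "0 < length (us' ! r)" using rt by auto
        then show "sum_list (map length ((w @ cut_at t (us' ! r)) # take r us' @ drop (Suc r) us')) < n"
          "length (w @ cut_at t (us' ! r)) < n"
          "sum_list (map length (take r us' @ drop (Suc r) us')) < n"
          using n rt tot[of r] unfolding 3 by simp_all
      qed (use n in \<open>auto simp: 3\<close>)
    qed
  qed
qed

definition lim_mean :: "'l list \<Rightarrow> complex" where
  "lim_mean w = lim (\<lambda>n. nmean n w)"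

definition lim_cov :: "'l list \<Rightarrow> 'l list \<Rightarrow> complex" where
  "lim_cov u v = lim (\<lambda>n. cmom n [u, v])"

lemma nmean_tendsto: "(\<lambda>n. nmean n w) \<longlonglongrightarrow> lim_mean w"
  using convergent_aux by (simp add: lim_mean_def convergent_LIMSEQ_iff)

lemma cmom_tendsto: "(\<lambda>n. cmom n us) \<longlonglongrightarrow> lim (\<lambda>n. cmom n us)"
  using convergent_aux by (simp add: convergent_LIMSEQ_iff)

lemma cov_tendsto: "(\<lambda>n. cmom n [u, v]) \<longlonglongrightarrow> lim_cov u v"
  unfolding lim_cov_def by (rule cmom_tendsto)

text \<open>Products of three centred traces and products of covariances carry a factor
  \<open>eps\<close> and drop out; for the list \<open>[v]\<close> the remaining product of the
  merging term is empty, with value 1.\<close>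

sublocale loop_limits c lim_mean lim_cov
proof
  show "lim_mean [] = 1" by (simp add: lim_mean_def nmean_Nil)
  show "lim_cov [] v = 0" for v by (simp add: lim_cov_def cmom_Nil_Cons)
  show "lim_mean (b # w) = (\<Sum>s<length w. c b (w ! s) * (lim_mean (take s w) * lim_mean (drop (Suc s) w)))" for b w
  proof -
    have "(\<lambda>n. nmean n (b # w)) \<longlonglongrightarrow> (\<Sum>s<length w. c b (w ! s) *
       (0 * 0 * lim (\<lambda>n. cmom n [take s w, drop (Suc s) w]) + lim_mean (take s w) * lim_mean (drop (Suc s) w)))"
      unfolding nmean_Cons
      by (intro tendsto_intros eps_lim nmean_tendsto cmom_tendsto)
    from LIMSEQ_unique[OF nmean_tendsto this] show ?thesis by simp
  qed
  show "lim_cov (b # w) v =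
      (\<Sum>s<length w. c b (w ! s) * (lim_mean (take s w) * lim_cov (drop (Suc s) w) v +
         lim_cov (take s w) v * lim_mean (drop (Suc s) w))) +
      (\<Sum>t<length v. c b (v ! t) * lim_mean (w @ cut_at t v))" for b w v
  proof -
    have "(\<lambda>n. cmom n [b # w, v]) \<longlonglongrightarrow>
      (\<Sum>s<length w. c b (w ! s) *
        (0 * lim (\<lambda>n. cmom n (take s w # drop (Suc s) w # [v])) +
         lim_mean (take s w) * lim_cov (drop (Suc s) w) v +
         lim_mean (drop (Suc s) w) * lim_cov (take s w) v -
         0 * lim (\<lambda>n. cmom n [take s w, drop (Suc s) w]) * lim (\<lambda>n. cmom n [v]))) +
      (\<Sum>r<length [v]. \<Sum>t<length ([v] ! r). c b ([v] ! r ! t) *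
        (0 * lim (\<lambda>n. cmom n ((w @ cut_at t ([v] ! r)) # take r [v] @ drop (Suc r) [v])) +
         lim_mean (w @ cut_at t ([v] ! r)) * lim (\<lambda>n. cmom n (take r [v] @ drop (Suc r) [v]))))"
      unfolding cmom_Cons' by (intro tendsto_intros eps_lim nmean_tendsto cmom_tendsto cov_tendsto)
    from LIMSEQ_unique[OF cov_tendsto this] show ?thesis
      by (simp add: cmom_Nil algebra_simps)
  qed
qed

end

section \<open>Elliptic matrices\<close>

lemma distributed_cong_AE:
  assumes "distributed M N X f" "AE \<omega> in M. X \<omega> = Y \<omega>" "Y \<in> measurable M N"
  shows "distributed M N Y f"
  using assms distr_cong_AE[of M M N N X Y] by (simp add: distributed_def)

section \<open>Real Gaussian variables, degenerate laws included\<close>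

context prob_space
begin

lemma all_moments_normal:
  assumes "0 < \<sigma>" "distributed M lborel Y (normal_density \<mu> \<sigma>)"
  shows "all_moments M Y"
proof -
  have [measurable]: "Y \<in> borel_measurable M"
    using distributed_measurable[OF assms(2)] by simp
  have "integrable M (\<lambda>\<omega>. \<bar>Y \<omega> - \<mu>\<bar> ^ n)" for n
    using distributed_integrable[OF assms(2), of "\<lambda>x. \<bar>x - \<mu>\<bar> ^ n"]
      integrable_normal_moment_abs[OF assms(1), of \<mu> n]
    by simp
  then have "all_moments M (\<lambda>\<omega>. Y \<omega> - \<mu>)"
    by (simp add: all_moments_def)
  then have "all_moments M (\<lambda>\<omega>. (Y \<omega> - \<mu>) + \<mu>)"
    by (intro all_moments_add all_moments_const)
  then show ?thesis by simp
qed

lemma all_moments_AE_const: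
  fixes Y :: "'a \<Rightarrow> real"
  assumes "Y \<in> borel_measurable M" "AE \<omega> in M. Y \<omega> = c"
  shows "all_moments M Y"
  unfolding all_moments_def
proof (intro conjI allI)
  fix n
  have "integrable M (\<lambda>\<omega>. norm (Y \<omega>) ^ n) \<longleftrightarrow> integrable M (\<lambda>\<omega>. norm c ^ n)"
    using assms by (intro integrable_cong_AE) auto
  then show "integrable M (\<lambda>\<omega>. norm (Y \<omega>) ^ n)" by simp
qed fact

lemma all_moments_gaussian_rv: "gaussian_rv M Y \<Longrightarrow> all_moments M Y"
  using all_moments_normal all_moments_AE_const by (auto simp: gaussian_rv_def)

text \<open>For a normal law the odd moments vanish and consecutive even moments have ratio (2 k +
  1) \<sigma>^2; in the degenerate case the vanishing mean forces the constant to be 0.\<close>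

lemma gaussian_rv_moment_rec:
  assumes "gaussian_rv M Y" and mean: "(\<integral>\<omega>. Y \<omega> \<partial>M) = 0"
  shows "(\<integral>\<omega>. Y \<omega> ^ Suc n \<partial>M) = real n * (\<integral>\<omega>. Y \<omega> ^ 2 \<partial>M) * (\<integral>\<omega>. Y \<omega> ^ (n - 1) \<partial>M)"
proof -
  have Y [measurable]: "Y \<in> borel_measurable M" using assms by (simp add: gaussian_rv_def)
  consider \<mu> \<sigma> where "0 < \<sigma>" "distributed M lborel Y (normal_density \<mu> \<sigma>)"
    | \<mu> where "AE \<omega> in M. Y \<omega> = \<mu>"
    using assms(1) by (auto simp: gaussian_rv_def)
  then show ?thesis
  proof cases
    case 1
    have "\<mu> = 0" using normal_distributed_expectation[OF 1] mean by simp
    have E: "(\<integral>\<omega>. Y \<omega> ^ k \<partial>M) = (\<integral>x. normal_density 0 \<sigma> x * x ^ k \<partial>lborel)" for k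
      using distributed_integral[OF 1(2), of "\<lambda>x. x ^ k"] \<open>\<mu> = 0\<close> by simp
    have even: "(\<integral>\<omega>. Y \<omega> ^ (2 * k) \<partial>M) = fact (2 * k) / ((2 / \<sigma>\<^sup>2) ^ k * fact k)" for k
      using integral_normal_moment_even[OF 1(1), of 0 k] by (simp add: E)
    have odd: "(\<integral>\<omega>. Y \<omega> ^ (2 * k + 1) \<partial>M) = 0" for k
      using integral_normal_moment_odd[OF 1(1), of 0 k] by (simp only: E diff_0_right)
    have var: "(\<integral>\<omega>. Y \<omega> ^ 2 \<partial>M) = \<sigma>\<^sup>2"
      using even[of 1] 1(1) by simp
    show ?thesis
    proof (cases "even n")
      case True
      then obtain k where n: "n = 2 * k" by (elim evenE)
      show ?thesis
      proof (cases k)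
        case 0
        then show ?thesis using n mean by simp
      next
        case (Suc j)
        then have "n - 1 = 2 * j + 1" "Suc n = 2 * k + 1" using n by simp_all
        then show ?thesis using odd[of j] odd[of k] by (simp only: mult_zero_right)
      qed
    next
      case False
      then obtain k where n: "n = 2 * k + 1" by (elim oddE)
      then have *: "Suc n = 2 * Suc k" "n - 1 = 2 * k" by simp_all
      define A where "A = (2 / \<sigma>\<^sup>2) ^ k * fact k"
      have "A > 0" using 1(1) by (simp add: A_def)
      have "(2 / \<sigma>\<^sup>2) ^ Suc k * fact (Suc k) = A * (2 * (real k + 1) / \<sigma>\<^sup>2)"
        by (simp add: A_def algebra_simps)
      moreover have "fact (2 * Suc k) = 2 * (real k + 1) * (2 * real k + 1) * fact (2 * k)"
        by (simp add: algebra_simps)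
      ultimately have "fact (2 * Suc k) / ((2 / \<sigma>\<^sup>2) ^ Suc k * fact (Suc k)) =
          2 * (real k + 1) * (2 * real k + 1) * fact (2 * k) / (A * (2 * (real k + 1) / \<sigma>\<^sup>2))"
        by (simp only:)
      also have "\<dots> = (2 * real k + 1) * \<sigma>\<^sup>2 * (fact (2 * k) / A)"
      proof -
        have "2 * x * y * F / (A * (2 * x / S)) = y * S * (F / A)" if "x > 0" "S > 0" for x y F S :: real
          using that \<open>A > 0\<close> by (simp add: field_simps)
        from this[of "real k + 1" "\<sigma>\<^sup>2"] show ?thesis using 1(1) by simp
      qed
      finally show ?thesis unfolding * even var A_def by (simp add: n)
    qed
  next
    case 2
    have "(\<integral>\<omega>. Y \<omega> \<partial>M) = (\<integral>\<omega>. \<mu> \<partial>M)"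
      using 2 by (intro integral_cong_AE) auto
    then have "\<mu> = 0" using mean by (simp add: prob_space)
    have "(\<integral>\<omega>. Y \<omega> ^ Suc k \<partial>M) = (\<integral>\<omega>. 0 \<partial>M)" for k
      using 2 \<open>\<mu> = 0\<close> by (intro integral_cong_AE) auto
    from this[of n] this[of 1] show ?thesis by (simp add: numeral_2_eq_2)
  qed
qed

lemma gaussian_rv_add_indep:
  assumes "indep_var borel X borel Y" "gaussian_rv M X" "gaussian_rv M Y"
  shows "gaussian_rv M (\<lambda>\<omega>. X \<omega> + Y \<omega>)"
proof -
  have [measurable]: "X \<in> borel_measurable M" "Y \<in> borel_measurable M"
    using assms by (auto simp: gaussian_rv_def)
  \<comment> \<open>A constant summand has no density, so the convolution theorem for normal laws
    does not apply; it acts as a shift instead.\<close>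
  have shift: "gaussian_rv M (\<lambda>\<omega>. U \<omega> + V \<omega>)"
    if U: "gaussian_rv M U" and V: "V \<in> borel_measurable M" "AE \<omega> in M. V \<omega> = c" for U V c
  proof -
    note [measurable] = V(1)
    have [measurable]: "U \<in> borel_measurable M" using U by (simp add: gaussian_rv_def)
    consider \<mu> \<sigma> where "0 < \<sigma>" "distributed M lborel U (normal_density \<mu> \<sigma>)"
      | \<mu> where "AE \<omega> in M. U \<omega> = \<mu>"
      using U by (auto simp: gaussian_rv_def)
    then show ?thesis
    proof cases
      case 1
      have "distributed M lborel (\<lambda>\<omega>. c + 1 * U \<omega>) (normal_density (c + 1 * \<mu>) (\<bar>1\<bar> * \<sigma>))"
        by (rule normal_density_affine[OF 1(2,1)]) simp
      then have "distributed M lborel (\<lambda>\<omega>. U \<omega> + V \<omega>) (normal_density (c + 1 * \<mu>) (\<bar>1\<bar> * \<sigma>))"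
        by (rule distributed_cong_AE) (use V(2) in auto)
      then show ?thesis using 1(1) unfolding gaussian_rv_def by auto
    next
      case 2
      with V(2) have "AE \<omega> in M. U \<omega> + V \<omega> = \<mu> + c" by auto
      then show ?thesis unfolding gaussian_rv_def by auto
    qed
  qed
  consider \<mu> \<sigma> \<nu> \<tau> where "0 < \<sigma>" "distributed M lborel X (normal_density \<mu> \<sigma>)"
        "0 < \<tau>" "distributed M lborel Y (normal_density \<nu> \<tau>)"
    | \<mu> where "AE \<omega> in M. X \<omega> = \<mu>" | \<mu> where "AE \<omega> in M. Y \<omega> = \<mu>"
    using assms(2,3) by (auto simp: gaussian_rv_def)
  then show ?thesis
  proof cases
    case 1
    have "0 < sqrt (\<sigma>\<^sup>2 + \<tau>\<^sup>2)" using 1(1) by (simp add: add_pos_nonneg)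
    with add_indep_normal[OF assms(1) 1(1,3,2,4)] show ?thesis
      unfolding gaussian_rv_def by auto
  next
    case 2
    from shift[OF assms(3) _ 2] show ?thesis by (simp add: add.commute)
  next
    case 3
    from shift[OF assms(2) _ 3] show ?thesis by simp
  qed
qed

lemma gaussian_rv_sum_indep:
  assumes "finite I" "indep_vars (\<lambda>_. borel) X I" "\<And>i. i \<in> I \<Longrightarrow> gaussian_rv M (X i)"
  shows "gaussian_rv M (\<lambda>\<omega>. \<Sum>i\<in>I. X i \<omega>)"
  using assms
proof (induction I rule: finite_induct)
  case empty
  then show ?case by (auto simp: gaussian_rv_def)
next
  case (insert i I)
  have "gaussian_rv M (\<lambda>\<omega>. \<Sum>i\<in>I. X i \<omega>)"
    by (intro insert.IH indep_vars_subset[OF insert.prems(1)] insert.prems(2)) auto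
  then have "gaussian_rv M (\<lambda>\<omega>. X i \<omega> + (\<Sum>i\<in>I. X i \<omega>))"
    using insert.prems(2) by (intro gaussian_rv_add_indep indep_vars_sum insert.hyps insert.prems(1)) auto
  then show ?case using insert.hyps by simp
qed

text \<open>A vanishing Bochner integral does not imply integrability, since the integral is 0 by
  default; integrability comes from the Gaussian coordinates.\<close>

lemma integrable_centered_gaussian:
  assumes "centered_gaussian M Z"
  shows "integrable M Z"
proof -
  have "integrable M (\<lambda>\<omega>. b \<bullet> Z \<omega>)" for b
    using assms by (intro all_moments_integrable all_moments_gaussian_rv)
      (auto simp: centered_gaussian_def)
  then have "integrable M (\<lambda>\<omega>. \<Sum>b\<in>Basis. (b \<bullet> Z \<omega>) *\<^sub>R b)" by auto
  also have "(\<lambda>\<omega>. \<Sum>b\<in>Basis. (b \<bullet> Z \<omega>) *\<^sub>R b) = Z"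
    by (simp add: inner_commute[of _ "Z _"] euclidean_representation)
  finally show ?thesis .
qed

lemma expectation_inner_centered_gaussian:
  assumes "centered_gaussian M Z"
  shows "(\<integral>\<omega>. v \<bullet> Z \<omega> \<partial>M) = 0"
  using integrable_centered_gaussian[OF assms] assms by (simp add: centered_gaussian_def)

end

section \<open>Elliptic matrices as Gaussian ensembles\<close>

definition ellipse_entry ::
    "nat \<Rightarrow> (nat \<Rightarrow> nat \<Rightarrow> 'a \<Rightarrow> complex) \<Rightarrow> bool \<Rightarrow> nat \<Rightarrow> nat \<Rightarrow> 'a \<Rightarrow> complex" where
  "ellipse_entry N \<xi> b i j \<omega> =
     complex_of_real (1 / sqrt (real N)) * (if b then \<xi> i j \<omega> else cnj (\<xi> j i \<omega>))"

locale elliptic_matrix =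
  fixes M :: "'a measure" and \<gamma> :: real and N :: nat and \<xi> :: "nat \<Rightarrow> nat \<Rightarrow> 'a \<Rightarrow> complex"
  assumes elliptic: "elliptic_entries M \<gamma> N \<xi>"
begin

sublocale prob_space M
  using elliptic by (simp add: elliptic_entries_def)

definition Idx :: "(nat \<times> nat) set" where
  "Idx = {(i, j). i \<le> j \<and> j < N}"

definition pair :: "nat \<times> nat \<Rightarrow> 'a \<Rightarrow> complex \<times> complex" where
  "pair p \<omega> = (\<xi> (fst p) (snd p) \<omega>, \<xi> (snd p) (fst p) \<omega>)"

text \<open>Real linear forms in the entries, grouped by unordered index pairs so that the summands
  are independent.\<close>

definition real_span :: "('a \<Rightarrow> real) set" where
  "real_span = {\<lambda>\<omega>. \<Sum>p\<in>Idx. v p \<bullet> pair p \<omega> | v. True}"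

lemma real_spanI: "f = (\<lambda>\<omega>. \<Sum>p\<in>Idx. v p \<bullet> pair p \<omega>) \<Longrightarrow> f \<in> real_span"
  by (auto simp: real_span_def)

lemma finite_Idx: "finite Idx"
  by (rule finite_subset[of _ "{..<N} \<times> {..<N}"]) (auto simp: Idx_def)

lemma indep_pairs: "indep_vars (\<lambda>_. borel) pair Idx"
proof -
  have "pair = (\<lambda>(i, j) \<omega>. (\<xi> i j \<omega>, \<xi> j i \<omega>))" by (auto simp: pair_def fun_eq_iff)
  then show ?thesis using elliptic by (simp add: elliptic_entries_def Idx_def)
qed

lemma pair_gaussian:
  assumes "p \<in> Idx"
  shows "gaussian_rv M (\<lambda>\<omega>. v \<bullet> pair p \<omega>)" "(\<integral>\<omega>. v \<bullet> pair p \<omega> \<partial>M) = 0"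
proof -
  obtain i j where p: "p = (i, j)" "i \<le> j" "j < N" using assms by (auto simp: Idx_def)
  have "gaussian_rv M (\<lambda>\<omega>. v \<bullet> pair p \<omega>) \<and> (\<integral>\<omega>. v \<bullet> pair p \<omega> \<partial>M) = 0"
  proof (cases "i = j")
    case True
    have g: "centered_gaussian M (\<xi> i i)" using elliptic p by (simp add: elliptic_entries_def)
    \<comment> \<open>On the diagonal the pair repeats one variable, so the form reduces to a form
      in that variable alone.\<close>
    have "v \<bullet> pair p \<omega> = (fst v + snd v) \<bullet> \<xi> i i \<omega>" for \<omega>
      using p True by (simp add: pair_def inner_prod_def inner_add_left)
    then show ?thesis
      using expectation_inner_centered_gaussian[OF g] g by (simp add: centered_gaussian_def)
  next
    case False
    have g: "centered_gaussian M (pair p)"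
      using elliptic p False unfolding pair_def[abs_def] by (simp add: elliptic_entries_def)
    then show ?thesis
      using expectation_inner_centered_gaussian[OF g] g unfolding centered_gaussian_def by blast
  qed
  then show "gaussian_rv M (\<lambda>\<omega>. v \<bullet> pair p \<omega>)" "(\<integral>\<omega>. v \<bullet> pair p \<omega> \<partial>M) = 0" by auto
qed

lemma real_span_gaussian:
  assumes "f \<in> real_span"
  shows "gaussian_rv M f" "(\<integral>\<omega>. f \<omega> \<partial>M) = 0"
proof -
  obtain v where f: "f = (\<lambda>\<omega>. \<Sum>p\<in>Idx. v p \<bullet> pair p \<omega>)" using assms by (auto simp: real_span_def)
  have "indep_vars (\<lambda>_. borel) (\<lambda>p \<omega>. v p \<bullet> pair p \<omega>) Idx"
    by (rule indep_vars_compose2[OF indep_pairs]) auto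
  then show "gaussian_rv M f" unfolding f
    by (intro gaussian_rv_sum_indep finite_Idx pair_gaussian)
  have "integrable M (\<lambda>\<omega>. v p \<bullet> pair p \<omega>)" if "p \<in> Idx" for p
    using that by (intro all_moments_integrable all_moments_gaussian_rv pair_gaussian)
  then show "(\<integral>\<omega>. f \<omega> \<partial>M) = 0" unfolding f
    by (simp add: Bochner_Integration.integral_sum pair_gaussian)
qed

sublocale gaussian_space M real_span
proof
  fix f g t assume "f \<in> real_span" "g \<in> real_span"
  then obtain v w where "f = (\<lambda>\<omega>. \<Sum>p\<in>Idx. v p \<bullet> pair p \<omega>)" "g = (\<lambda>\<omega>. \<Sum>p\<in>Idx. w p \<bullet> pair p \<omega>)"
    by (auto simp: real_span_def)
  then have "(\<lambda>\<omega>. f \<omega> + t * g \<omega>) = (\<lambda>\<omega>. \<Sum>p\<in>Idx. (v p + t *\<^sub>R w p) \<bullet> pair p \<omega>)"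
    by (simp add: inner_add_left sum.distrib sum_distrib_left)
  then show "(\<lambda>\<omega>. f \<omega> + t * g \<omega>) \<in> real_span" by (rule real_spanI)
next
  fix f n assume f: "f \<in> real_span"
  show "all_moments M f" by (rule all_moments_gaussian_rv[OF real_span_gaussian(1)[OF f]])
  show "(\<integral>\<omega>. f \<omega> ^ Suc n \<partial>M) = real n * (\<integral>\<omega>. f \<omega> ^ 2 \<partial>M) * (\<integral>\<omega>. f \<omega> ^ (n - 1) \<partial>M)"
    by (rule gaussian_rv_moment_rec[OF real_span_gaussian[OF f]])
qed

lemma inner_entry_span:
  assumes "i < N" "j < N"
  shows "(\<lambda>\<omega>. a \<bullet> \<xi> i j \<omega>) \<in> real_span"
proof -
  define p where "p = (min i j, max i j)"
  define v where "v = (\<lambda>q. if q = p then (if i \<le> j then (a, 0) else (0, a)) else (0 :: complex \<times> complex))"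
  have p: "p \<in> Idx" using assms by (auto simp: p_def Idx_def)
  have "(\<Sum>q\<in>Idx. v q \<bullet> pair q \<omega>) = v p \<bullet> pair p \<omega>" for \<omega>
  proof -
    have "(\<Sum>q\<in>Idx. v q \<bullet> pair q \<omega>) = (\<Sum>q\<in>{p}. v q \<bullet> pair q \<omega>)"
      using p finite_Idx by (intro sum.mono_neutral_right) (auto simp: v_def)
    then show ?thesis by simp
  qed
  moreover have "v p \<bullet> pair p \<omega> = a \<bullet> \<xi> i j \<omega>" for \<omega>
    by (auto simp: v_def p_def pair_def min_def max_def)
  ultimately have "(\<lambda>\<omega>. a \<bullet> \<xi> i j \<omega>) = (\<lambda>\<omega>. \<Sum>q\<in>Idx. v q \<bullet> pair q \<omega>)" by simp
  then show ?thesis by (rule real_spanI)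
qed

lemma entry_complex_span:
  assumes "i < N" "j < N"
  shows "\<xi> i j \<in> complex_span" "(\<lambda>\<omega>. cnj (\<xi> i j \<omega>)) \<in> complex_span"
proof -
  show "\<xi> i j \<in> complex_span"
    by (rule complex_spanI[OF inner_entry_span[OF assms, of 1] inner_entry_span[OF assms, of \<i>]])
      (simp add: complex_eq_iff inner_complex_def)
  show "(\<lambda>\<omega>. cnj (\<xi> i j \<omega>)) \<in> complex_span"
    by (rule complex_spanI[OF inner_entry_span[OF assms, of 1] inner_entry_span[OF assms, of "- \<i>"]])
      (simp add: complex_eq_iff inner_complex_def)
qed

lemma complex_span_of_real_mult:
  assumes "z \<in> complex_span"
  shows "(\<lambda>\<omega>. complex_of_real r * z \<omega>) \<in> complex_span"
proof -
  obtain A B where AB: "A \<in> real_span" "B \<in> real_span"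
    and z: "z = (\<lambda>\<omega>. complex_of_real (A \<omega>) + \<i> * complex_of_real (B \<omega>))"
    using assms by (auto simp: complex_span_def)
  \<comment> \<open>\<open>lin\<close> offers only sums C + t C, hence t = r - 1.\<close>
  have "(\<lambda>\<omega>. r * C \<omega>) \<in> real_span" if "C \<in> real_span" for C
    using lin[OF that that, of "r - 1"] by (simp add: algebra_simps)
  from complex_spanI[OF this[OF AB(1)] this[OF AB(2)]] show ?thesis
    by (simp add: z algebra_simps)
qed

lemma expectation_complex_span: "z \<in> complex_span \<Longrightarrow> (\<integral>\<omega>. z \<omega> \<partial>M) = 0"
proof -
  assume z: "z \<in> complex_span"
  then obtain A B where AB: "A \<in> real_span" "B \<in> real_span"
    and z: "z = (\<lambda>\<omega>. complex_of_real (A \<omega>) + \<i> * complex_of_real (B \<omega>))"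
    by (auto simp: complex_span_def)
  have "(\<integral>\<omega>. z \<omega> \<partial>M) = (\<integral>\<omega>. complex_of_real (A \<omega>) \<partial>M) + (\<integral>\<omega>. \<i> * complex_of_real (B \<omega>) \<partial>M)"
    unfolding z
    by (intro Bochner_Integration.integral_add all_moments_integrable all_moments_cmult
        all_moments_of_real mom AB)
  then show ?thesis
    by (simp add: real_span_gaussian[OF AB(1)] real_span_gaussian[OF AB(2)])
qed

text \<open>Independence factorises the expectation, and elements of the span are centred.\<close>

lemma expectation_distinct_pairs:
  fixes f g :: "complex \<times> complex \<Rightarrow> complex"
  assumes pq: "p \<in> Idx" "q \<in> Idx" "p \<noteq> q"
    and m: "f \<in> borel_measurable borel" "g \<in> borel_measurable borel"
    and f: "(\<lambda>\<omega>. f (pair p \<omega>)) \<in> complex_span" and g: "(\<lambda>\<omega>. g (pair q \<omega>)) \<in> complex_span"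
  shows "(\<integral>\<omega>. f (pair p \<omega>) * g (pair q \<omega>) \<partial>M) = 0"
proof -
  define h where "h = (\<lambda>r. if r = p then f else g)"
  have "indep_vars (\<lambda>_. borel) pair {p, q}"
    by (rule indep_vars_subset[OF indep_pairs]) (use pq in auto)
  then have "indep_vars (\<lambda>_. borel) (\<lambda>r \<omega>. h r (pair r \<omega>)) {p, q}"
    by (rule indep_vars_compose2) (use m in \<open>auto simp: h_def\<close>)
  moreover have "integrable M (\<lambda>\<omega>. h r (pair r \<omega>))" if "r \<in> {p, q}" for r
    using that f g pq(3) by (auto simp: h_def intro!: all_moments_integrable all_moments_complex_span)
  ultimately have "(\<integral>\<omega>. (\<Prod>r\<in>{p, q}. h r (pair r \<omega>)) \<partial>M) = (\<Prod>r\<in>{p, q}. \<integral>\<omega>. h r (pair r \<omega>) \<partial>M)"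
    by (intro indep_vars_lebesgue_integral) auto
  then show ?thesis using pq(3) expectation_complex_span[OF f] by (simp add: h_def)
qed

text \<open>An entry is a coordinate (\<open>sel\<close>) of the pair at its sorted index
  (\<open>srt\<close>), and the hypotheses make the sorted indices different. The maps \<phi> and
  \<psi> cover conjugated and plain entries at once.\<close>

lemma entry_distinct:
  assumes N: "i < N" "j < N" "k < N" "l < N" and ne: "(i, j) \<noteq> (k, l)" "(i, j) \<noteq> (l, k)"
    and \<phi>: "\<phi> = id \<or> \<phi> = cnj" and \<psi>: "\<psi> = id \<or> \<psi> = cnj"
  shows "(\<integral>\<omega>. \<phi> (\<xi> i j \<omega>) * \<psi> (\<xi> k l \<omega>) \<partial>M) = 0"
proof -
  define sel where "sel = (\<lambda>i j (z :: complex \<times> complex). if (i :: nat) \<le> j then fst z else snd z)"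
  define srt where "srt = (\<lambda>i j. (min i j, max i j :: nat))"
  have \<xi>: "\<xi> i j \<omega> = sel i j (pair (srt i j) \<omega>)" for i j \<omega>
    by (auto simp: sel_def srt_def pair_def min_def max_def)
  have [measurable]: "sel i j \<in> borel_measurable borel" for i j
    unfolding sel_def by (cases "i \<le> j") (auto simp: borel_prod[symmetric])
  have [measurable]: "cnj \<in> borel_measurable borel" by (intro borel_measurable_continuous_onI continuous_intros)
  have m: "(\<lambda>z. \<theta> (sel i j z)) \<in> borel_measurable borel" if "\<theta> = id \<or> \<theta> = cnj" for i j \<theta>
    using that by auto
  have sp: "(\<lambda>\<omega>. \<theta> (sel i j (pair (srt i j) \<omega>))) \<in> complex_span"
    if "\<theta> = id \<or> \<theta> = cnj" "i < N" "j < N" for i j \<theta>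
    using that entry_complex_span[of i j] by (auto simp flip: \<xi>)
  have "srt i j \<noteq> srt k l" using ne by (auto simp: srt_def min_def max_def split: if_splits)
  moreover have "srt i j \<in> Idx" "srt k l \<in> Idx" using N by (auto simp: srt_def Idx_def)
  ultimately have "(\<integral>\<omega>. \<phi> (sel i j (pair (srt i j) \<omega>)) * \<psi> (sel k l (pair (srt k l) \<omega>)) \<partial>M) = 0"
    by (intro expectation_distinct_pairs[where f = "\<lambda>z. \<phi> (sel i j z)" and g = "\<lambda>z. \<psi> (sel k l z)"]
        m sp \<phi> \<psi> N)
  then show ?thesis by (simp only: \<xi>[symmetric])
qed

lemma entry_entry:
  assumes "i < N" "j < N" "k < N" "l < N"
  shows "(\<integral>\<omega>. \<xi> i j \<omega> * \<xi> k l \<omega> \<partial>M) = (if i = l \<and> j = k then complex_of_real \<gamma> else 0)"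
proof (cases "(i, j) \<noteq> (k, l) \<and> (i, j) \<noteq> (l, k)")
  case True
  then show ?thesis using entry_distinct[OF assms, of id id] by auto
next
  case False
  have *: "i' < j' \<Longrightarrow> j' < N \<Longrightarrow> (\<integral>\<omega>. (\<xi> i' j' \<omega>)\<^sup>2 \<partial>M) = 0 \<and> (\<integral>\<omega>. (\<xi> j' i' \<omega>)\<^sup>2 \<partial>M) = 0 \<and>
      (\<integral>\<omega>. \<xi> i' j' \<omega> * \<xi> j' i' \<omega> \<partial>M) = complex_of_real \<gamma>" for i' j'
    using elliptic by (simp add: elliptic_entries_def)
  have d: "(\<integral>\<omega>. (\<xi> i i \<omega>)\<^sup>2 \<partial>M) = complex_of_real \<gamma>"
    using elliptic assms(1) by (simp add: elliptic_entries_def)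
  consider "i = j" | "i < j" | "j < i" by linarith
  then show ?thesis
  proof cases
    case 1
    then show ?thesis using False d by (auto simp: power2_eq_square)
  next
    case 2
    then show ?thesis using False *[OF 2 assms(2)] by (auto simp: power2_eq_square)
  next
    case 3
    then show ?thesis using False *[OF 3 assms(1)] by (auto simp: power2_eq_square mult.commute)
  qed
qed

lemma entry_cnj_entry:
  assumes "i < N" "j < N" "k < N" "l < N"
  shows "(\<integral>\<omega>. \<xi> i j \<omega> * cnj (\<xi> k l \<omega>) \<partial>M) = (if i = k \<and> j = l then 1 else 0)"
proof (cases "(i, j) \<noteq> (k, l) \<and> (i, j) \<noteq> (l, k)")
  case True
  then show ?thesis using entry_distinct[OF assms, of id cnj] by auto
next
  case False
  have sq: "(\<integral>\<omega>. \<xi> a b \<omega> * cnj (\<xi> a b \<omega>) \<partial>M) = complex_of_real (\<integral>\<omega>. (cmod (\<xi> a b \<omega>))\<^sup>2 \<partial>M)" for a b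
    unfolding complex_norm_square[symmetric] by (rule integral_complex_of_real)
  have *: "i' < j' \<Longrightarrow> j' < N \<Longrightarrow> (\<integral>\<omega>. (cmod (\<xi> i' j' \<omega>))\<^sup>2 \<partial>M) = 1 \<and>
      (\<integral>\<omega>. (cmod (\<xi> j' i' \<omega>))\<^sup>2 \<partial>M) = 1 \<and>
      (\<integral>\<omega>. \<xi> i' j' \<omega> * cnj (\<xi> j' i' \<omega>) \<partial>M) = 0" for i' j'
    using elliptic by (simp add: elliptic_entries_def)
  have d: "(\<integral>\<omega>. (cmod (\<xi> i i \<omega>))\<^sup>2 \<partial>M) = 1"
    using elliptic assms(1) by (simp add: elliptic_entries_def)
  \<comment> \<open>The hypotheses give this mixed moment only above the diagonal; conjugation
    transfers it below.\<close>
  have sw: "(\<integral>\<omega>. \<xi> i j \<omega> * cnj (\<xi> j i \<omega>) \<partial>M) = cnj (\<integral>\<omega>. \<xi> j i \<omega> * cnj (\<xi> i j \<omega>) \<partial>M)"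
    by (simp add: mult.commute flip: Bochner_Integration.integral_cnj)
  consider "i = j" | "i < j" | "j < i" by linarith
  then show ?thesis
  proof cases
    case 1
    then show ?thesis using False d sq by auto
  next
    case 2
    then show ?thesis using False *[OF 2 assms(2)] sq by auto
  next
    case 3
    then show ?thesis using False *[OF 3 assms(1)] sq sw by auto
  qed
qed

text \<open>Passing to the adjoint swaps the indices as well as conjugating, so all four letter
  combinations get the same index pattern. For two adjoint letters the value is the conjugate of
  \<gamma>, which is real.\<close>

sublocale elliptic_ensemble M real_span N "complex_of_real \<gamma>" "ellipse_entry N \<xi>"
proof
  fix i j b assume "i < N" "j < N"
  then show "ellipse_entry N \<xi> b i j \<in> complex_span"
    unfolding ellipse_entry_def[abs_def]
    by (intro complex_span_of_real_mult) (cases b; simp only: if_True if_False entry_complex_span)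
next
  fix i j k l b b' assume N: "i < N" "j < N" "k < N" "l < N"
  let ?s = "complex_of_real (1 / sqrt (real N))"
  have s: "?s * ?s = 1 / of_nat N"
    by (simp flip: of_real_mult)
  have cc: "(\<integral>\<omega>. cnj (\<xi> j i \<omega>) * cnj (\<xi> l k \<omega>) \<partial>M) = cnj (\<integral>\<omega>. \<xi> j i \<omega> * \<xi> l k \<omega> \<partial>M)"
    by (simp flip: Bochner_Integration.integral_cnj)
  have "(\<integral>\<omega>. ellipse_entry N \<xi> b i j \<omega> * ellipse_entry N \<xi> b' k l \<omega> \<partial>M) =
     (?s * ?s) * (\<integral>\<omega>. (if b then \<xi> i j \<omega> else cnj (\<xi> j i \<omega>)) * (if b' then \<xi> k l \<omega> else cnj (\<xi> l k \<omega>)) \<partial>M)"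
    unfolding ellipse_entry_def by (subst integral_mult_right_zero[symmetric]) (simp add: mult_ac)
  also have "(\<integral>\<omega>. (if b then \<xi> i j \<omega> else cnj (\<xi> j i \<omega>)) * (if b' then \<xi> k l \<omega> else cnj (\<xi> l k \<omega>)) \<partial>M) =
      (if i = l \<and> j = k then letter_cov (complex_of_real \<gamma>) b b' else 0)"
    using N entry_cnj_entry[OF N(3,4,2,1)]
    by (cases b; cases b')
      (auto simp: letter_cov_def entry_entry entry_cnj_entry cc mult.commute[of "cnj _" "\<xi> _ _ _"])
  finally show "(\<integral>\<omega>. ellipse_entry N \<xi> b i j \<omega> * ellipse_entry N \<xi> b' k l \<omega> \<partial>M) =
      (if i = l \<and> j = k then letter_cov (complex_of_real \<gamma>) b b' / of_nat N else 0)"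
    unfolding s by simp
qed

end

section \<open>Traces of matrix powers\<close>

lemma concat_replicate_Suc: "concat (replicate (Suc n) u) = concat (replicate n u) @ u"
  by (induction n) auto

context elliptic_matrix
begin

definition represents :: "'a \<Rightarrow> bool list \<Rightarrow> complex mat \<Rightarrow> bool" where
  "represents \<omega> u B \<longleftrightarrow> B \<in> carrier_mat N N \<and> (\<forall>i<N. \<forall>j<N. B $$ (i, j) = word_entry u i j \<omega>)"

lemma represents_mult:
  assumes "represents \<omega> u B" "represents \<omega> v C"
  shows "represents \<omega> (u @ v) (B * C)"
proof -
  have BC: "B \<in> carrier_mat N N" "C \<in> carrier_mat N N" using assms by (auto simp: represents_def)
  have "(B * C) $$ (i, j) = word_entry (u @ v) i j \<omega>" if "i < N" "j < N" for i j
    using BC that assms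
    by (simp add: scalar_prod_def word_entry_append represents_def atLeast0LessThan)
  then show ?thesis using BC by (simp add: represents_def)
qed

lemma represents_power:
  assumes "represents \<omega> u B"
  shows "represents \<omega> (concat (replicate p u)) (B ^\<^sub>m p)"
proof (induction p)
  case 0
  have "dim_row B = N" using assms by (auto simp: represents_def)
  then show ?case by (simp add: represents_def)
next
  case (Suc p)
  show ?case unfolding concat_replicate_Suc pow_mat.simps
    by (rule represents_mult[OF Suc assms])
qed

lemma word_entry_single: "j < N \<Longrightarrow> word_entry [b] i j \<omega> = ellipse_entry N \<xi> b i j \<omega>"
proof -
  assume "j < N"
  have "word_entry [b] i j \<omega> = (\<Sum>k<N. if k = j then ellipse_entry N \<xi> b i k \<omega> else 0)"
    unfolding word_entry.simps by (rule sum.cong) auto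
  then show ?thesis using \<open>j < N\<close> by simp
qed

lemma represents_normalized_mat: "represents \<omega> [True] (normalized_mat N \<xi> \<omega>)"
  unfolding represents_def
  by (simp add: normalized_mat_def word_entry_single ellipse_entry_def del: word_entry.simps)

lemma represents_mat_adjoint: "represents \<omega> [False] (mat_adjoint (normalized_mat N \<xi> \<omega>))"
  unfolding represents_def
  by (simp add: normalized_mat_def mat_adjoint_def word_entry_single ellipse_entry_def
      mat_of_rows_index carrier_matI del: word_entry.simps)

lemma Tr_represents: "represents \<omega> u B \<Longrightarrow> Tr B = word_trace u \<omega>"
  by (auto simp: represents_def Tr_def word_trace_def)

lemma cumulant2_words:
  assumes "\<And>\<omega>. represents \<omega> u (B \<omega>)" "\<And>\<omega>. represents \<omega> v (C \<omega>)"
  shows "cumulant2 M (\<lambda>\<omega>. Tr (B \<omega>)) (\<lambda>\<omega>. Tr (C \<omega>)) = cmom [u, v]"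
  using expectation_trace_mult_mult[of u v "[]"]
  by (simp add: cumulant2_def Tr_represents[OF assms(1)] Tr_represents[OF assms(2)]
      cmom_single cmom_Nil trace_prod_def mean_def[symmetric])

end

text \<open>Only equations at fixed size are transferred, so the matrices of different sizes may
  live on unrelated probability spaces.\<close>

lemma loop_asymptotics_elliptic:
  assumes "\<And>n. elliptic_matrix (M n) \<gamma> (Suc n) (\<xi> n)"
  shows "loop_asymptotics (letter_cov (complex_of_real \<gamma>))
    (\<lambda>n. elliptic_ensemble.mean (M n) (Suc n) (ellipse_entry (Suc n) (\<xi> n)))
    (\<lambda>n. elliptic_ensemble.cmom (M n) (Suc n) (ellipse_entry (Suc n) (\<xi> n)))"
proof
  fix n
  interpret E: elliptic_matrix "M n" \<gamma> "Suc n" "\<xi> n" by (rule assms)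
  show "E.mean [] = of_nat (Suc n)" by (rule E.mean_Nil)
  show "E.cmom [] = 1" by (rule E.cmom_Nil)
  show "E.cmom ([] # us) = 0" for us by (rule E.cmom_Nil_Cons)
  show "E.mean (b # w) = (\<Sum>s<length w. letter_cov (complex_of_real \<gamma>) b (w ! s) / of_nat (Suc n) *
     (E.cmom [take s w, drop (Suc s) w] + E.mean (take s w) * E.mean (drop (Suc s) w)))" for b w
    by (rule E.mean_Cons)
  show "E.cmom ((b # w) # us) =
    (\<Sum>s<length w. letter_cov (complex_of_real \<gamma>) b (w ! s) / of_nat (Suc n) *
      (E.cmom (take s w # drop (Suc s) w # us) +
       E.mean (take s w) * E.cmom (drop (Suc s) w # us) +
       E.mean (drop (Suc s) w) * E.cmom (take s w # us) -
       E.cmom [take s w, drop (Suc s) w] * E.cmom us)) +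
    (\<Sum>r<length us. \<Sum>t<length (us ! r). letter_cov (complex_of_real \<gamma>) b (us ! r ! t) / of_nat (Suc n) *
      (E.cmom ((w @ cut_at t (us ! r)) # take r us @ drop (Suc r) us) +
       E.mean (w @ cut_at t (us ! r)) * E.cmom (take r us @ drop (Suc r) us)))" for b w us
    by (rule E.cmom_Cons)
qed

section \<open>Constant and alternating words, and the closed formulas\<close>

locale letter_limits = loop_limits "letter_cov g" m k
  for g :: "'c::comm_ring_1" and m k
begin

lemma alternating_replicate: "alternating g (replicate n b)"
  by (auto simp: alternating_def letter_cov_def)

lemma cut_at_replicate: "t < n \<Longrightarrow> cut_at t (replicate n b) = replicate (n - 1) b"
  by (simp add: cut_at_def flip: replicate_add)

text \<open>All rotations have the same weight, so the power sum is q times a power;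
  \<open>paths_eq_ballot\<close> then trades the q rotations for the number a of pairs
  across.\<close>

lemma k_replicate:
  assumes "1 \<le> q"
  shows "k (replicate p b) (replicate q b') =
    (\<Sum>a = 1..min p q. of_nat a * letter_cov g b b' ^ a * paths g p a * paths g q a)"
proof -
  let ?d = "letter_cov g b b'"
  define f where "f a = of_nat a * ?d ^ a * paths g p a * paths g q a" for a
  have "annular g (\<lambda>a. of_nat q * ?d ^ Suc a) (replicate p b) (replicate q b')"
    by (auto simp: annular_def cut_at_replicate alternating_replicate letter_cov_def)
  from k_annular[OF this, of p] assms
  have "k (replicate p b) (replicate q b') =
      (\<Sum>a<p. of_nat q * ?d ^ Suc a * paths g p (Suc a) * ballot g (q - 1) a)"
    by simp
  also have "\<dots> = (\<Sum>a<p. f (Suc a))"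
  proof (intro sum.cong refl)
    fix a
    have "f (Suc a) = (of_nat (Suc a) * paths g q (Suc a)) * ?d ^ Suc a * paths g p (Suc a)"
      unfolding f_def by (simp only: mult_ac)
    also have "of_nat (Suc a) * paths g q (Suc a) = of_nat q * ballot g (q - 1) a"
      using paths_eq_ballot[of a g "q - 1"] assms by simp
    finally show "of_nat q * ?d ^ Suc a * paths g p (Suc a) * ballot g (q - 1) a = f (Suc a)"
      by (simp only: mult_ac)
  qed
  also have "\<dots> = (\<Sum>a = 1..p. f a)"
    by (simp add: sum.atLeast1_atMost_eq)
  \<comment> \<open>More than q pairs across are impossible: \<open>paths g q a\<close> vanishes for
    a > q.\<close>
  also have "\<dots> = (\<Sum>a = 1..min p q. f a)"
    by (rule sum.mono_neutral_right) (auto simp: f_def paths_eq_0)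
  finally show ?thesis by (simp add: f_def)
qed

lemma cut_at_even:
  assumes "t < 2 * q" "l < 2 * q - 1"
  shows "cut_at t (map even [0..<2 * q]) ! l = even (Suc t + l)"
  using assms by (auto simp: cut_at_def nth_append)

text \<open>Half of the rotations join equal letters, of weight g, and half join different ones, of
  weight 1.\<close>

lemma sum_letter_cov_even:
  "(\<Sum>t<2 * q. letter_cov g b (even t) ^ Suc a) = of_nat q * (g ^ Suc a + 1)"
  by (induction q) (auto simp: letter_cov_def algebra_simps)

text \<open>Letters at odd distance in an alternating word differ, so inner pairs weigh 1 and g
  enters only through the rotation. A further pair of admissible parity compares letters exactly as
  the first pair does.\<close>

lemma annular_even:
  "annular 1 (\<lambda>a. of_nat q * (g ^ Suc a + 1)) (map even [0..<2 * p]) (map even [0..<2 * q])"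
  unfolding annular_def
proof (intro conjI allI impI)
  show "alternating 1 (cut_at t (map even [0..<2 * q]))" if "t < length (map even [0..<2 * q])" for t
    using that by (auto simp: alternating_def cut_at_even letter_cov_def)
  show "letter_cov g (map even [0..<2 * p] ! i) (map even [0..<2 * p] ! j) = 1"
    if "i < j" "j < length (map even [0..<2 * p])" "odd (i + j) \<or> odd (length (map even [0..<2 * q]))"
    for i j
    using that by (auto simp: letter_cov_def)
  show "letter_cov g (map even [0..<2 * p] ! j) (cut_at t (map even [0..<2 * q]) ! l) =
      letter_cov g (map even [0..<2 * p] ! i) (map even [0..<2 * q] ! t)"
    if "l < length (map even [0..<2 * q]) - 1" "t < length (map even [0..<2 * q])" "i < j"
      "j < length (map even [0..<2 * p])" "odd (j - i + l + length (map even [0..<2 * q]))" for t i j l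
    using that by (auto simp: cut_at_even letter_cov_def)
  show "(\<Sum>t<length (map even [0..<2 * q]). letter_cov g (map even [0..<2 * p] ! i)
      (map even [0..<2 * q] ! t) ^ Suc a) = of_nat q * (g ^ Suc a + 1)" for i a
    unfolding sum_letter_cov_even[symmetric, of _ _ "map even [0..<2 * p] ! i"]
    by (rule sum.cong) simp_all
qed

end

lemma sum_even_index:
  fixes f :: "nat \<Rightarrow> 'a::comm_monoid_add"
  assumes "\<And>a. odd a \<Longrightarrow> f a = 0"
  shows "(\<Sum>b<2 * p. f (Suc b)) = (\<Sum>a = 1..p. f (2 * a))"
  using assms by (induction p) auto

text \<open>Only an even number 2 a of pairs across is possible. The word has length 2 q but the
  power sum only the factor q; the equation is doubled because the ring need not allow division by
  2.\<close>

lemma (in letter_limits) k_even: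
  assumes "1 \<le> q"
  shows "2 * k (map even [0..<2 * p]) (map even [0..<2 * q]) =
    2 * (\<Sum>a = 1..p. of_nat a * (g ^ (2 * a) + 1) * paths 1 (2 * p) (2 * a) * paths 1 (2 * q) (2 * a))"
proof -
  define f where "f a = of_nat a * (g ^ a + 1) * paths 1 (2 * p) a * paths 1 (2 * q) a" for a
  from k_annular[OF annular_even, of p "2 * p" q] assms
  have "2 * k (map even [0..<2 * p]) (map even [0..<2 * q]) =
      2 * (\<Sum>a<2 * p. of_nat q * (g ^ Suc a + 1) * paths 1 (2 * p) (Suc a) * ballot 1 (2 * q - 1) a)"
    by simp
  also have "\<dots> = (\<Sum>a<2 * p. f (Suc a))"
  proof -
    have "Suc (2 * q - 1) = 2 * q" using assms by simp
    then have e: "of_nat (Suc a) * paths 1 (2 * q) (Suc a) = 2 * (of_nat q * (ballot 1 (2 * q - 1) a :: 'c))" for a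
      using paths_eq_ballot[of a "1 :: 'c" "2 * q - 1"] by (simp only: of_nat_mult of_nat_numeral mult.assoc)
    have "2 * (of_nat q * (g ^ Suc a + 1) * paths 1 (2 * p) (Suc a) * ballot 1 (2 * q - 1) a) = f (Suc a)" for a
    proof -
      have "f (Suc a) = (of_nat (Suc a) * paths 1 (2 * q) (Suc a)) * (g ^ Suc a + 1) * paths 1 (2 * p) (Suc a)"
        unfolding f_def by (simp only: mult_ac)
      then show ?thesis unfolding e by (simp only: mult_ac)
    qed
    then show ?thesis by (simp only: sum_distrib_left)
  qed
  also have "\<dots> = (\<Sum>a = 1..p. f (2 * a))"
    by (rule sum_even_index) (simp add: f_def paths_eq_0)
  also have "\<dots> = 2 * (\<Sum>a = 1..p. of_nat a * (g ^ (2 * a) + 1) * paths 1 (2 * p) (2 * a) * paths 1 (2 * q) (2 * a))"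
    unfolding f_def sum_distrib_left
    by (intro sum.cong refl) (simp only: of_nat_mult of_nat_numeral mult_ac)
  finally show ?thesis .
qed

lemma paths_of_real:
  "a \<le> p \<Longrightarrow> paths (complex_of_real \<gamma>) p a =
     complex_of_real (\<gamma> ^ ((p - a) div 2) * binom_real p ((real p - real a) / 2))"
proof -
  assume "a \<le> p"
  show ?thesis
  proof (cases "even (p - a)")
    case True
    then obtain k where "p - a = 2 * k" by (elim evenE)
    then have p: "p = a + 2 * k" using \<open>a \<le> p\<close> by simp
    have "(real p - real a) / 2 = real k" using p by simp
    then show ?thesis using p by (simp add: paths_def binom_real_def)
  next
    case False
    have "(real p - real a) / 2 \<notin> \<nat>"
    proof
      assume "(real p - real a) / 2 \<in> \<nat>"
      then obtain k where "(real p - real a) / 2 = real k" by (elim Nats_cases)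
      then have "real p = real (a + 2 * k)" by simp
      then have "p = a + 2 * k" by (simp only: of_nat_eq_iff)
      then show False using False by simp
    qed
    then show ?thesis using False by (simp add: paths_def binom_real_def)
  qed
qed

lemma paths_1_even: "a \<le> p \<Longrightarrow> paths 1 (2 * p) (2 * a) = of_nat ((2 * p) choose (p - a))"
  using paths_diag[of 1 "2 * a"] by (auto simp: le_iff_add distrib_left)

text \<open>Treats equal letters (e = 1) and an adjoint pair (e = 0) together. The weight is written
  as a power of \<gamma> and nothing is divided by \<gamma>, so \<gamma> = 0 is covered with 0^0 =
  1.\<close>

lemma paths_mult_of_real:
  assumes "a \<le> min p q" "d = \<gamma> ^ e" "e \<le> 1"
  shows "of_nat a * complex_of_real d ^ a * paths (complex_of_real \<gamma>) p a * paths (complex_of_real \<gamma>) q a =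
    complex_of_real (real a * \<gamma> ^ ((p + q) div 2 - (1 - e) * a) *
      binom_real p ((real p - real a) / 2) * binom_real q ((real q - real a) / 2))"
proof (cases "even (p - a) \<and> even (q - a)")
  case True
  then obtain k l where "p - a = 2 * k" "q - a = 2 * l" by (metis evenE)
  then have p: "p = a + 2 * k" and q: "q = a + 2 * l" using assms(1) by auto
  have e: "d ^ a * \<gamma> ^ k * \<gamma> ^ l = \<gamma> ^ ((p + q) div 2 - (1 - e) * a)"
    using assms(3) unfolding assms(2) p q
    by (cases e) (simp_all add: power_add algebra_simps flip: power_add)
  have "(p - a) div 2 = k" "(q - a) div 2 = l" using p q by simp_all
  then have "of_nat a * complex_of_real d ^ a * paths (complex_of_real \<gamma>) p a * paths (complex_of_real \<gamma>) q a =
      complex_of_real (real a * (d ^ a * \<gamma> ^ k * \<gamma> ^ l) *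
        binom_real p ((real p - real a) / 2) * binom_real q ((real q - real a) / 2))"
    using assms(1) by (simp add: paths_of_real mult_ac)
  then show ?thesis unfolding e .
next
  case False
  then have "paths (complex_of_real \<gamma>) p a = 0 \<or> paths (complex_of_real \<gamma>) q a = 0"
    by (auto simp: paths_def)
  \<comment> \<open>Evaluated at weight 1, where the vanishing of \<open>paths\<close> cannot be due
    to a power of \<gamma>.\<close>
  moreover have "binom_real p ((real p - real a) / 2) = 0 \<or> binom_real q ((real q - real a) / 2) = 0"
    using False paths_of_real[of a p 1] paths_of_real[of a q 1] assms(1) by (auto simp: paths_def)
  ultimately show ?thesis by auto
qed

theorem theorem1p5:
  fixes \<gamma> :: real
    and M :: "nat \<Rightarrow> 'a measure"
    and \<xi> :: "nat \<Rightarrow> nat \<Rightarrow> nat \<Rightarrow> 'a \<Rightarrow> complex"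
    and X :: "nat \<Rightarrow> 'a \<Rightarrow> complex mat"
    and p q :: nat
  assumes "-1 \<le> \<gamma>" and "\<gamma> \<le> 1"
    and "\<And>N. 1 \<le> N \<Longrightarrow> elliptic_entries (M N) \<gamma> N (\<xi> N)"
    and "\<And>N. 1 \<le> N \<Longrightarrow> X N = normalized_mat N (\<xi> N)"
    and "1 \<le> p" and "1 \<le> q"
  shows
    "(\<lambda>N. cumulant2 (M N) (\<lambda>\<omega>. Tr (X N \<omega> ^\<^sub>m p)) (\<lambda>\<omega>. Tr (X N \<omega> ^\<^sub>m q)))
       \<longlonglongrightarrow> complex_of_real (\<Sum>a = 1..min p q. real a * \<gamma> ^ ((p + q) div 2) *
             binom_real p ((real p - real a) / 2) * binom_real q ((real q - real a) / 2))
     \<and> (\<lambda>N. cumulant2 (M N) (\<lambda>\<omega>. Tr (X N \<omega> ^\<^sub>m p)) (\<lambda>\<omega>. Tr (mat_adjoint (X N \<omega>) ^\<^sub>m q)))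
       \<longlonglongrightarrow> complex_of_real (\<Sum>a = 1..min p q. real a * \<gamma> ^ ((p + q) div 2 - a) *
             binom_real p ((real p - real a) / 2) * binom_real q ((real q - real a) / 2))
     \<and> (\<lambda>N. cumulant2 (M N) (\<lambda>\<omega>. Tr ((X N \<omega> * mat_adjoint (X N \<omega>)) ^\<^sub>m p))
                           (\<lambda>\<omega>. Tr ((X N \<omega> * mat_adjoint (X N \<omega>)) ^\<^sub>m q)))
       \<longlonglongrightarrow> complex_of_real (\<Sum>a = 1..min p q. real a * (\<gamma> ^ (2 * a) + 1) *
             real ((2 * p) choose (p - a)) * real ((2 * q) choose (q - a)))"
proof -
  have em: "elliptic_matrix (M (Suc n)) \<gamma> (Suc n) (\<xi> (Suc n))" for n
    using assms(3) by unfold_locales simp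
  let ?g = "complex_of_real \<gamma>"
  let ?cmom = "\<lambda>n. elliptic_ensemble.cmom (M (Suc n)) (Suc n) (ellipse_entry (Suc n) (\<xi> (Suc n)))"
  interpret loop_asymptotics "letter_cov ?g"
    "\<lambda>n. elliptic_ensemble.mean (M (Suc n)) (Suc n) (ellipse_entry (Suc n) (\<xi> (Suc n)))" ?cmom
    by (rule loop_asymptotics_elliptic[OF em])
  interpret letter_limits ?g lim_mean lim_cov ..
  have X: "X (Suc n) = normalized_mat (Suc n) (\<xi> (Suc n))" for n using assms(4) by simp
  \<comment> \<open>Stated for arbitrary matrix functions \<open>B\<close> and \<open>C\<close>
    represented by words, so that the three limits become instances.\<close>
  have limit: "(\<lambda>N. cumulant2 (M N) (\<lambda>\<omega>. Tr (B (X N \<omega>))) (\<lambda>\<omega>. Tr (C (X N \<omega>)))) \<longlonglongrightarrow> lim_cov u v"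
    if "\<And>n \<omega>. elliptic_matrix.represents (Suc n) (\<xi> (Suc n)) \<omega> u (B (X (Suc n) \<omega>))"
      "\<And>n \<omega>. elliptic_matrix.represents (Suc n) (\<xi> (Suc n)) \<omega> v (C (X (Suc n) \<omega>))" for u v B C
  proof (rule LIMSEQ_imp_Suc)
    have "cumulant2 (M (Suc n)) (\<lambda>\<omega>. Tr (B (X (Suc n) \<omega>))) (\<lambda>\<omega>. Tr (C (X (Suc n) \<omega>))) = ?cmom n [u, v]" for n
      by (rule elliptic_matrix.cumulant2_words[OF em that])
    then show "(\<lambda>n. cumulant2 (M (Suc n)) (\<lambda>\<omega>. Tr (B (X (Suc n) \<omega>))) (\<lambda>\<omega>. Tr (C (X (Suc n) \<omega>)))) \<longlonglongrightarrow> lim_cov u v"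
      using cov_tendsto[of u v] by simp
  qed
  have repX: "elliptic_matrix.represents (Suc n) (\<xi> (Suc n)) \<omega> [True] (X (Suc n) \<omega>)" for n \<omega>
    unfolding X by (rule elliptic_matrix.represents_normalized_mat[OF em])
  have repA: "elliptic_matrix.represents (Suc n) (\<xi> (Suc n)) \<omega> [False] (mat_adjoint (X (Suc n) \<omega>))" for n \<omega>
    unfolding X by (rule elliptic_matrix.represents_mat_adjoint[OF em])
  have repXA: "elliptic_matrix.represents (Suc n) (\<xi> (Suc n)) \<omega> [True, False]
      (X (Suc n) \<omega> * mat_adjoint (X (Suc n) \<omega>))" for n \<omega>
    using elliptic_matrix.represents_mult[OF em repX repA] by simp
  note power = elliptic_matrix.represents_power[OF em]
  have rep1: "concat (replicate n [b]) = replicate n b" for n and b :: bool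
    by (induction n) auto
  have rep2: "concat (replicate n [True, False]) = map even [0..<2 * n]" for n
    by (induction n) (auto simp: concat_replicate_Suc simp del: replicate.simps)
  have "lim_cov (replicate p True) (replicate q True) =
      complex_of_real (\<Sum>a = 1..min p q. real a * \<gamma> ^ ((p + q) div 2) *
             binom_real p ((real p - real a) / 2) * binom_real q ((real q - real a) / 2))"
    unfolding k_replicate[OF assms(6)] of_real_sum
  proof (intro sum.cong refl)
    fix a assume "a \<in> {1..min p q}"
    then show "of_nat a * letter_cov ?g True True ^ a * paths ?g p a * paths ?g q a =
        complex_of_real (real a * \<gamma> ^ ((p + q) div 2) *
          binom_real p ((real p - real a) / 2) * binom_real q ((real q - real a) / 2))"
      using paths_mult_of_real[of a p q \<gamma> \<gamma> 1] by (auto simp: letter_cov_def)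
  qed
  moreover have "lim_cov (replicate p True) (replicate q False) =
      complex_of_real (\<Sum>a = 1..min p q. real a * \<gamma> ^ ((p + q) div 2 - a) *
             binom_real p ((real p - real a) / 2) * binom_real q ((real q - real a) / 2))"
    unfolding k_replicate[OF assms(6)] of_real_sum
  proof (intro sum.cong refl)
    fix a assume "a \<in> {1..min p q}"
    then show "of_nat a * letter_cov ?g True False ^ a * paths ?g p a * paths ?g q a =
        complex_of_real (real a * \<gamma> ^ ((p + q) div 2 - a) *
          binom_real p ((real p - real a) / 2) * binom_real q ((real q - real a) / 2))"
      using paths_mult_of_real[of a p q 1 \<gamma> 0] by (auto simp: letter_cov_def)
  qed
  moreover have "lim_cov (map even [0..<2 * p]) (map even [0..<2 * q]) =
      complex_of_real (\<Sum>a = 1..min p q. real a * (\<gamma> ^ (2 * a) + 1) *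
             real ((2 * p) choose (p - a)) * real ((2 * q) choose (q - a)))"
  proof -
    have "lim_cov (map even [0..<2 * p]) (map even [0..<2 * q]) =
      (\<Sum>a = 1..p. of_nat a * (?g ^ (2 * a) + 1) * paths 1 (2 * p) (2 * a) * paths 1 (2 * q) (2 * a))"
      using k_even[OF assms(6), of p] by simp
    also have "\<dots> = (\<Sum>a = 1..min p q. of_nat a * (?g ^ (2 * a) + 1) * paths 1 (2 * p) (2 * a) * paths 1 (2 * q) (2 * a))"
      by (rule sum.mono_neutral_right) (auto simp: paths_eq_0)
    also have "\<dots> = complex_of_real (\<Sum>a = 1..min p q. real a * (\<gamma> ^ (2 * a) + 1) *
             real ((2 * p) choose (p - a)) * real ((2 * q) choose (q - a)))"
      unfolding of_real_sum by (intro sum.cong refl) (simp add: paths_1_even)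
    finally show ?thesis .
  qed
  ultimately show ?thesis
    using limit[where B = "\<lambda>A. A ^\<^sub>m p" and C = "\<lambda>A. A ^\<^sub>m q", OF power[OF repX] power[OF repX]]
      limit[where B = "\<lambda>A. A ^\<^sub>m p" and C = "\<lambda>A. mat_adjoint A ^\<^sub>m q", OF power[OF repX] power[OF repA]]
      limit[where B = "\<lambda>A. (A * mat_adjoint A) ^\<^sub>m p" and C = "\<lambda>A. (A * mat_adjoint A) ^\<^sub>m q",
        OF power[OF repXA] power[OF repXA]]
    unfolding rep1 rep2 by simp
qed

end
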